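(* Fix $D\ge 3$ and $\delta\ge0$. The number of schemes of degree $\delta$ is finite.
   Context: Fix an integer $D\geq3$. A colored graph is a finite connected bipartite multigraph (black/white vertices, multiple edges allowed) with edges colored in $\{0,\dots,D\}$, every vertex incident to exactly one edge of each color; rooted if it has a distinguished root edge. Faces of color $(c,c')$, $c<c'$, are the cycles formed by edges of colors $c,c'$; with $F$ faces in total and $2k$ vertices, the degree is $\frac12D(D-1)k+D-F$. A melon in a rooted colored graph is a pair of vertices with $D$ parallel edges between them none of which is the root edge; a melon-free graph has none (the empty graph counts as melon-free). A $(D-1)$-dipole is a pair of vertices (one white, one black) joined by exactly $D-1$ parallel edges. A pre-chain is a sequence $d_1,\dots,d_p$ ($p\ge1$) of $(D-1)$-dipoles such that for $i<p$ the white vertex of $d_i$ is joined to the black vertex of $d_{i+1}$ and the black vertex of $d_i$ to the white vertex of $d_{i+1}$; the internal vertices are those of the $d_i$; the left external half-edges $\ell_\circ,\ell_\bullet$ are the half-edges at the white/black vertex of $d_1$ not in edges between internal vertices, the right ones $r_\circ,r_\bullet$ likewise at $d_p$; no two external half-edges may be halves of one edge and the root edge is not an edge between internal vertices. It is proper if $p\ge2$; maximal proper if it is proper and not contained in a larger proper pre-chain. It is a chain if $\ell_\circ,\ell_\bullet$ have the same color $i$ (then $r_\circ,r_\bullet$ share a color $j$; external colors $(i,j)$). A chain is broken if for every color $k\ne i$, $\ell_\circ,\ell_\bullet$ lie in the same face of colors $\{i,k\}$, unbroken otherwise; an unbroken chain with external colors $(i,i)$ has secondary color $j$, the color for which $\ell_\circ,\ell_\bullet$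 are in different faces of colors $\{i,j\}$. Chain types: broken with external colors $(i,j)$; unbroken with $(i,j)$, $i\ne j$; unbroken with $(i,i)$ and secondary color $j$. A scheme is a rooted graph with colored edges whose vertices are regular (black/white, one edge of each color) or chain-vertices (abstract vertices with four attachment points left-white, left-black, right-white, right-black, labelled by a chain type); it is reduced if it contains no proper chain. The scheme of a melon-free rooted colored graph is obtained by replacing each maximal proper pre-chain that is a chain by a chain-vertex of the same type attached to its four external half-edges. Two melon-free rooted colored graphs with the same scheme have the same degree; the schemes of degree $\delta$ are the schemes of melon-free rooted colored graphs of degree $\delta$ (counted up to isomorphism). *)

theory Defs
  imports Main
begin

section \<open>Rooted colored graphs\<close>

text \<open>
  Every edge has one white and one black end, so a half-edge is an edge together with a choice
  of its white or its black side.
\<close>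

record ('v, 'e) graph =
  whites :: "'v set"
  blacks :: "'v set"
  edges :: "'e set"
  white_end :: "'e \<Rightarrow> 'v"
  black_end :: "'e \<Rightarrow> 'v"
  color :: "'e \<Rightarrow> nat"
  root :: "'e option"

definition verts :: "('v, 'e) graph \<Rightarrow> 'v set" where
  "verts G = whites G \<union> blacks G"

definition adjacency :: "('v, 'e) graph \<Rightarrow> 'e set \<Rightarrow> ('v \<times> 'v) set" where
  "adjacency G F = {(u, v). \<exists>e\<in>F. {u, v} = {white_end G e, black_end G e}}"

definition colored_graph :: "nat \<Rightarrow> ('v, 'e) graph \<Rightarrow> bool" where
  "colored_graph D G \<longleftrightarrow>
     finite (verts G) \<and> finite (edges G) \<and>
     whites G \<inter> blacks G = {} \<and>
     (\<forall>e\<in>edges G. white_end G e \<in> whites G \<and> black_end G e \<in> blacks G \<and> color G e \<le> D) \<and>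
     (\<forall>w\<in>whites G. \<forall>c\<le>D. \<exists>!e. e \<in> edges G \<and> white_end G e = w \<and> color G e = c) \<and>
     (\<forall>b\<in>blacks G. \<forall>c\<le>D. \<exists>!e. e \<in> edges G \<and> black_end G e = b \<and> color G e = c) \<and>
     verts G \<noteq> {} \<and>
     (\<forall>u\<in>verts G. \<forall>v\<in>verts G. (u, v) \<in> (adjacency G (edges G))\<^sup>*)"

definition empty_graph :: "('v, 'e) graph \<Rightarrow> bool" where
  "empty_graph G \<longleftrightarrow> verts G = {} \<and> edges G = {} \<and> root G = None"

definition rooted_colored_graph :: "nat \<Rightarrow> ('v, 'e) graph \<Rightarrow> bool" where
  "rooted_colored_graph D G \<longleftrightarrow>
     colored_graph D G \<and> (\<exists>e\<in>edges G. root G = Some e) \<or> empty_graph G"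

text \<open>A face is represented by the set of edges of the cycle.\<close>

definition faces :: "('v, 'e) graph \<Rightarrow> nat \<Rightarrow> nat \<Rightarrow> 'e set set" where
  "faces G c c' =
     (let F = {e \<in> edges G. color G e \<in> {c, c'}}
      in (\<lambda>v. {e \<in> F. (v, white_end G e) \<in> (adjacency G F)\<^sup>*}) ` verts G)"

text \<open>
  The empty rooted graph stands for a single root edge closed on itself, which lies in one
  face for each of the \<open>D\<close> other colors; thus it has degree \<open>0\<close>.
\<close>

definition num_faces :: "nat \<Rightarrow> ('v, 'e) graph \<Rightarrow> nat" where
  "num_faces D G =
     (if empty_graph G then D
      else \<Sum>(c, c') \<in> {(c, c'). c < c' \<and> c' \<le> D}. card (faces G c c'))"

definition degree :: "nat \<Rightarrow> ('v, 'e) graph \<Rightarrow> int" where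
  "degree D G =
     int (D * (D - 1) div 2) * int (card (verts G) div 2) + int D - int (num_faces D G)"

definition edges_between :: "('v, 'e) graph \<Rightarrow> 'v \<Rightarrow> 'v \<Rightarrow> 'e set" where
  "edges_between G w b = {e \<in> edges G. white_end G e = w \<and> black_end G e = b}"

definition melon :: "nat \<Rightarrow> ('v, 'e) graph \<Rightarrow> 'v \<Rightarrow> 'v \<Rightarrow> bool" where
  "melon D G w b \<longleftrightarrow> w \<in> whites G \<and> b \<in> blacks G \<and>
     (\<exists>F \<subseteq> edges_between G w b. card F = D \<and> root G \<notin> Some ` F)"

definition melon_free :: "nat \<Rightarrow> ('v, 'e) graph \<Rightarrow> bool" where
  "melon_free D G \<longleftrightarrow> (\<nexists>w b. melon D G w b)"


section \<open>Chains\<close>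

text \<open>
  A dipole is given by its white and its black vertex. The external half-edges are given by the
  edges they belong to; the suffixes \<open>w\<close> and \<open>b\<close> tell the side. A pre-chain read
  in the opposite direction, with left and right exchanged, is a different element of this type.
\<close>

record ('v, 'e) prechain =
  dipoles :: "('v \<times> 'v) list"
  left_w :: 'e
  left_b :: 'e
  right_w :: 'e
  right_b :: 'e

definition dipole :: "nat \<Rightarrow> ('v, 'e) graph \<Rightarrow> 'v \<Rightarrow> 'v \<Rightarrow> bool" where
  "dipole D G w b \<longleftrightarrow> w \<in> whites G \<and> b \<in> blacks G \<and> card (edges_between G w b) = D - 1"

definition internal_verts :: "('v, 'e) prechain \<Rightarrow> 'v set" where
  "internal_verts p = fst ` set (dipoles p) \<union> snd ` set (dipoles p)"

definition internal_edges :: "('v, 'e) graph \<Rightarrow> ('v, 'e) prechain \<Rightarrow> 'e set" where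
  "internal_edges G p =
     {e \<in> edges G. white_end G e \<in> internal_verts p \<and> black_end G e \<in> internal_verts p}"

text \<open>
  For a single dipole, the condition that the four edges be distinct also says that the left and
  the right half-edge at a vertex are different; the distribution is then part of the data.
\<close>

definition prechain :: "nat \<Rightarrow> ('v, 'e) graph \<Rightarrow> ('v, 'e) prechain \<Rightarrow> bool" where
  "prechain D G p \<longleftrightarrow> (let ds = dipoles p in
     ds \<noteq> [] \<and> distinct (map fst ds) \<and> distinct (map snd ds) \<and>
     (\<forall>(w, b) \<in> set ds. dipole D G w b) \<and>
     (\<forall>i. Suc i < length ds \<longrightarrow>
        edges_between G (fst (ds ! i)) (snd (ds ! Suc i)) \<noteq> {} \<and>
        edges_between G (fst (ds ! Suc i)) (snd (ds ! i)) \<noteq> {}) \<and>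
     {left_w p, left_b p, right_w p, right_b p} \<subseteq> edges G - internal_edges G p \<and>
     white_end G (left_w p) = fst (hd ds) \<and> black_end G (left_b p) = snd (hd ds) \<and>
     white_end G (right_w p) = fst (last ds) \<and> black_end G (right_b p) = snd (last ds) \<and>
     distinct [left_w p, left_b p, right_w p, right_b p] \<and>
     root G \<notin> Some ` internal_edges G p)"

definition proper_prechain :: "nat \<Rightarrow> ('v, 'e) graph \<Rightarrow> ('v, 'e) prechain \<Rightarrow> bool" where
  "proper_prechain D G p \<longleftrightarrow> prechain D G p \<and> length (dipoles p) \<ge> 2"

definition maximal_proper_prechain :: "nat \<Rightarrow> ('v, 'e) graph \<Rightarrow> ('v, 'e) prechain \<Rightarrow> bool" where
  "maximal_proper_prechain D G p \<longleftrightarrow> proper_prechain D G p \<and>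
     (\<nexists>q. proper_prechain D G q \<and> set (dipoles p) \<subset> set (dipoles q))"

definition is_chain :: "('v, 'e) graph \<Rightarrow> ('v, 'e) prechain \<Rightarrow> bool" where
  "is_chain G p \<longleftrightarrow> color G (left_w p) = color G (left_b p)"

text \<open>
  Faces are followed inside the chain only: the left external half-edges, of color \<open>i\<close>,
  lie in the same face of colors \<open>i, k\<close> of the chain iff the end vertices of the first
  dipole are linked by internal edges of these colors. How the face closes up outside the chain
  is irrelevant, since the type has to determine the effect of the chain on the degree.
\<close>

definition left_same_face :: "('v, 'e) graph \<Rightarrow> ('v, 'e) prechain \<Rightarrow> nat \<Rightarrow> bool" where
  "left_same_face G p k \<longleftrightarrow>
     hd (dipoles p) \<in>
       (adjacency G {e \<in> internal_edges G p. color G e \<in> {color G (left_w p), k}})\<^sup>*"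

definition broken :: "nat \<Rightarrow> ('v, 'e) graph \<Rightarrow> ('v, 'e) prechain \<Rightarrow> bool" where
  "broken D G p \<longleftrightarrow> (\<forall>k\<le>D. k \<noteq> color G (left_w p) \<longrightarrow> left_same_face G p k)"

text \<open>
  \<open>UnbrokenDiff i j\<close> has external colors \<open>(i, j)\<close> with \<open>i \<noteq> j\<close>, and
  \<open>UnbrokenSame i j\<close> has external colors \<open>(i, i)\<close> and secondary color \<open>j\<close>.
\<close>

datatype chain_type = Broken nat nat | UnbrokenDiff nat nat | UnbrokenSame nat nat

definition type_of_chain :: "nat \<Rightarrow> ('v, 'e) graph \<Rightarrow> ('v, 'e) prechain \<Rightarrow> chain_type" where
  "type_of_chain D G p = (let i = color G (left_w p); j = color G (right_w p) in
     if broken D G p then Broken i j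
     else if i \<noteq> j then UnbrokenDiff i j
     else UnbrokenSame i (THE k. k \<le> D \<and> k \<noteq> i \<and> \<not> left_same_face G p k))"


section \<open>Schemes\<close>

text \<open>
  The white end of an edge is attached to a regular white vertex or to the left-white or
  right-white point of a chain-vertex, and similarly for its black end.
\<close>

datatype side = Left | Right

datatype ('v, 'c) attachment = Regular 'v | Port 'c side

record ('v, 'e, 'c) scheme =
  reg_whites :: "'v set"
  reg_blacks :: "'v set"
  chain_verts :: "'c set"
  chain_type :: "'c \<Rightarrow> chain_type"
  sedges :: "'e set"
  swhite_end :: "'e \<Rightarrow> ('v, 'c) attachment"
  sblack_end :: "'e \<Rightarrow> ('v, 'c) attachment"
  scolor :: "'e \<Rightarrow> nat"
  sroot :: "'e option"

fun external_color :: "chain_type \<Rightarrow> side \<Rightarrow> nat" where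
  "external_color (Broken i j) s = (case s of Left \<Rightarrow> i | Right \<Rightarrow> j)"
| "external_color (UnbrokenDiff i j) s = (case s of Left \<Rightarrow> i | Right \<Rightarrow> j)"
| "external_color (UnbrokenSame i j) s = i"

fun valid_type :: "nat \<Rightarrow> chain_type \<Rightarrow> bool" where
  "valid_type D (Broken i j) \<longleftrightarrow> i \<le> D \<and> j \<le> D"
| "valid_type D (UnbrokenDiff i j) \<longleftrightarrow> i \<le> D \<and> j \<le> D \<and> i \<noteq> j"
| "valid_type D (UnbrokenSame i j) \<longleftrightarrow> i \<le> D \<and> j \<le> D \<and> i \<noteq> j"

definition is_scheme :: "nat \<Rightarrow> ('v, 'e, 'c) scheme \<Rightarrow> bool" where
  "is_scheme D S \<longleftrightarrow>
     finite (reg_whites S) \<and> finite (reg_blacks S) \<and> finite (chain_verts S) \<and>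
     finite (sedges S) \<and> reg_whites S \<inter> reg_blacks S = {} \<and>
     (\<forall>c\<in>chain_verts S. valid_type D (chain_type S c)) \<and>
     (\<forall>e\<in>sedges S. scolor S e \<le> D \<and>
        swhite_end S e \<in> Regular ` reg_whites S \<union> (\<Union>c\<in>chain_verts S. range (Port c)) \<and>
        sblack_end S e \<in> Regular ` reg_blacks S \<union> (\<Union>c\<in>chain_verts S. range (Port c))) \<and>
     (\<forall>w\<in>reg_whites S. \<forall>c\<le>D.
        \<exists>!e. e \<in> sedges S \<and> swhite_end S e = Regular w \<and> scolor S e = c) \<and>
     (\<forall>b\<in>reg_blacks S. \<forall>c\<le>D.
        \<exists>!e. e \<in> sedges S \<and> sblack_end S e = Regular b \<and> scolor S e = c) \<and>
     (\<forall>c\<in>chain_verts S. \<forall>s.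
        (\<exists>e\<in>sedges S. {e' \<in> sedges S. swhite_end S e' = Port c s} = {e} \<and>
           scolor S e = external_color (chain_type S c) s) \<and>
        (\<exists>e\<in>sedges S. {e' \<in> sedges S. sblack_end S e' = Port c s} = {e} \<and>
           scolor S e = external_color (chain_type S c) s)) \<and>
     (case sroot S of
        Some e \<Rightarrow> e \<in> sedges S
      | None \<Rightarrow> reg_whites S = {} \<and> reg_blacks S = {} \<and> chain_verts S = {} \<and> sedges S = {})"

text \<open>
  The chains to be replaced, each in one of its two directions. If the maximal proper pre-chains
  that are chains are pairwise disjoint, all of them are chosen. They may overlap in one
  situation: when the dipoles \<open>d\<^sub>1, \<dots>, d\<^sub>m\<close> with \<open>m \<ge> 3\<close> are joined
  consecutively and an external half-edge at \<open>d\<^sub>1\<close> and one at \<open>d\<^sub>m\<close> are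
  halves of one edge, both \<open>d\<^sub>1, \<dots>, d\<^bsub>m-1\<^esub>\<close> and
  \<open>d\<^sub>2, \<dots>, d\<^sub>m\<close> can be maximal; only one of them can then be replaced,
  and either choice is admitted.
\<close>

definition replaced_chains ::
    "nat \<Rightarrow> ('v, 'e) graph \<Rightarrow> ('v, 'e) prechain set \<Rightarrow> bool" where
  "replaced_chains D G P \<longleftrightarrow>
     (\<forall>p\<in>P. maximal_proper_prechain D G p \<and> is_chain G p) \<and>
     (\<forall>p\<in>P. \<forall>q\<in>P. p \<noteq> q \<longrightarrow> internal_verts p \<inter> internal_verts q = {}) \<and>
     (\<forall>p. maximal_proper_prechain D G p \<and> is_chain G p \<longrightarrow>
        (\<exists>q\<in>P. internal_verts p \<inter> internal_verts q \<noteq> {}))"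

definition attach ::
    "('v, 'e) prechain set \<Rightarrow> (('v, 'e) prechain \<Rightarrow> 'e) \<Rightarrow> 'e \<Rightarrow> 'v \<Rightarrow>
     ('v, ('v, 'e) prechain) attachment" where
  "attach P left e v =
     (if \<exists>p\<in>P. v \<in> internal_verts p
      then (let p = (THE p. p \<in> P \<and> v \<in> internal_verts p)
            in Port p (if e = left p then Left else Right))
      else Regular v)"

definition replace ::
    "nat \<Rightarrow> ('v, 'e) graph \<Rightarrow> ('v, 'e) prechain set \<Rightarrow> ('v, 'e, ('v, 'e) prechain) scheme" where
  "replace D G P =
     \<lparr>reg_whites = whites G - \<Union>(internal_verts ` P),
      reg_blacks = blacks G - \<Union>(internal_verts ` P),
      chain_verts = P,
      chain_type = type_of_chain D G,
      sedges = edges G - \<Union>(internal_edges G ` P),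
      swhite_end = (\<lambda>e. attach P left_w e (white_end G e)),
      sblack_end = (\<lambda>e. attach P left_b e (black_end G e)),
      scolor = color G,
      sroot = root G\<rparr>"

definition is_scheme_of ::
    "nat \<Rightarrow> ('v, 'e) graph \<Rightarrow> ('v, 'e, ('v, 'e) prechain) scheme \<Rightarrow> bool" where
  "is_scheme_of D G S \<longleftrightarrow> (\<exists>P. replaced_chains D G P \<and> S = replace D G P)"

text \<open>Every finite graph is isomorphic to one whose vertices and edges are natural numbers.\<close>

definition schemes_of_degree ::
    "nat \<Rightarrow> nat \<Rightarrow> (nat, nat, (nat, nat) prechain) scheme set" where
  "schemes_of_degree D \<delta> =
     {S. \<exists>G. rooted_colored_graph D G \<and> melon_free D G \<and> degree D G = int \<delta> \<and>
            is_scheme_of D G S}"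


section \<open>Isomorphism of schemes\<close>

text \<open>
  The direction in which a chain is read is arbitrary, so an isomorphism may exchange left and
  right at any chain-vertex; \<open>\<phi>\<close> tells where it does.
\<close>

fun flip_side :: "side \<Rightarrow> side" where
  "flip_side Left = Right"
| "flip_side Right = Left"

fun flip_type :: "chain_type \<Rightarrow> chain_type" where
  "flip_type (Broken i j) = Broken j i"
| "flip_type (UnbrokenDiff i j) = UnbrokenDiff j i"
| "flip_type (UnbrokenSame i j) = UnbrokenSame i j"

fun carry_attachment :: "('v \<Rightarrow> 'w) \<Rightarrow> ('c \<Rightarrow> 'd) \<Rightarrow> ('c \<Rightarrow> bool) \<Rightarrow>
    ('v, 'c) attachment \<Rightarrow> ('w, 'd) attachment" where
  "carry_attachment f h \<phi> (Regular v) = Regular (f v)"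
| "carry_attachment f h \<phi> (Port c s) = Port (h c) (if \<phi> c then flip_side s else s)"

definition scheme_isomorphism ::
    "('v \<Rightarrow> 'w) \<Rightarrow> ('c \<Rightarrow> 'd) \<Rightarrow> ('c \<Rightarrow> bool) \<Rightarrow> ('e \<Rightarrow> 'f) \<Rightarrow>
     ('v, 'e, 'c) scheme \<Rightarrow> ('w, 'f, 'd) scheme \<Rightarrow> bool" where
  "scheme_isomorphism f h \<phi> g S T \<longleftrightarrow>
     bij_betw f (reg_whites S \<union> reg_blacks S) (reg_whites T \<union> reg_blacks T) \<and>
     f ` reg_whites S = reg_whites T \<and> f ` reg_blacks S = reg_blacks T \<and>
     bij_betw h (chain_verts S) (chain_verts T) \<and>
     (\<forall>c\<in>chain_verts S. chain_type T (h c) =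
        (if \<phi> c then flip_type (chain_type S c) else chain_type S c)) \<and>
     bij_betw g (sedges S) (sedges T) \<and>
     (\<forall>e\<in>sedges S. scolor T (g e) = scolor S e \<and>
        swhite_end T (g e) = carry_attachment f h \<phi> (swhite_end S e) \<and>
        sblack_end T (g e) = carry_attachment f h \<phi> (sblack_end S e)) \<and>
     sroot T = map_option g (sroot S)"

definition scheme_iso :: "nat \<Rightarrow> (('v, 'e, 'c) scheme \<times> ('v, 'e, 'c) scheme) set" where
  "scheme_iso D =
     {(S, T). is_scheme D S \<and> is_scheme D T \<and> (\<exists>f h \<phi> g. scheme_isomorphism f h \<phi> g S T)}"

lemma flip_side_flip [simp]: "flip_side (flip_side s) = s"
  by (cases s) auto

lemma flip_type_flip [simp]: "flip_type (flip_type t) = t"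
  by (cases t) auto

lemma scheme_isomorphism_trans:
  assumes "scheme_isomorphism f h \<phi> g S T" "scheme_isomorphism f' h' \<phi>' g' T U"
  shows "scheme_isomorphism (f' \<circ> f) (h' \<circ> h) (\<lambda>c. \<phi> c \<noteq> \<phi>' (h c)) (g' \<circ> g) S U"
proof -
  have m: "carry_attachment f' h' \<phi>' (carry_attachment f h \<phi> a) =
      carry_attachment (f' \<circ> f) (h' \<circ> h) (\<lambda>c. \<phi> c \<noteq> \<phi>' (h c)) a" for a
    by (cases a) auto
  have "h c \<in> chain_verts T" if "c \<in> chain_verts S" for c
    using assms(1) that unfolding scheme_isomorphism_def bij_betw_def by blast
  moreover have "g e \<in> sedges T" if "e \<in> sedges S" for e
    using assms(1) that unfolding scheme_isomorphism_def bij_betw_def by blast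
  moreover have "bij_betw (f' \<circ> f) (reg_whites S \<union> reg_blacks S) (reg_whites U \<union> reg_blacks U)"
    "bij_betw (h' \<circ> h) (chain_verts S) (chain_verts U)"
    "bij_betw (g' \<circ> g) (sedges S) (sedges U)"
    using assms unfolding scheme_isomorphism_def by (meson bij_betw_trans)+
  moreover have "(f' \<circ> f) ` reg_whites S = reg_whites U" "(f' \<circ> f) ` reg_blacks S = reg_blacks U"
    using assms unfolding scheme_isomorphism_def image_comp[symmetric] by auto
  ultimately show ?thesis
    using assms unfolding scheme_isomorphism_def by (simp add: m option.map_comp)
qed

lemma carry_attachment_id [simp]: "carry_attachment id id (\<lambda>_. False) a = a"
  by (cases a) auto

lemma scheme_isomorphism_refl: "scheme_isomorphism id id (\<lambda>_. False) id S S"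
  by (auto simp: scheme_isomorphism_def option.map_id)

lemma scheme_isomorphism_sym:
  assumes S: "is_scheme D S" and iso: "scheme_isomorphism f h \<phi> g S T"
  shows "\<exists>f' h' \<phi>' g'. scheme_isomorphism f' h' \<phi>' g' T S"
proof -
  let ?V = "reg_whites S \<union> reg_blacks S"
  let ?f = "inv_into ?V f" and ?h = "inv_into (chain_verts S) h" and ?g = "inv_into (sedges S) g"
  let ?\<phi> = "\<lambda>c. \<phi> (?h c)"
  have f: "bij_betw f ?V (reg_whites T \<union> reg_blacks T)" "f ` reg_whites S = reg_whites T"
      "f ` reg_blacks S = reg_blacks T"
    and h: "bij_betw h (chain_verts S) (chain_verts T)"
    and g: "bij_betw g (sedges S) (sedges T)"
    using iso unfolding scheme_isomorphism_def by auto
  have fi: "?f (f v) = v" if "v \<in> ?V" for v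
    using f(1) that by (meson bij_betw_inv_into_left)
  have hi: "?h (h c) = c" if "c \<in> chain_verts S" for c
    using h that by (meson bij_betw_inv_into_left)
  have gi: "?g (g e) = e" if "e \<in> sedges S" for e
    using g that by (meson bij_betw_inv_into_left)
  have Te: "\<exists>e'\<in>sedges S. e = g e'" if "e \<in> sedges T" for e
    using g that unfolding bij_betw_def by blast
  have Tc: "\<exists>c'\<in>chain_verts S. c = h c'" if "c \<in> chain_verts T" for c
    using h that unfolding bij_betw_def by blast
  have m: "carry_attachment ?f ?h ?\<phi> (carry_attachment f h \<phi> a) = a"
    if "a \<in> Regular ` ?V \<union> (\<Union>c\<in>chain_verts S. range (Port c))" for a
    using that fi hi by auto
  have at: "swhite_end S e \<in> Regular ` ?V \<union> (\<Union>c\<in>chain_verts S. range (Port c))"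
     "sblack_end S e \<in> Regular ` ?V \<union> (\<Union>c\<in>chain_verts S. range (Port c))" if "e \<in> sedges S" for e
  proof -
    have "\<forall>e\<in>sedges S. scolor S e \<le> D \<and>
        swhite_end S e \<in> Regular ` reg_whites S \<union> (\<Union>c\<in>chain_verts S. range (Port c)) \<and>
        sblack_end S e \<in> Regular ` reg_blacks S \<union> (\<Union>c\<in>chain_verts S. range (Port c))"
      using S unfolding is_scheme_def by (elim conjE)
    from bspec[OF this that] show
      "swhite_end S e \<in> Regular ` ?V \<union> (\<Union>c\<in>chain_verts S. range (Port c))"
      "sblack_end S e \<in> Regular ` ?V \<union> (\<Union>c\<in>chain_verts S. range (Port c))"
      unfolding image_Un by (meson UnE UnI1 UnI2)+
  qed
  have W: "?f ` reg_whites T = reg_whites S" "?f ` reg_blacks T = reg_blacks S"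
    unfolding f(2,3)[symmetric] image_image using fi by auto
  have r: "sroot S = map_option ?g (sroot T)"
  proof (cases "sroot S")
    case None
    then show ?thesis using iso by (simp add: scheme_isomorphism_def)
  next
    case (Some e)
    then have "e \<in> sedges S" using S by (simp add: is_scheme_def)
    then show ?thesis using iso Some gi by (simp add: scheme_isomorphism_def)
  qed
  have "scheme_isomorphism ?f ?h ?\<phi> ?g T S"
    unfolding scheme_isomorphism_def
  proof (intro conjI ballI)
    fix c assume "c \<in> chain_verts T"
    then obtain c' where c': "c' \<in> chain_verts S" "c = h c'" using Tc by blast
    then show "chain_type S (?h c) =
        (if \<phi> (?h c) then flip_type (chain_type T c) else chain_type T c)"
      using iso hi[OF c'(1)] by (simp add: scheme_isomorphism_def)
  next
    fix e assume "e \<in> sedges T"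
    then obtain e' where e': "e' \<in> sedges S" "e = g e'" using Te by blast
    have *: "scolor T (g e') = scolor S e'"
      "swhite_end T (g e') = carry_attachment f h \<phi> (swhite_end S e')"
      "sblack_end T (g e') = carry_attachment f h \<phi> (sblack_end S e')"
      using iso e'(1) by (auto simp: scheme_isomorphism_def)
    show "scolor S (?g e) = scolor T e"
      "swhite_end S (?g e) = carry_attachment ?f ?h ?\<phi> (swhite_end T e)"
      "sblack_end S (?g e) = carry_attachment ?f ?h ?\<phi> (sblack_end T e)"
      using * e'(2) gi[OF e'(1)] m[OF at(1)[OF e'(1)]] m[OF at(2)[OF e'(1)]] by simp_all
  qed (fact bij_betw_inv_into[OF f(1)] bij_betw_inv_into[OF h] bij_betw_inv_into[OF g] W r)+
  then show ?thesis by blast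
qed

lemma equiv_scheme_iso: "equiv {S. is_scheme D S} (scheme_iso D)"
proof (rule equivI)
  show "scheme_iso D \<subseteq> {S. is_scheme D S} \<times> {S. is_scheme D S}"
    by (auto simp: scheme_iso_def)
  show "refl_on {S. is_scheme D S} (scheme_iso D)"
    unfolding refl_on_def scheme_iso_def using scheme_isomorphism_refl by blast
  show "sym (scheme_iso D)"
    by (auto simp: sym_def scheme_iso_def intro: scheme_isomorphism_sym)
  show "trans (scheme_iso D)"
    unfolding trans_def scheme_iso_def using scheme_isomorphism_trans by fast
qed


section \<open>The scheme of a graph is a scheme\<close>

lemma star_split:
  assumes "finite A" "card A = D + 1" "X \<subseteq> A" "card X = D - 1" "D \<ge> 1"
    "l \<in> A - X" "r \<in> A - X" "l \<noteq> r"
  shows "A = insert l (insert r X)"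
proof -
  have "finite X" using assms finite_subset by blast
  then have "card (insert l (insert r X)) = card A" using assms by auto
  moreover have "insert l (insert r X) \<subseteq> A" using assms by auto
  ultimately show ?thesis using card_subset_eq[OF assms(1)] by metis
qed

lemma star_colors:
  fixes col :: "'e \<Rightarrow> nat"
  assumes "A = insert l (insert r X)" "l \<in> A - X" "r \<in> A - X" "inj_on col A" "col ` A = {..D}"
  shows "{col l, col r} = {..D} - col ` X"
proof -
  have "col l \<notin> col ` X" "col r \<notin> col ` X"
    using assms(1-4) by (auto simp: inj_on_def)
  moreover have "{..D} = {col l, col r} \<union> col ` X" using assms(1,5) by auto
  ultimately show ?thesis by auto
qed

definition wstar :: "('v, 'e) graph \<Rightarrow> 'v \<Rightarrow> 'e set" where
  "wstar G w = {e \<in> edges G. white_end G e = w}"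

definition bstar :: "('v, 'e) graph \<Rightarrow> 'v \<Rightarrow> 'e set" where
  "bstar G b = {e \<in> edges G. black_end G e = b}"

lemma star_bij:
  fixes col :: "'e \<Rightarrow> nat"
  assumes "finite E" "\<forall>e\<in>E. col e \<le> D" "\<forall>c\<le>D. \<exists>!e. e \<in> E \<and> en e = v \<and> col e = c"
  shows "finite {e \<in> E. en e = v}" "inj_on col {e \<in> E. en e = v}"
    "col ` {e \<in> E. en e = v} = {..D}" "card {e \<in> E. en e = v} = D + 1"
proof -
  show 1: "finite {e \<in> E. en e = v}" using assms by auto
  show 2: "inj_on col {e \<in> E. en e = v}" using assms(2,3) unfolding inj_on_def by blast
  show 3: "col ` {e \<in> E. en e = v} = {..D}"
  proof
    show "col ` {e \<in> E. en e = v} \<subseteq> {..D}" using assms(2) by auto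
    show "{..D} \<subseteq> col ` {e \<in> E. en e = v}"
    proof
      fix c assume "c \<in> {..D}"
      then obtain e where "e \<in> E \<and> en e = v \<and> col e = c" using assms(3) by auto
      then show "c \<in> col ` {e \<in> E. en e = v}" by auto
    qed
  qed
  show "card {e \<in> E. en e = v} = D + 1" using card_image[OF 2] 3 by simp
qed

lemma wstar_bij:
  assumes "colored_graph D G" "w \<in> whites G"
  shows "finite (wstar G w)" "inj_on (color G) (wstar G w)"
    "color G ` wstar G w = {..D}" "card (wstar G w) = D + 1"
  using star_bij[of "edges G" "color G" D "white_end G" w] assms
  unfolding colored_graph_def wstar_def by auto

lemma bstar_bij:
  assumes "colored_graph D G" "b \<in> blacks G"
  shows "finite (bstar G b)" "inj_on (color G) (bstar G b)"
    "color G ` bstar G b = {..D}" "card (bstar G b) = D + 1"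
  using star_bij[of "edges G" "color G" D "black_end G" b] assms
  unfolding colored_graph_def bstar_def by auto

context
  fixes D :: nat and G :: "('v, 'e) graph" and p :: "('v, 'e) prechain"
  assumes G: "colored_graph D G" and p: "prechain D G p" and D: "D \<ge> 1"
begin

private abbreviation (input) "n \<equiv> length (dipoles p)"
private abbreviation (input) "w m \<equiv> fst (dipoles p ! m)"
private abbreviation (input) "b m \<equiv> snd (dipoles p ! m)"

private lemma n_pos: "n > 0" using p by (auto simp: prechain_def Let_def)

private lemma verts_in: "m < n \<Longrightarrow> w m \<in> whites G" "m < n \<Longrightarrow> b m \<in> blacks G"
  "m < n \<Longrightarrow> card (edges_between G (w m) (b m)) = D - 1"
  "m < n \<Longrightarrow> w m \<in> internal_verts p" "m < n \<Longrightarrow> b m \<in> internal_verts p"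
proof -
  assume m: "m < n"
  then have "(w m, b m) \<in> set (dipoles p)" by simp
  moreover have "\<forall>(w, b) \<in> set (dipoles p). dipole D G w b"
    using p by (simp add: prechain_def Let_def)
  ultimately show "w m \<in> whites G" "b m \<in> blacks G" "card (edges_between G (w m) (b m)) = D - 1"
    "w m \<in> internal_verts p" "b m \<in> internal_verts p"
    unfolding dipole_def internal_verts_def by force+
qed

private lemma inj: "i < n \<Longrightarrow> j < n \<Longrightarrow> w i = w j \<longleftrightarrow> i = j" "i < n \<Longrightarrow> j < n \<Longrightarrow> b i = b j \<longleftrightarrow> i = j"
proof -
  assume a: "i < n" "j < n"
  have "distinct (map fst (dipoles p))" "distinct (map snd (dipoles p))"
    using p by (auto simp: prechain_def Let_def)
  then show "w i = w j \<longleftrightarrow> i = j" "b i = b j \<longleftrightarrow> i = j"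
    using a nth_eq_iff_index_eq[of "map fst (dipoles p)" i j]
      nth_eq_iff_index_eq[of "map snd (dipoles p)" i j] by auto
qed

lemma external_ends: "left_w p \<in> edges G" "left_b p \<in> edges G" "right_w p \<in> edges G" "right_b p \<in> edges G"
  "left_w p \<notin> internal_edges G p" "left_b p \<notin> internal_edges G p"
  "right_w p \<notin> internal_edges G p" "right_b p \<notin> internal_edges G p"
  "white_end G (left_w p) = w 0" "black_end G (left_b p) = b 0"
  "white_end G (right_w p) = w (n - 1)" "black_end G (right_b p) = b (n - 1)"
  "left_w p \<noteq> right_w p" "left_b p \<noteq> right_b p"
  using p n_pos by (auto simp: prechain_def Let_def hd_conv_nth last_conv_nth)

private definition "Lw m = (if m = 0 then left_w p else SOME e. e \<in> edges_between G (w m) (b (m - 1)))"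
private definition "Lb m = (if m = 0 then left_b p else SOME e. e \<in> edges_between G (w (m - 1)) (b m))"
private definition "Rw m = (if Suc m = n then right_w p else Lb (Suc m))"
private definition "Rb m = (if Suc m = n then right_b p else Lw (Suc m))"

private lemma link: "Suc m < n \<Longrightarrow> Lw (Suc m) \<in> edges_between G (w (Suc m)) (b m)"
  "Suc m < n \<Longrightarrow> Lb (Suc m) \<in> edges_between G (w m) (b (Suc m))"
proof -
  assume "Suc m < n"
  then have "edges_between G (w m) (b (Suc m)) \<noteq> {}" "edges_between G (w (Suc m)) (b m) \<noteq> {}"
    using p by (auto simp: prechain_def Let_def)
  then show "Lw (Suc m) \<in> edges_between G (w (Suc m)) (b m)"
    "Lb (Suc m) \<in> edges_between G (w m) (b (Suc m))"
    unfolding Lw_def Lb_def by (auto intro: someI)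
qed

private lemma internal_between:
  "i < n \<Longrightarrow> j < n \<Longrightarrow> edges_between G (w i) (b j) \<subseteq> internal_edges G p"
  using verts_in by (auto simp: edges_between_def internal_edges_def)

private lemma wsplit:
  assumes m: "m < n"
  shows "wstar G (w m) = insert (Lw m) (insert (Rw m) (edges_between G (w m) (b m)))"
    "Lw m \<in> wstar G (w m) - edges_between G (w m) (b m)"
    "Rw m \<in> wstar G (w m) - edges_between G (w m) (b m)"
proof -
  let ?X = "edges_between G (w m) (b m)"
  have X: "?X \<subseteq> wstar G (w m)" by (auto simp: edges_between_def wstar_def)
  show l: "Lw m \<in> wstar G (w m) - ?X"
  proof (cases m)
    case 0
    then show ?thesis using external_ends internal_between[OF m m] by (auto simp: Lw_def wstar_def)
  next
    case (Suc k)
    then show ?thesis using link(1)[of k] m inj(2)[of k m] by (auto simp: wstar_def edges_between_def)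
  qed
  show r: "Rw m \<in> wstar G (w m) - ?X"
  proof (cases "Suc m = n")
    case True
    then have "m = n - 1" by simp
    then show ?thesis using True external_ends internal_between[OF m m] by (auto simp: Rw_def wstar_def)
  next
    case False
    then show ?thesis using link(2)[of m] m inj(2)[of m "Suc m"]
      by (auto simp: wstar_def edges_between_def Rw_def)
  qed
  have "Lw m \<noteq> Rw m"
  proof (cases m)
    case 0
    show ?thesis
    proof (cases "Suc m = n")
      case True then show ?thesis using 0 external_ends by (auto simp: Lw_def Rw_def)
    next
      case False
      then show ?thesis using 0 external_ends link(2)[of 0] internal_between[of 0 1] m
        by (auto simp: Lw_def Rw_def)
    qed
  next
    case (Suc k)
    show ?thesis
    proof (cases "Suc m = n")
      case True
      then show ?thesis using Suc external_ends link(1)[of k] internal_between[of m k] m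
        by (auto simp: Rw_def)
    next
      case False
      then show ?thesis using Suc link(1)[of k] link(2)[of m] m inj(2)[of k "Suc m"]
        by (auto simp: Rw_def edges_between_def)
    qed
  qed
  then show "wstar G (w m) = insert (Lw m) (insert (Rw m) ?X)"
    using star_split[OF _ _ X _ D l r] wstar_bij[OF G] verts_in m by auto
qed

private lemma bsplit:
  assumes m: "m < n"
  shows "bstar G (b m) = insert (Lb m) (insert (Rb m) (edges_between G (w m) (b m)))"
    "Lb m \<in> bstar G (b m) - edges_between G (w m) (b m)"
    "Rb m \<in> bstar G (b m) - edges_between G (w m) (b m)"
proof -
  let ?X = "edges_between G (w m) (b m)"
  have X: "?X \<subseteq> bstar G (b m)" by (auto simp: edges_between_def bstar_def)
  show l: "Lb m \<in> bstar G (b m) - ?X"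
  proof (cases m)
    case 0
    then show ?thesis using external_ends internal_between[OF m m] by (auto simp: Lb_def bstar_def)
  next
    case (Suc k)
    then show ?thesis using link(2)[of k] m inj(1)[of k m] by (auto simp: bstar_def edges_between_def)
  qed
  show r: "Rb m \<in> bstar G (b m) - ?X"
  proof (cases "Suc m = n")
    case True
    then have "m = n - 1" by simp
    then show ?thesis using True external_ends internal_between[OF m m] by (auto simp: Rb_def bstar_def)
  next
    case False
    then show ?thesis using link(1)[of m] m inj(1)[of m "Suc m"]
      by (auto simp: bstar_def edges_between_def Rb_def)
  qed
  have "Lb m \<noteq> Rb m"
  proof (cases m)
    case 0
    show ?thesis
    proof (cases "Suc m = n")
      case True then show ?thesis using 0 external_ends by (auto simp: Lb_def Rb_def)
    next
      case False
      then show ?thesis using 0 external_ends link(1)[of 0] internal_between[of 1 0] m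
        by (auto simp: Lb_def Rb_def)
    qed
  next
    case (Suc k)
    show ?thesis
    proof (cases "Suc m = n")
      case True
      then show ?thesis using Suc external_ends link(2)[of k] internal_between[of k m] m
        by (auto simp: Rb_def)
    next
      case False
      then show ?thesis using Suc link(2)[of k] link(1)[of m] m inj(1)[of k "Suc m"]
        by (auto simp: Rb_def edges_between_def)
    qed
  qed
  then show "bstar G (b m) = insert (Lb m) (insert (Rb m) ?X)"
    using star_split[OF _ _ X _ D l r] bstar_bij[OF G] verts_in m by auto
qed

private lemma outer_colors:
  assumes m: "m < n"
  shows "{color G (Lw m), color G (Rw m)} = {..D} - color G ` edges_between G (w m) (b m)"
    "{color G (Lb m), color G (Rb m)} = {..D} - color G ` edges_between G (w m) (b m)"
  using star_colors[OF wsplit[OF m]] wstar_bij[OF G] star_colors[OF bsplit[OF m]] bstar_bij[OF G]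
    verts_in[OF m] by auto

private lemma same_other: "{a, x} = X \<Longrightarrow> {a', y} = X \<Longrightarrow> a = a' \<Longrightarrow> x = y"
  by (auto simp: doubleton_eq_iff)

private lemma chain_colors:
  assumes c: "is_chain G p" and m: "m < n"
  shows "color G (Lw m) = color G (Lb m) \<and> color G (Rw m) = color G (Rb m)"
  using m
proof (induction m)
  case 0
  have "color G (Lw 0) = color G (Lb 0)" using c by (auto simp: is_chain_def Lw_def Lb_def)
  then show ?case using same_other[OF outer_colors[OF 0]] by blast
next
  case (Suc m)
  then have "color G (Lw (Suc m)) = color G (Lb (Suc m))" by (auto simp: Rw_def Rb_def)
  then show ?case using same_other[OF outer_colors[OF Suc.prems]] by blast
qed

private lemma right_colors: "is_chain G p \<Longrightarrow> color G (right_w p) = color G (right_b p)"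
  using chain_colors[of "n - 1"] n_pos by (auto simp: Rw_def Rb_def)

private lemma left_same_faceI:
  assumes "k \<le> D" "k \<noteq> color G (left_w p)" "k \<noteq> color G (Rw 0)"
  shows "left_same_face G p k"
proof -
  have "k \<in> color G ` edges_between G (w 0) (b 0)"
    using outer_colors(1)[OF n_pos] assms by (auto simp: Lw_def)
  then obtain e where e: "e \<in> edges_between G (w 0) (b 0)" "color G e = k" by auto
  then have "(w 0, b 0) \<in> adjacency G {e \<in> internal_edges G p. color G e \<in> {color G (left_w p), k}}"
    using internal_between[OF n_pos n_pos] by (auto simp: adjacency_def edges_between_def)
  moreover have "hd (dipoles p) = (w 0, b 0)" using n_pos by (simp add: hd_conv_nth)
  ultimately show ?thesis unfolding left_same_face_def by auto
qed

private lemma secondary_color: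
  assumes "\<not> broken D G p"
  shows "\<exists>!k. k \<le> D \<and> k \<noteq> color G (left_w p) \<and> \<not> left_same_face G p k"
  using assms left_same_faceI unfolding broken_def by metis

lemma external_w:
  assumes "e \<in> edges G" "white_end G e \<in> internal_verts p" "e \<notin> internal_edges G p"
  shows "e = left_w p \<or> e = right_w p"
proof -
  have "white_end G e \<in> whites G" using G assms by (auto simp: colored_graph_def)
  moreover have "whites G \<inter> blacks G = {}" using G by (auto simp: colored_graph_def)
  ultimately obtain m where m: "m < n" "white_end G e = w m"
    using assms(2) verts_in(2) unfolding internal_verts_def by (fastforce simp: in_set_conv_nth)
  then have "e \<in> wstar G (w m)" using assms by (auto simp: wstar_def)
  then have "e = Lw m \<or> e = Rw m" using wsplit(1)[OF m(1)] internal_between[OF m(1) m(1)] assms by auto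
  then show ?thesis
  proof
    assume "e = Lw m"
    then show ?thesis using link(1)[of "m - 1"] internal_between[of m "m - 1"] m assms(3)
      by (cases m) (auto simp: Lw_def)
  next
    assume "e = Rw m"
    then show ?thesis using link(2)[of m] internal_between[of m "Suc m"] m assms(3)
      by (cases "Suc m = n") (auto simp: Rw_def)
  qed
qed

lemma external_b:
  assumes "e \<in> edges G" "black_end G e \<in> internal_verts p" "e \<notin> internal_edges G p"
  shows "e = left_b p \<or> e = right_b p"
proof -
  have "black_end G e \<in> blacks G" using G assms by (auto simp: colored_graph_def)
  moreover have "whites G \<inter> blacks G = {}" using G by (auto simp: colored_graph_def)
  ultimately obtain m where m: "m < n" "black_end G e = b m"
    using assms(2) verts_in(1) unfolding internal_verts_def by (fastforce simp: in_set_conv_nth)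
  then have "e \<in> bstar G (b m)" using assms by (auto simp: bstar_def)
  then have "e = Lb m \<or> e = Rb m" using bsplit(1)[OF m(1)] internal_between[OF m(1) m(1)] assms by auto
  then show ?thesis
  proof
    assume "e = Lb m"
    then show ?thesis using link(2)[of "m - 1"] internal_between[of "m - 1" m] m assms(3)
      by (cases m) (auto simp: Lb_def)
  next
    assume "e = Rb m"
    then show ?thesis using link(1)[of m] internal_between[of "Suc m" m] m assms(3)
      by (cases "Suc m = n") (auto simp: Rb_def)
  qed
qed

lemma valid_type_of_chain: "valid_type D (type_of_chain D G p)"
proof -
  have "color G e \<le> D" if "e \<in> edges G" for e using G that by (auto simp: colored_graph_def)
  then show ?thesis
    using external_ends(1,3) theI'[OF secondary_color] by (auto simp: type_of_chain_def Let_def)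
qed

lemma external_color_type:
  assumes "is_chain G p"
  shows "external_color (type_of_chain D G p) Left = color G (left_w p)"
    "external_color (type_of_chain D G p) Left = color G (left_b p)"
    "external_color (type_of_chain D G p) Right = color G (right_w p)"
    "external_color (type_of_chain D G p) Right = color G (right_b p)"
  using assms right_colors[OF assms] by (auto simp: type_of_chain_def Let_def is_chain_def)

lemma ends_internal:
  "white_end G (left_w p) \<in> internal_verts p" "white_end G (right_w p) \<in> internal_verts p"
  "black_end G (left_b p) \<in> internal_verts p" "black_end G (right_b p) \<in> internal_verts p"
  using external_ends verts_in n_pos by auto

end

lemma is_scheme_replace:
  assumes "D \<ge> 1" and G: "rooted_colored_graph D G" and P: "replaced_chains D G P"
  shows "is_scheme D (replace D G P)"
proof -
  have pc: "prechain D G p" "is_chain G p" if "p \<in> P" for p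
    using P that by (auto simp: replaced_chains_def maximal_proper_prechain_def proper_prechain_def)
  have sub: "internal_verts p \<subseteq> verts G" and ne: "internal_verts p \<noteq> {}" if "p \<in> P" for p
  proof -
    have "dipole D G a b" if "(a, b) \<in> set (dipoles p)" for a b
      using pc(1)[OF \<open>p \<in> P\<close>] that by (auto simp: prechain_def Let_def)
    then show "internal_verts p \<subseteq> verts G" by (fastforce simp: internal_verts_def verts_def dipole_def)
    show "internal_verts p \<noteq> {}"
      using pc(1)[OF that] by (auto simp: prechain_def Let_def internal_verts_def)
  qed
  show ?thesis
  proof (cases "empty_graph G")
    case True
    then have "P = {}" using sub ne by (auto simp: empty_graph_def)
    then show ?thesis using True
      by (auto simp: is_scheme_def replace_def empty_graph_def verts_def)
  next
    case False
    then have cg: "colored_graph D G" and rt: "\<exists>e\<in>edges G. root G = Some e"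
      using G by (auto simp: rooted_colored_graph_def)
    have disj: "p = q" if "p \<in> P" "q \<in> P" "v \<in> internal_verts p" "v \<in> internal_verts q" for p q v
      using P that unfolding replaced_chains_def by blast
    have the: "(THE p. p \<in> P \<and> v \<in> internal_verts p) = p" if "p \<in> P" "v \<in> internal_verts p" for p v
      using that disj by blast
    have att: "attach P l e v = Port p (if e = l p then Left else Right)"
      if "p \<in> P" "v \<in> internal_verts p" for p l e v
      using that the[OF that] by (auto simp: attach_def Let_def)
    have att0: "attach P l e v = Regular v" if "\<And>p. p \<in> P \<Longrightarrow> v \<notin> internal_verts p" for l e v
      using that by (auto simp: attach_def)
    have attR: "attach P l e v = Regular u \<longleftrightarrow> v = u \<and> (\<forall>p\<in>P. v \<notin> internal_verts p)" for l e v u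
      by (auto simp: attach_def Let_def)
    have attP: "attach P l e v = Port p s \<longleftrightarrow>
        v \<in> internal_verts p \<and> s = (if e = l p then Left else Right)" if "p \<in> P" for l e v p s
    proof (cases "\<exists>q\<in>P. v \<in> internal_verts q")
      case True
      then obtain q where "q \<in> P" "v \<in> internal_verts q" by blast
      then show ?thesis using att[of q v l e] disj[of p q v] that by auto
    qed (use that att0[of v l e] in auto)
    have cs: "finite (verts G)" "finite (edges G)" "whites G \<inter> blacks G = {}"
      "\<And>e. e \<in> edges G \<Longrightarrow> white_end G e \<in> whites G \<and> black_end G e \<in> blacks G \<and> color G e \<le> D"
      "\<And>w c. w \<in> whites G \<Longrightarrow> c \<le> D \<Longrightarrow> \<exists>!e. e \<in> edges G \<and> white_end G e = w \<and> color G e = c"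
      "\<And>w c. w \<in> blacks G \<Longrightarrow> c \<le> D \<Longrightarrow> \<exists>!e. e \<in> edges G \<and> black_end G e = w \<and> color G e = c"
      using cg unfolding colored_graph_def by blast+
    have "inj_on internal_verts P" using disj ne unfolding inj_on_def by blast
    moreover have "internal_verts ` P \<subseteq> Pow (verts G)" using sub by auto
    ultimately have finP: "finite P" using cs(1) by (meson finite_Pow_iff inj_on_finite)
    have wports: "\<exists>e\<in>sedges (replace D G P). {e' \<in> sedges (replace D G P).
          swhite_end (replace D G P) e' = Port p s} = {e} \<and>
        scolor (replace D G P) e = external_color (chain_type (replace D G P) p) s"
      if p: "p \<in> P" for p s
    proof -
      let ?e = "case s of Left \<Rightarrow> left_w p | Right \<Rightarrow> right_w p"
      note x = external_ends[OF cg pc(1)[OF p] \<open>D \<ge> 1\<close>] ends_internal[OF cg pc(1)[OF p] \<open>D \<ge> 1\<close>]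
      have ret: "e \<in> edges G - \<Union>(internal_edges G ` P)"
        if "e \<in> edges G" "e \<notin> internal_edges G p" "white_end G e \<in> internal_verts p" for e
        using that disj[OF p] by (auto simp: internal_edges_def)
      have 1: "?e \<in> sedges (replace D G P)"
        using ret x by (cases s) (auto simp: replace_def)
      moreover have "{e' \<in> sedges (replace D G P). swhite_end (replace D G P) e' = Port p s} = {?e}"
      proof -
        have "e' = ?e" if "e' \<in> sedges (replace D G P)" "swhite_end (replace D G P) e' = Port p s" for e'
          using that attP[OF p, of left_w e'] external_w[OF cg pc(1)[OF p] \<open>D \<ge> 1\<close>, of e'] p
          by (cases s) (auto simp: replace_def split: if_splits)
        moreover have "swhite_end (replace D G P) ?e = Port p s"
          using attP[OF p, of left_w] x by (cases s) (auto simp: replace_def)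
        ultimately show ?thesis using 1 by blast
      qed
      moreover have "scolor (replace D G P) ?e = external_color (chain_type (replace D G P) p) s"
        using external_color_type[OF cg pc(1)[OF p] \<open>D \<ge> 1\<close> pc(2)[OF p]]
        by (cases s) (auto simp: replace_def)
      ultimately show ?thesis by blast
    qed
    have bports: "\<exists>e\<in>sedges (replace D G P). {e' \<in> sedges (replace D G P).
          sblack_end (replace D G P) e' = Port p s} = {e} \<and>
        scolor (replace D G P) e = external_color (chain_type (replace D G P) p) s"
      if p: "p \<in> P" for p s
    proof -
      let ?e = "case s of Left \<Rightarrow> left_b p | Right \<Rightarrow> right_b p"
      note x = external_ends[OF cg pc(1)[OF p] \<open>D \<ge> 1\<close>] ends_internal[OF cg pc(1)[OF p] \<open>D \<ge> 1\<close>]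
      have ret: "e \<in> edges G - \<Union>(internal_edges G ` P)"
        if "e \<in> edges G" "e \<notin> internal_edges G p" "black_end G e \<in> internal_verts p" for e
        using that disj[OF p] by (auto simp: internal_edges_def)
      have 1: "?e \<in> sedges (replace D G P)"
        using ret x by (cases s) (auto simp: replace_def)
      moreover have "{e' \<in> sedges (replace D G P). sblack_end (replace D G P) e' = Port p s} = {?e}"
      proof -
        have "e' = ?e" if "e' \<in> sedges (replace D G P)" "sblack_end (replace D G P) e' = Port p s" for e'
          using that attP[OF p, of left_b e'] external_b[OF cg pc(1)[OF p] \<open>D \<ge> 1\<close>, of e'] p
          by (cases s) (auto simp: replace_def split: if_splits)
        moreover have "sblack_end (replace D G P) ?e = Port p s"
          using attP[OF p, of left_b] x by (cases s) (auto simp: replace_def)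
        ultimately show ?thesis using 1 by blast
      qed
      moreover have "scolor (replace D G P) ?e = external_color (chain_type (replace D G P) p) s"
        using external_color_type[OF cg pc(1)[OF p] \<open>D \<ge> 1\<close> pc(2)[OF p]]
        by (cases s) (auto simp: replace_def)
      ultimately show ?thesis by blast
    qed
    have wreg: "\<exists>!e. e \<in> sedges (replace D G P) \<and> swhite_end (replace D G P) e = Regular w \<and>
        scolor (replace D G P) e = c" if "w \<in> reg_whites (replace D G P)" "c \<le> D" for w c
    proof -
      have w: "w \<in> whites G" "\<And>p. p \<in> P \<Longrightarrow> w \<notin> internal_verts p"
        using that by (auto simp: replace_def)
      have "(e \<in> sedges (replace D G P) \<and> swhite_end (replace D G P) e = Regular w \<and>
          scolor (replace D G P) e = c) \<longleftrightarrow> (e \<in> edges G \<and> white_end G e = w \<and> color G e = c)" for e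
        using w by (auto simp: replace_def attR internal_edges_def)
      then show ?thesis using cs(5)[OF w(1) that(2)] by simp
    qed
    have breg: "\<exists>!e. e \<in> sedges (replace D G P) \<and> sblack_end (replace D G P) e = Regular w \<and>
        scolor (replace D G P) e = c" if "w \<in> reg_blacks (replace D G P)" "c \<le> D" for w c
    proof -
      have w: "w \<in> blacks G" "\<And>p. p \<in> P \<Longrightarrow> w \<notin> internal_verts p"
        using that by (auto simp: replace_def)
      have "(e \<in> sedges (replace D G P) \<and> sblack_end (replace D G P) e = Regular w \<and>
          scolor (replace D G P) e = c) \<longleftrightarrow> (e \<in> edges G \<and> black_end G e = w \<and> color G e = c)" for e
        using w by (auto simp: replace_def attR internal_edges_def)
      then show ?thesis using cs(6)[OF w(1) that(2)] by simp
    qed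
    have ends: "scolor (replace D G P) e \<le> D \<and>
        swhite_end (replace D G P) e \<in> Regular ` reg_whites (replace D G P) \<union>
          (\<Union>c\<in>chain_verts (replace D G P). range (Port c)) \<and>
        sblack_end (replace D G P) e \<in> Regular ` reg_blacks (replace D G P) \<union>
          (\<Union>c\<in>chain_verts (replace D G P). range (Port c))"
      if "e \<in> sedges (replace D G P)" for e
    proof -
      have e: "e \<in> edges G" using that by (auto simp: replace_def)
      have a: "attach P l e v \<in> Regular ` (A - \<Union>(internal_verts ` P)) \<union> (\<Union>c\<in>P. range (Port c))"
        if "v \<in> A" for l v and A :: "'a set"
      proof (cases "\<exists>p\<in>P. v \<in> internal_verts p")
        case True
        then obtain p where "p \<in> P" "v \<in> internal_verts p" by blast
        then show ?thesis using att[of p v l e] by auto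
      next
        case False
        then show ?thesis using att0[of v l e] that by auto
      qed
      show ?thesis using cs(4)[OF e] a by (simp add: replace_def)
    qed
    have root: "case sroot (replace D G P) of Some e \<Rightarrow> e \<in> sedges (replace D G P) | None \<Rightarrow> False"
    proof -
      have "root G \<notin> Some ` internal_edges G p" if "p \<in> P" for p
        using pc(1)[OF that] by (simp add: prechain_def Let_def)
      then show ?thesis using rt by (force simp: replace_def)
    qed
    have fin: "finite (reg_whites (replace D G P))" "finite (reg_blacks (replace D G P))"
      "finite (chain_verts (replace D G P))" "finite (sedges (replace D G P))"
      "reg_whites (replace D G P) \<inter> reg_blacks (replace D G P) = {}"
      using cs(1-3) finP by (auto simp: replace_def verts_def)
    have ty: "\<forall>c\<in>chain_verts (replace D G P). valid_type D (chain_type (replace D G P) c)"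
      using valid_type_of_chain[OF cg _ \<open>D \<ge> 1\<close>] pc(1) by (simp add: replace_def)
    have cv: "chain_verts (replace D G P) = P" by (simp add: replace_def)
    show ?thesis
      unfolding is_scheme_def
      using fin ty ends wreg breg wports bports root cv by (auto split: option.splits)
  qed
qed

lemma schemes_of_degree_subset:
  "D \<ge> 1 \<Longrightarrow> schemes_of_degree D \<delta> \<subseteq> {S. is_scheme D S}"
  using is_scheme_replace by (auto simp: schemes_of_degree_def is_scheme_of_def)

end

theory Submission
  imports Defs
begin

text \<open>
  A colored graph is a family of fixed-point-free involutions \<open>\<tau> c\<close>, sending a vertex to its
  neighbour along the edge of color \<open>c\<close>. Flipping the two edges of color \<open>i\<close> at a pair of vertices
  that is already joined by \<open>h\<close> colors turns them into an edge of the pair and one other edge.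
  This changes every face count by at most one. For large \<open>h\<close> it lowers the degree, unless it
  disconnects the graph; then the degree is distributed over the two parts. With the
  supermodularity of the number of components it follows that the degree is non-negative, and
  that a connected graph of degree \<open>0\<close> with more than two vertices contains two disjoint melons.

  Now cut a melon-free graph by such flips at every link between consecutive dipoles and at every
  isolated dipole, and mark the new edges. A part of degree \<open>0\<close> contains two disjoint melons, both of
  which must contain a mark; if it has only two marked edges, it is a chain. Hence the number of cuts
  that do not just remove a piece of a chain is linear in the degree. In a graph whose dipoles are
  all next to marks the number of vertices is linear in the degree and the number of marks. For
  \<open>D \<ge> 4\<close> this holds because all but few of the components left by removing one color have degree
  \<open>0\<close>, hence contain a dipole. For \<open>D = 3\<close> there are few faces of length \<open>2\<close>, hence few faces of length
  at least \<open>6\<close>; away from these the \<open>\<tau> c\<close> commute, and four commuting involutions have orbits of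
  at most \<open>16\<close> vertices. Altogether the number of vertices outside long chains plus the number of
  chains is bounded.
\<close>

section \<open>Classes of symmetric relations\<close>

text \<open>What is bounded is the defect \<open>2 * card V - card (links C V \<tau> R)\<close>. In
  a graph with at least five vertices, a vertex inside a long chain is the first entry of exactly
  two links, any other vertex of at most one, so the defect bounds the number of vertices that are
  not inside chains. The bound has the form \<open>A * deg4 C V \<tau> + B * (card R - 4)\<close>. A
  separating cut does not raise the total degree and adds four marked half-edges, so that
  \<open>(card R1 - 4) + (card R2 - 4) = card R - 4\<close> and the bound passes to the parts
  without loss. A cut that does not separate costs \<open>4 * B\<close>, which the fall of the
  degree pays for. The number 4 is also the least number of marked half-edges that a part of degree
  0 can have (\<open>linear_melonic\<close>), so the second term is negative only at positive
  degree. The given graph is of this kind: its root contributes two half-edges, which also shows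
  that its degree is positive.\<close>

definition symon :: "'v set \<Rightarrow> ('v \<times> 'v) set \<Rightarrow> bool" where
  "symon V r \<longleftrightarrow> (\<forall>x\<in>V. \<forall>y. (x, y) \<in> r \<longrightarrow> y \<in> V \<and> (y, x) \<in> r)"

lemma symonI: "(\<And>x y. x \<in> V \<Longrightarrow> (x, y) \<in> r \<Longrightarrow> y \<in> V \<and> (y, x) \<in> r) \<Longrightarrow> symon V r"
  unfolding symon_def by blast

lemma symonD:
  assumes "symon V r" "x \<in> V" "(x, y) \<in> r" shows "y \<in> V" "(y, x) \<in> r"
  using assms unfolding symon_def by blast+

text \<open>Forward reachability. It gives equivalence classes where the relation is
  \<open>symon\<close>; that is asked only at points of a set \<open>V\<close>, because the maps of
  a colored graph are unconstrained outside its vertices.\<close>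

definition cls :: "('v \<times> 'v) set \<Rightarrow> 'v \<Rightarrow> 'v set" where
  "cls r x = r\<^sup>* `` {x}"

definition ncr :: "('v \<times> 'v) set \<Rightarrow> 'v set \<Rightarrow> nat" where
  "ncr r V = card (cls r ` V)"

lemma cls_refl [simp]: "x \<in> cls r x"
  by (simp add: cls_def)

lemma cls_step: "y \<in> cls r x \<Longrightarrow> (y, z) \<in> r \<Longrightarrow> z \<in> cls r x"
  by (auto simp: cls_def)

lemma cls_trans: "y \<in> cls r x \<Longrightarrow> z \<in> cls r y \<Longrightarrow> z \<in> cls r x"
  by (auto simp: cls_def)

lemma cls_induct [consumes 1, case_names base step]:
  assumes "y \<in> cls r x" "P x" "\<And>y z. y \<in> cls r x \<Longrightarrow> P y \<Longrightarrow> (y, z) \<in> r \<Longrightarrow> P z"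
  shows "P y"
proof -
  have "(x, y) \<in> r\<^sup>*" using assms(1) by (simp add: cls_def)
  then show ?thesis
  proof (induction rule: rtrancl_induct)
    case (step y z) then show ?case using assms(3)[of y z] by (simp add: cls_def)
  qed (fact assms(2))
qed

lemma cls_least:
  assumes "x \<in> S" "\<And>y z. y \<in> S \<Longrightarrow> (y, z) \<in> r \<Longrightarrow> z \<in> S"
  shows "cls r x \<subseteq> S"
proof
  fix y assume "y \<in> cls r x"
  then show "y \<in> S" by (induction rule: cls_induct) (use assms in auto)
qed

lemma cls_mono: "r \<subseteq> s \<Longrightarrow> cls r x \<subseteq> cls s x"
  by (auto simp: cls_def dest: rtrancl_mono)

lemma cls_subset:
  assumes "symon V r" "x \<in> V" shows "cls r x \<subseteq> V"
  by (rule cls_least) (use assms symonD(1) in \<open>fast+\<close>)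

lemma cls_sym:
  assumes "symon V r" "x \<in> V" "y \<in> cls r x" shows "x \<in> cls r y"
  using assms(3)
proof (induction rule: cls_induct)
  case (step y z)
  then have "y \<in> V" using cls_subset[OF assms(1,2)] by auto
  then have "(z, y) \<in> r" using step symonD(2)[OF assms(1)] by blast
  then have "y \<in> cls r z" using cls_step[OF cls_refl] by metis
  then show ?case using cls_trans[of y r z x] step by blast
qed simp

lemma cls_eq:
  assumes "symon V r" "x \<in> V" "y \<in> cls r x" shows "cls r y = cls r x"
proof
  show "cls r y \<subseteq> cls r x" using cls_trans[OF assms(3)] by auto
  show "cls r x \<subseteq> cls r y" using cls_trans[OF cls_sym[OF assms]] by auto
qed

lemma cls_eq_iff:
  assumes "symon V r" "x \<in> V" shows "cls r y = cls r x \<longleftrightarrow> y \<in> cls r x"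
  using cls_eq[OF assms] cls_refl by metis

lemma cls_disjoint:
  assumes "symon V r" "x \<in> V" "y \<in> V" "y \<notin> cls r x" shows "cls r x \<inter> cls r y = {}"
proof (rule ccontr)
  assume "\<not> ?thesis"
  then obtain z where z: "z \<in> cls r x" "z \<in> cls r y" by auto
  have "cls r x = cls r y" using cls_eq[OF assms(1,2) z(1)] cls_eq[OF assms(1,3) z(2)] by simp
  then show False using assms(4) cls_refl[of y r] by simp
qed

lemma cls_cong:
  assumes "symon V r" "symon V s" "\<And>x y. x \<in> V \<Longrightarrow> (x, y) \<in> r \<longleftrightarrow> (x, y) \<in> s" "x \<in> V"
  shows "cls r x = cls s x"
proof -
  have "cls r x \<subseteq> V \<inter> cls s x" if "symon V r" "\<And>x y. x \<in> V \<Longrightarrow> (x, y) \<in> r \<longleftrightarrow> (x, y) \<in> s" for r s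
    by (rule cls_least) (use that assms(4) symonD(1)[OF that(1)] in \<open>auto intro: cls_step\<close>)
  from this[OF assms(1,3)] this[of s r, OF assms(2)] show ?thesis using assms(3) by auto
qed

lemma ncr_cong:
  assumes "symon V r" "symon V s" "\<And>x y. x \<in> V \<Longrightarrow> (x, y) \<in> r \<longleftrightarrow> (x, y) \<in> s"
  shows "ncr r V = ncr s V"
proof -
  have "cls r ` V = cls s ` V" using cls_cong[OF assms] by (auto intro!: image_cong)
  then show ?thesis by (simp add: ncr_def)
qed

lemma ncr_Un:
  assumes "symon V1 r" "symon V2 r" "finite V1" "finite V2" "V1 \<inter> V2 = {}"
  shows "ncr r (V1 \<union> V2) = ncr r V1 + ncr r V2"
proof -
  have "cls r ` V1 \<inter> cls r ` V2 = {}"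
  proof -
    have False if "x \<in> V1" "y \<in> V2" "cls r x = cls r y" for x y
      using that cls_subset[OF assms(1), of x] cls_subset[OF assms(2), of y] cls_refl[of x r] assms(5)
      by blast
    then show ?thesis by blast
  qed
  then show ?thesis using assms(3,4) by (simp add: ncr_def image_Un card_Un_disjoint)
qed

text \<open>Every class of \<open>s\<close> lies in a class of \<open>r\<close>, which gives a map
  from the classes of \<open>s\<close> onto those of \<open>r\<close>. If one class of
  \<open>r\<close> meets two classes of \<open>s\<close>, this map is not injective and the
  inequality is strict.\<close>

lemma ncr_coarse:
  assumes V: "finite V" and r: "symon V r" and s: "symon V s"
    and sub: "\<And>x y. x \<in> V \<Longrightarrow> (x, y) \<in> s \<Longrightarrow> y \<in> cls r x"
  shows "ncr r V \<le> ncr s V"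
    and "x \<in> V \<Longrightarrow> y \<in> cls r x \<Longrightarrow> y \<notin> cls s x \<Longrightarrow> ncr r V < ncr s V"
proof -
  have cs: "cls s x \<subseteq> cls r x" if x: "x \<in> V" for x
  proof
    fix y assume "y \<in> cls s x"
    then show "y \<in> cls r x"
    proof (induction rule: cls_induct)
      case (step y z)
      have "y \<in> V" using cls_subset[OF s x] step by auto
      then show ?case using sub[of y z] step cls_trans by metis
    qed simp
  qed
  define g where "g = (\<lambda>X. cls r (SOME x. x \<in> X))"
  have g: "g (cls s x) = cls r x" if x: "x \<in> V" for x
  proof -
    have "(SOME y. y \<in> cls s x) \<in> cls s x" by (rule someI) (rule cls_refl)
    then show ?thesis unfolding g_def using cls_eq[OF r x] cs[OF x] by blast
  qed
  have img: "cls r ` V = g ` (cls s ` V)" using g by (auto simp: image_image)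
  then show "ncr r V \<le> ncr s V" unfolding ncr_def using V by (simp add: card_image_le)
  assume x: "x \<in> V" and y: "y \<in> cls r x" "y \<notin> cls s x"
  have yV: "y \<in> V" using cls_subset[OF r x] y by auto
  have "\<not> inj_on g (cls s ` V)"
  proof
    assume "inj_on g (cls s ` V)"
    moreover have "g (cls s x) = g (cls s y)" using g x yV cls_eq[OF r x y(1)] by simp
    ultimately have "cls s x = cls s y" using x yV by (auto dest: inj_onD)
    then show False using y(2) by simp
  qed
  then have "card (g ` (cls s ` V)) \<noteq> card (cls s ` V)" using V eq_card_imp_inj_on by blast
  then show "ncr r V < ncr s V"
    unfolding ncr_def img using V by (metis card_image_le finite_imageI le_neq_implies_less)
qed

lemma symon_Un: "symon V r \<Longrightarrow> symon V s \<Longrightarrow> symon V (r \<union> s)"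
  unfolding symon_def by blast

lemma symon_edge: "x \<in> V \<Longrightarrow> y \<in> V \<Longrightarrow> symon V {(x, y), (y, x)}"
  by (auto simp: symon_def)

lemma cls_add_edge:
  assumes r: "symon V r" and x: "x \<in> V" and y: "y \<in> V" and z: "z \<in> V"
  shows "cls (r \<union> {(x, y), (y, x)}) z =
    (if z \<in> cls r x \<union> cls r y then cls r x \<union> cls r y else cls r z)" (is "cls ?s z = _")
proof -
  have s: "symon V ?s" using symon_Un[OF r symon_edge[OF x y]] .
  have rs: "cls r u \<subseteq> cls ?s u" for u by (rule cls_mono) auto
  have xy: "y \<in> cls ?s x" by (rule cls_step[OF cls_refl]) auto
  show ?thesis
  proof (cases "z \<in> cls r x \<union> cls r y")
    case True
    have eq: "cls ?s z = cls ?s x"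
      using True cls_eq[OF s x] cls_eq[OF s y] rs xy by blast
    have "cls ?s x \<subseteq> cls r x \<union> cls r y"
      by (rule cls_least) (auto intro: cls_step)
    moreover have "cls r x \<union> cls r y \<subseteq> cls ?s x" using rs[of x] rs[of y] cls_eq[OF s x xy] by auto
    ultimately show ?thesis using True eq by auto
  next
    case False
    have "cls ?s z \<subseteq> cls r z"
    proof (rule cls_least)
      fix u v assume u: "u \<in> cls r z" and uv: "(u, v) \<in> ?s"
      have "u \<noteq> x" "u \<noteq> y" using False u cls_sym[OF r z] by auto
      then have "(u, v) \<in> r" using uv by auto
      then show "v \<in> cls r z" using u cls_step by metis
    qed simp
    then show ?thesis using False rs by auto
  qed
qed

lemma ncr_add_edge:
  assumes V: "finite V" and r: "symon V r" and x: "x \<in> V" and y: "y \<in> V"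
  shows "ncr r V = ncr (r \<union> {(x, y), (y, x)}) V + (if y \<in> cls r x then 0 else 1)"
proof -
  let ?s = "r \<union> {(x, y), (y, x)}"
  note c = cls_add_edge[OF r x y]
  show ?thesis
  proof (cases "y \<in> cls r x")
    case True
    have e: "cls r y = cls r x" by (rule cls_eq[OF r x True])
    have "cls ?s z = cls r z" if "z \<in> V" for z
      using c[OF that] e cls_eq[OF r x, of z] by auto
    then have "cls ?s ` V = cls r ` V" by auto
    then show ?thesis using True by (simp add: ncr_def)
  next
    case False
    let ?X = "cls r x" and ?Y = "cls r y"
    have d: "?X \<inter> ?Y = {}" using cls_disjoint[OF r x y False] .
    then have ne: "?X \<noteq> ?Y" using cls_refl[of x r] by (metis Int_absorb empty_iff)
    have other: "cls r z \<noteq> ?X \<and> cls r z \<noteq> ?Y \<longleftrightarrow> z \<notin> ?X \<union> ?Y" if "z \<in> V" for z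
      using that cls_eq_iff[OF r x, of z] cls_eq_iff[OF r y, of z] by auto
    have "cls ?s ` V = insert (?X \<union> ?Y) (cls r ` V - {?X, ?Y})" (is "?L = ?R")
    proof
      show "?L \<subseteq> ?R" using c other by auto
      show "?R \<subseteq> ?L"
      proof
        fix K assume "K \<in> ?R"
        then consider "K = ?X \<union> ?Y" | z where "z \<in> V" "K = cls r z" "K \<noteq> ?X" "K \<noteq> ?Y" by auto
        then show "K \<in> ?L"
        proof cases
          case 1 then have "K = cls ?s x" using c[OF x] by auto
          then show ?thesis using x by simp
        next
          case 2 then have "K = cls ?s z" using c other by auto
          then show ?thesis using 2 by simp
        qed
      qed
    qed
    moreover have "?X \<union> ?Y \<notin> cls r ` V"
    proof
      assume "?X \<union> ?Y \<in> cls r ` V"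
      then obtain z where z: "z \<in> V" "cls r z = ?X \<union> ?Y" by auto
      then have "x \<in> cls r z" "y \<in> cls r z" by auto
      then show False using cls_eq[OF r z(1)] ne by metis
    qed
    ultimately have "card (cls ?s ` V) = Suc (card (cls r ` V - {?X, ?Y}))" using V by simp
    moreover have "card (cls r ` V - {?X, ?Y}) = card (cls r ` V) - 2"
      using ne x y V by (subst card_Diff_subset) auto
    moreover have "card {?X, ?Y} \<le> card (cls r ` V)" using x y V by (intro card_mono) auto
    ultimately show ?thesis using False ne by (simp add: ncr_def)
  qed
qed

section \<open>Supermodularity of the number of classes\<close>

lemma ncr_submod_aux:
  assumes "finite V" "symon V h" "symon V e" "finite f" "f \<subseteq> V \<times> V"
  shows "ncr (h \<union> e) V + ncr (h \<union> (f \<union> f\<inverse>)) V \<le> ncr h V + ncr (h \<union> e \<union> (f \<union> f\<inverse>)) V"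
  using assms(4,5)
proof (induction f)
  case empty then show ?case by simp
next
  case (insert p f)
  obtain x y where p: "p = (x, y)" by (cases p)
  have xy: "x \<in> V" "y \<in> V" using insert p by auto
  have sf: "symon V (f \<union> f\<inverse>)" using insert.prems unfolding symon_def by blast
  have s1: "symon V (h \<union> (f \<union> f\<inverse>))" and s2: "symon V (h \<union> e \<union> (f \<union> f\<inverse>))"
    using sf assms(2,3) by (auto intro!: symon_Un)
  have e1: "h \<union> (insert p f \<union> (insert p f)\<inverse>) = (h \<union> (f \<union> f\<inverse>)) \<union> {(x, y), (y, x)}"
    and e2: "h \<union> e \<union> (insert p f \<union> (insert p f)\<inverse>) = (h \<union> e \<union> (f \<union> f\<inverse>)) \<union> {(x, y), (y, x)}"
    using p by auto
  \<comment> \<open>If the new edge joins two classes of the larger relation, it also joins two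
    classes of the smaller one. So it lowers the left side at least as much as the right
    side.\<close>
  have "cls (h \<union> (f \<union> f\<inverse>)) x \<subseteq> cls (h \<union> e \<union> (f \<union> f\<inverse>)) x" by (rule cls_mono) auto
  then show ?case
    using insert ncr_add_edge[OF assms(1) s1 xy] ncr_add_edge[OF assms(1) s2 xy]
    unfolding e1 e2 by (auto split: if_splits)
qed

lemma cls_restrict:
  assumes "symon V r" "x \<in> V" shows "cls (r \<inter> V \<times> V) x = cls r x"
proof
  show "cls (r \<inter> V \<times> V) x \<subseteq> cls r x" by (rule cls_mono) auto
  have "cls r x \<subseteq> V \<inter> cls (r \<inter> V \<times> V) x"
  proof (rule cls_least)
    fix y z assume "y \<in> V \<inter> cls (r \<inter> V \<times> V) x" "(y, z) \<in> r"
    then show "z \<in> V \<inter> cls (r \<inter> V \<times> V) x"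
      using symonD(1)[OF assms(1), of y z] cls_step[of y "r \<inter> V \<times> V" x z] by auto
  qed (use assms in auto)
  then show "cls r x \<subseteq> cls (r \<inter> V \<times> V) x" by auto
qed

lemma ncr_submod:
  assumes "finite V" "symon V h" "symon V e" "symon V f"
  shows "ncr (h \<union> e) V + ncr (h \<union> f) V \<le> ncr h V + ncr (h \<union> e \<union> f) V"
proof -
  \<comment> \<open>The edge-by-edge induction needs a finite set of edges, while \<open>f\<close>
    is arbitrary outside \<open>V\<close>.\<close>
  let ?f = "f \<inter> V \<times> V"
  have inv: "?f \<union> ?f\<inverse> = ?f" using assms(4) unfolding symon_def by blast
  have fin: "finite ?f" "?f \<subseteq> V \<times> V" using assms(1) by (auto intro: finite_subset[of _ "V \<times> V"])
  have r: "ncr (r \<union> ?f) V = ncr (r \<union> f) V" if "symon V r" for r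
  proof -
    have s: "symon V (r \<union> f)" "symon V (r \<union> ?f)"
      using that assms(4) unfolding symon_def by blast+
    have "(r \<union> ?f) \<inter> V \<times> V = (r \<union> f) \<inter> V \<times> V" by auto
    then have "cls (r \<union> ?f) x = cls (r \<union> f) x" if "x \<in> V" for x
      using cls_restrict[OF s(1) that] cls_restrict[OF s(2) that] by simp
    then show ?thesis by (simp add: ncr_def)
  qed
  show ?thesis
    using ncr_submod_aux[OF assms(1-3) fin] unfolding inv
    using r[OF assms(2)] r[OF symon_Un[OF assms(2,3)]] by simp
qed

section \<open>Colored graphs as families of matchings, and flips\<close>

definition matchings :: "nat set \<Rightarrow> 'v set \<Rightarrow> (nat \<Rightarrow> 'v \<Rightarrow> 'v) \<Rightarrow> bool" where
  "matchings C V \<tau> \<longleftrightarrow> finite V \<and> finite C \<and>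
     (\<forall>c\<in>C. \<forall>x\<in>V. \<tau> c x \<in> V \<and> \<tau> c x \<noteq> x \<and> \<tau> c (\<tau> c x) = x)"

definition step :: "nat set \<Rightarrow> (nat \<Rightarrow> 'v \<Rightarrow> 'v) \<Rightarrow> ('v \<times> 'v) set" where
  "step C \<tau> = {(x, \<tau> c x) | x c. c \<in> C}"

abbreviation cl :: "nat set \<Rightarrow> (nat \<Rightarrow> 'v \<Rightarrow> 'v) \<Rightarrow> 'v \<Rightarrow> 'v set" where
  "cl C \<tau> \<equiv> cls (step C \<tau>)"

abbreviation ncl :: "nat set \<Rightarrow> 'v set \<Rightarrow> (nat \<Rightarrow> 'v \<Rightarrow> 'v) \<Rightarrow> nat" where
  "ncl C V \<tau> \<equiv> ncr (step C \<tau>) V"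

lemma matchingsD:
  assumes "matchings C V \<tau>"
  shows "finite V" "finite C" "c \<in> C \<Longrightarrow> x \<in> V \<Longrightarrow> \<tau> c x \<in> V" "c \<in> C \<Longrightarrow> x \<in> V \<Longrightarrow> \<tau> c x \<noteq> x"
    "c \<in> C \<Longrightarrow> x \<in> V \<Longrightarrow> \<tau> c (\<tau> c x) = x"
  using assms by (auto simp: matchings_def)

lemma matchings_eqD:
  assumes "matchings C V \<tau>" "c \<in> C" "x \<in> V" "y \<in> V"
  shows "\<tau> c x = \<tau> c y \<longleftrightarrow> x = y" "\<tau> c x = y \<longleftrightarrow> \<tau> c y = x"
  using matchingsD(5)[OF assms(1,2)] assms(3,4) by metis+

lemma step_iff: "(x, y) \<in> step C \<tau> \<longleftrightarrow> (\<exists>c\<in>C. y = \<tau> c x)"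
  by (auto simp: step_def)

lemma matchings_mono: "matchings C V \<tau> \<Longrightarrow> P \<subseteq> C \<Longrightarrow> matchings P V \<tau>"
  by (auto simp: matchings_def dest: finite_subset)

lemma matchings_symon: "matchings C V \<tau> \<Longrightarrow> P \<subseteq> C \<Longrightarrow> symon V (step P \<tau>)"
  unfolding symon_def step_iff using matchingsD(3,5) by (metis subsetD)

lemma cl_step: "y \<in> cl P \<tau> x \<Longrightarrow> c \<in> P \<Longrightarrow> \<tau> c y \<in> cl P \<tau> x"
  by (rule cls_step) (auto simp: step_iff)

lemma cl_least:
  assumes "x \<in> S" "\<And>y c. y \<in> S \<Longrightarrow> c \<in> P \<Longrightarrow> \<tau> c y \<in> S" shows "cl P \<tau> x \<subseteq> S"
  by (rule cls_least) (use assms in \<open>auto simp: step_iff\<close>)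

lemma matchings_sub:
  "matchings C V \<tau> \<Longrightarrow> V' \<subseteq> V \<Longrightarrow> (\<And>x c. x \<in> V' \<Longrightarrow> c \<in> C \<Longrightarrow> \<tau> c x \<in> V') \<Longrightarrow> matchings C V' \<tau>"
  by (auto simp: matchings_def dest: finite_subset)

lemma matchings_cl:
  assumes "matchings C V \<tau>" "P \<subseteq> C" "x \<in> V" shows "matchings P (cl P \<tau> x) \<tau>"
  using matchings_sub[OF matchings_mono[OF assms(1,2)] cls_subset[OF matchings_symon[OF assms(1,2)] assms(3)]]
    cl_step by metis

lemma matchings_compl:
  assumes "matchings C V \<tau>" "matchings C V1 \<tau>" "V1 \<subseteq> V" shows "matchings C (V - V1) \<tau>"
proof (rule matchings_sub[OF assms(1)])
  fix x c assume x: "x \<in> V - V1" "c \<in> C"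
  then have "\<tau> c x \<notin> V1" using matchingsD(3)[OF assms(2), of c "\<tau> c x"] matchingsD(5)[OF assms(1), of c x] by auto
  then show "\<tau> c x \<in> V - V1" using x matchingsD(3)[OF assms(1)] by auto
qed auto

lemma even_card_involution:
  assumes "finite K" "\<And>x. x \<in> K \<Longrightarrow> f x \<in> K \<and> f x \<noteq> x \<and> f (f x) = x"
  shows "even (card K)"
  using assms
proof (induction "card K" arbitrary: K rule: less_induct)
  case less
  show ?case
  proof (cases "K = {}")
    case False
    then obtain x where x: "x \<in> K" by auto
    let ?L = "K - {x, f x}"
    have fx: "f x \<in> K" "f x \<noteq> x" using less.prems(2)[OF x] by auto
    have c: "card K = card ?L + 2"
      using x fx less.prems(1) card_Diff_subset[of "{x, f x}" K] card_mono[of K "{x, f x}"] by auto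
    have "even (card ?L)"
    proof (rule less.hyps)
      fix y assume y: "y \<in> ?L"
      then have "f y \<in> K" "f y \<noteq> y" "f (f y) = y" using less.prems(2)[of y] by auto
      moreover have "f y \<noteq> x" "f y \<noteq> f x" using y calculation less.prems(2)[OF x] by auto
      ultimately show "f y \<in> ?L \<and> f y \<noteq> y \<and> f (f y) = y" by auto
    qed (use c less.prems in auto)
    then show ?thesis using c by simp
  qed simp
qed

lemma even_card_matchings: "matchings C V \<tau> \<Longrightarrow> C \<noteq> {} \<Longrightarrow> even (card V)"
proof -
  assume m: "matchings C V \<tau>" and "C \<noteq> {}"
  then obtain c where "c \<in> C" by auto
  then show "even (card V)"
    using even_card_involution[of V "\<tau> c"] matchingsD[OF m] by blast
qed

lemma ncl_Un:
  assumes "matchings C V1 \<tau>" "matchings C V2 \<tau>" "V1 \<inter> V2 = {}" "P \<subseteq> C"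
  shows "ncl P (V1 \<union> V2) \<tau> = ncl P V1 \<tau> + ncl P V2 \<tau>"
  using ncr_Un[OF matchings_symon[OF assms(1,4)] matchings_symon[OF assms(2,4)]] assms matchingsD(1) by blast

lemma ncl_cong:
  assumes "matchings C V \<tau>" "P \<subseteq> C" "\<And>c x. c \<in> P \<Longrightarrow> x \<in> V \<Longrightarrow> \<sigma> c x = \<tau> c x"
  shows "ncl P V \<sigma> = ncl P V \<tau>"
proof (rule ncr_cong)
  have "matchings P V \<tau>" using matchings_mono[OF assms(1,2)] .
  then have "matchings P V \<sigma>" using assms(3) by (simp add: matchings_def)
  then show "symon V (step P \<sigma>)" using matchings_symon by blast
  show "symon V (step P \<tau>)" using matchings_symon[OF assms(1,2)] .
qed (use assms(3) in \<open>auto simp: step_iff\<close>)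

definition pairs :: "nat set \<Rightarrow> nat set set" where
  "pairs C = {P. P \<subseteq> C \<and> card P = 2}"

definition nfaces :: "nat set \<Rightarrow> 'v set \<Rightarrow> (nat \<Rightarrow> 'v \<Rightarrow> 'v) \<Rightarrow> int" where
  "nfaces C V \<tau> = (\<Sum>P\<in>pairs C. int (ncl P V \<tau>))"

text \<open>
  Four times the degree, so that no division is needed: here \<open>card C = D + 1\<close>, and a graph with \<open>2 k\<close>
  vertices has \<open>card V = 2 k\<close>. If the graph is not connected, the constant \<open>D\<close> is counted once for each
  component, which makes the degree additive.
\<close>

definition deg4 :: "nat set \<Rightarrow> 'v set \<Rightarrow> (nat \<Rightarrow> 'v \<Rightarrow> 'v) \<Rightarrow> int" where
  "deg4 C V \<tau> = (int (card C) - 1) * (int (card C) - 2) * int (card V)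
     + 4 * (int (card C) - 1) * int (ncl C V \<tau>) - 4 * nfaces C V \<tau>"

lemma finite_pairs: "finite C \<Longrightarrow> finite (pairs C)"
  by (auto simp: pairs_def)

text \<open>Splits off the pairs that contain the color \<open>i\<close>: a flip of color
  \<open>i\<close> changes no other faces.\<close>

lemma sum_pairs_remove:
  fixes f :: "nat set \<Rightarrow> int"
  assumes "finite C" "i \<in> C"
  shows "sum f (pairs C) = sum f (pairs (C - {i})) + (\<Sum>c\<in>C - {i}. f {i, c})"
proof -
  have "pairs C = pairs (C - {i}) \<union> (\<lambda>c. {i, c}) ` (C - {i})"
  proof
    show "pairs C \<subseteq> pairs (C - {i}) \<union> (\<lambda>c. {i, c}) ` (C - {i})"
    proof
      fix P assume P: "P \<in> pairs C"
      then obtain a c where ac: "P = {a, c}" "a \<noteq> c" by (auto simp: pairs_def card_2_iff)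
      show "P \<in> pairs (C - {i}) \<union> (\<lambda>c. {i, c}) ` (C - {i})"
        using P ac by (cases "i = a"; cases "i = c") (auto simp: pairs_def)
    qed
    show "pairs (C - {i}) \<union> (\<lambda>c. {i, c}) ` (C - {i}) \<subseteq> pairs C"
      using assms(2) by (auto simp: pairs_def)
  qed
  moreover have "pairs (C - {i}) \<inter> (\<lambda>c. {i, c}) ` (C - {i}) = {}" by (auto simp: pairs_def)
  moreover have "inj_on (\<lambda>c. {i, c}) (C - {i})" by (auto simp: inj_on_def doubleton_eq_iff)
  ultimately show ?thesis
    using assms(1) by (simp add: sum.union_disjoint finite_pairs sum.reindex)
qed

lemma deg4_Un:
  assumes "matchings C V1 \<tau>" "matchings C V2 \<tau>" "V1 \<inter> V2 = {}"
  shows "deg4 C (V1 \<union> V2) \<tau> = deg4 C V1 \<tau> + deg4 C V2 \<tau>"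
proof -
  have "nfaces C (V1 \<union> V2) \<tau> = nfaces C V1 \<tau> + nfaces C V2 \<tau>"
    unfolding nfaces_def sum.distrib[symmetric]
    by (rule sum.cong) (use ncl_Un[OF assms] in \<open>auto simp: pairs_def\<close>)
  moreover have "card (V1 \<union> V2) = card V1 + card V2"
    using assms(3) matchingsD(1)[OF assms(1)] matchingsD(1)[OF assms(2)] by (simp add: card_Un_disjoint)
  ultimately show ?thesis using ncl_Un[OF assms, of C] by (simp add: deg4_def algebra_simps)
qed

section \<open>Flips: exchanging the ends of two edges of one color\<close>

definition flip :: "nat \<Rightarrow> 'v \<Rightarrow> 'v \<Rightarrow> (nat \<Rightarrow> 'v \<Rightarrow> 'v) \<Rightarrow> nat \<Rightarrow> 'v \<Rightarrow> 'v" where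
  "flip i w b \<tau> = \<tau>(i := \<lambda>x. if x = w then b else if x = b then w
     else if x = \<tau> i w then \<tau> i b else if x = \<tau> i b then \<tau> i w else \<tau> i x)"

text \<open>The condition \<open>nw\<close> says that the edges of color \<open>i\<close> at
  \<open>w\<close> and at \<open>b\<close> are different, hence that their four ends are
  distinct.\<close>

locale flipping =
  fixes C :: "nat set" and V :: "'v set" and \<tau> :: "nat \<Rightarrow> 'v \<Rightarrow> 'v" and i :: nat and w b :: 'v
  assumes m: "matchings C V \<tau>" and i: "i \<in> C" and w: "w \<in> V" and b: "b \<in> V" and wb: "w \<noteq> b"
    and nw: "\<tau> i w \<noteq> b"
begin

abbreviation "\<tau>' \<equiv> flip i w b \<tau>"
abbreviation "w' \<equiv> \<tau> i w"
abbreviation "b' \<equiv> \<tau> i b"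

lemma ends: "w' \<in> V" "b' \<in> V" "\<tau> i w' = w" "\<tau> i b' = b" "w' \<noteq> w" "b' \<noteq> b" "w' \<noteq> b'" "b' \<noteq> w"
  using matchingsD[OF m] i w b wb nw by metis+

lemma flip_simps [simp]: "\<tau>' i w = b" "\<tau>' i b = w" "\<tau>' i w' = b'" "\<tau>' i b' = w'"
  "c \<noteq> i \<Longrightarrow> \<tau>' c = \<tau> c" "x \<notin> {w, b, w', b'} \<Longrightarrow> \<tau>' i x = \<tau> i x"
  using ends wb nw by (auto simp: flip_def)

lemma matchings_flip: "matchings C V \<tau>'"
  unfolding matchings_def
proof (intro conjI ballI)
  fix c x assume c: "c \<in> C" and x: "x \<in> V"
  have "\<tau>' c x \<in> V \<and> \<tau>' c x \<noteq> x \<and> \<tau>' c (\<tau>' c x) = x"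
  proof (cases "c = i \<and> x \<in> {w, b, w', b'}")
    case True then show ?thesis using ends wb w b nw by auto
  next
    case False
    show ?thesis
    proof (cases "c = i")
      case True
      then have "\<tau> i x \<notin> {w, b, w', b'}" using False ends matchingsD(5)[OF m i x] by auto
      then show ?thesis using True False matchingsD(3-5)[OF m c x] by auto
    qed (use matchingsD(3-5)[OF m c x] in auto)
  qed
  then show "\<tau>' c x \<in> V" "\<tau>' c x \<noteq> x" "\<tau>' c (\<tau>' c x) = x" by auto
qed (use matchingsD[OF m] in auto)

lemma step_flip:
  "(x, y) \<in> step P \<tau>' \<longleftrightarrow> (if i \<in> P \<and> x \<in> {w, b, w', b'}
     then (x, y) \<in> step (P - {i}) \<tau> \<or> (x, y) \<in> {(w, b), (b, w), (w', b'), (b', w')} else (x, y) \<in> step P \<tau>)"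
proof (cases "i \<in> P \<and> x \<in> {w, b, w', b'}")
  case True
  then have "(x, y) \<in> step P \<tau>' \<longleftrightarrow> (\<exists>c\<in>P - {i}. y = \<tau>' c x) \<or> y = \<tau>' i x"
    unfolding step_iff by blast
  also have "(\<exists>c\<in>P - {i}. y = \<tau>' c x) \<longleftrightarrow> (x, y) \<in> step (P - {i}) \<tau>"
    unfolding step_iff by (rule bex_cong) auto
  finally have 1: "(x, y) \<in> step P \<tau>' \<longleftrightarrow> (x, y) \<in> step (P - {i}) \<tau> \<or> y = \<tau>' i x" .
  have "y = \<tau>' i x \<longleftrightarrow> (x, y) \<in> {(w, b), (b, w), (w', b'), (b', w')}"
    using True ends wb nw by auto
  then show ?thesis using True 1 by simp
next
  case False
  have "\<tau>' c x = \<tau> c x" if "c \<in> P" for c using that False by (cases "c = i") auto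
  then show ?thesis using False by (auto simp: step_iff)
qed

text \<open>Add one more edge between \<open>w\<close> and \<open>b\<close> to the old graph. The
  path from \<open>w'\<close> over \<open>w\<close> and \<open>b\<close> to \<open>b'\<close> then
  replaces the other new edge, so the flipped graph has at least as many classes as this one; and
  the added edge merged at most two.\<close>

lemma ncl_flip_ge: assumes P: "P \<subseteq> C" shows "ncl P V \<tau> \<le> ncl P V \<tau>' + 1"
proof -
  let ?r = "step P \<tau> \<union> {(w, b), (b, w)}"
  note s = matchings_symon[OF m P]
  have "ncl P V \<tau> \<le> ncr ?r V + 1"
    using ncr_add_edge[OF matchingsD(1)[OF m] s w b] by auto
  moreover have "ncr ?r V \<le> ncl P V \<tau>'"
  proof (rule ncr_coarse(1)[OF matchingsD(1)[OF m] symon_Un[OF s symon_edge[OF w b]] matchings_symon[OF matchings_flip P]])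
    fix x y assume "x \<in> V" "(x, y) \<in> step P \<tau>'"
    then consider "(x, y) \<in> ?r" | "i \<in> P" "(x, y) = (w', b')" | "i \<in> P" "(x, y) = (b', w')"
      unfolding step_flip by (auto split: if_splits simp: step_iff)
    then show "y \<in> cls ?r x"
    proof cases
      case 1 then show ?thesis using cls_step[OF cls_refl] by metis
    next
      case 2
      have "(w', w) \<in> step P \<tau>" "(b, b') \<in> step P \<tau>" using 2(1) ends(3) unfolding step_iff by metis+
      then have "(w', w) \<in> ?r" "(w, b) \<in> ?r" "(b, b') \<in> ?r" by auto
      then show ?thesis using 2 cls_step cls_refl by (metis Pair_inject)
    next
      case 3
      have "(b', b) \<in> step P \<tau>" "(w, w') \<in> step P \<tau>" using 3(1) ends(4) unfolding step_iff by metis+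
      then have "(b', b) \<in> ?r" "(b, w) \<in> ?r" "(w, w') \<in> ?r" by auto
      then show ?thesis using 3 cls_step cls_refl by (metis Pair_inject)
    qed
  qed
  ultimately show ?thesis by simp
qed

text \<open>Flipping at \<open>w\<close> and its old neighbour restores the graph, so the upper
  bound on the number of classes follows from the lower one.\<close>

lemma flip_reverse: "flipping C V \<tau>' i w w'"
  by unfold_locales (use matchings_flip i w ends nw in auto)

lemma flip_back: "flip i w w' \<tau>' c x = \<tau> c x"
proof -
  have "flip i w w' \<tau>' i x = \<tau> i x"
    using ends wb nw by (cases "x \<in> {w, b, w', b'}") (auto simp: flip_def)
  then show ?thesis by (cases "c = i") (auto simp: flip_def)
qed

lemma ncl_flip_le: assumes P: "P \<subseteq> C" shows "ncl P V \<tau>' \<le> ncl P V \<tau> + 1"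
  using flipping.ncl_flip_ge[OF flip_reverse P] ncl_cong[OF m P, of "flip i w w' \<tau>'"] flip_back P
  by (metis subsetD)

lemma flip_swap: "flipping C V \<tau> i w' b'" "flip i w' b' \<tau> = \<tau>'"
proof -
  show "flipping C V \<tau> i w' b'" by unfold_locales (use m i ends in auto)
  show "flip i w' b' \<tau> = \<tau>'" using ends wb nw by (auto simp: flip_def fun_eq_iff)
qed

text \<open>A face is a cycle, so no edge of it is a bridge; by parity this needs no cycles.\<close>

lemma separated_joined:
  assumes P: "P \<subseteq> C" and iP: "i \<in> P" and j: "j \<in> P" "j \<noteq> i" and sep: "w' \<notin> cl P \<tau>' w"
  shows "b \<in> cl P \<tau> w"
proof -
  \<comment> \<open>\<open>?K\<close> is the class of \<open>w\<close> under the steps that both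
    graphs have. It misses \<open>w'\<close> and \<open>b'\<close>. If it also missed
    \<open>b\<close>, color \<open>j\<close> would match \<open>?K\<close> perfectly and color
    \<open>i\<close> would match \<open>?K\<close> without \<open>w\<close>, against parity.\<close>
  let ?r = "step P \<tau> \<inter> step P \<tau>'"
  let ?K = "cls ?r w"
  have K: "?K \<subseteq> cl P \<tau>' w" "?K \<subseteq> cl P \<tau> w" by (auto intro!: cls_mono)
  have KV: "?K \<subseteq> V" using K(2) cls_subset[OF matchings_symon[OF m P] w] by auto
  have "b \<in> ?K"
  proof (rule ccontr)
    assume nb: "b \<notin> ?K"
    have w': "w' \<notin> ?K" using sep K by auto
    have "b' \<notin> cl P \<tau>' w"
    proof
      assume "b' \<in> cl P \<tau>' w"
      from cl_step[OF this iP] show False using sep by simp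
    qed
    then have b': "b' \<notin> ?K" using K by auto
    have "even (card ?K)"
    proof (rule even_card_involution[where f = "\<tau> j"])
      fix x assume x: "x \<in> ?K"
      have "(x, \<tau> j x) \<in> ?r" using j by (auto simp: step_iff intro!: bexI[of _ j])
      then have "\<tau> j x \<in> ?K" using cls_step[OF x] by blast
      moreover have "x \<in> V" "j \<in> C" using x KV j P by auto
      ultimately show "\<tau> j x \<in> ?K \<and> \<tau> j x \<noteq> x \<and> \<tau> j (\<tau> j x) = x"
        using matchingsD(4,5)[OF m] by blast
    qed (use KV matchingsD(1)[OF m] finite_subset in blast)
    moreover have "even (card (?K - {w}))"
    proof (rule even_card_involution[where f = "\<tau> i"])
      fix x assume x: "x \<in> ?K - {w}"
      then have "x \<notin> {w, b, w', b'}" using nb w' b' by auto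
      then have "(x, \<tau> i x) \<in> ?r" using iP by (auto simp: step_iff intro!: bexI[of _ i])
      then have 1: "\<tau> i x \<in> ?K" using cls_step[of x ?r w] x by blast
      have xV: "x \<in> V" using x KV by auto
      have "\<tau> i x \<noteq> w" using matchings_eqD(2)[OF m i xV w] x w' by auto
      then show "\<tau> i x \<in> ?K - {w} \<and> \<tau> i x \<noteq> x \<and> \<tau> i (\<tau> i x) = x"
        using 1 matchingsD(3-5)[OF m i xV] by auto
    qed (use KV matchingsD(1)[OF m] finite_subset in blast)
    moreover have "card ?K = Suc (card (?K - {w}))"
      using card.remove[OF finite_subset[OF KV matchingsD(1)[OF m]] cls_refl] .
    ultimately show False by (metis even_Suc)
  qed
  then show ?thesis using K by auto
qed

text \<open>By \<open>separated_joined\<close>, applied to both pairs of ends, the new edges run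
  inside old classes. So the new classes refine the old ones, and strictly, since \<open>w\<close>
  and its old neighbour come apart; a flip cannot gain more than one class.\<close>

lemma ncl_flip_separated:
  assumes P: "P \<subseteq> C" and iP: "i \<in> P" and j: "j \<in> P" "j \<noteq> i" and sep: "w' \<notin> cl P \<tau>' w"
  shows "ncl P V \<tau>' = ncl P V \<tau> + 1"
proof -
  note s = matchings_symon[OF m P] and s' = matchings_symon[OF matchings_flip P]
  have 1: "b \<in> cl P \<tau> w" by (rule separated_joined[OF assms])
  have "w \<notin> cl P \<tau>' w'" using sep cls_sym[OF s' ends(1)] by auto
  then have 2: "b' \<in> cl P \<tau> w'"
    using flipping.separated_joined[OF flip_swap(1) P iP j] flip_swap(2) ends by simp
  have "ncl P V \<tau> < ncl P V \<tau>'"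
  proof (rule ncr_coarse(2)[OF matchingsD(1)[OF m] s s' _ w _ sep])
    show "w' \<in> cl P \<tau> w" using cl_step[OF cls_refl iP] .
    fix x y assume "x \<in> V" and xy: "(x, y) \<in> step P \<tau>'"
    then consider "(x, y) \<in> step P \<tau>" | "(x, y) \<in> {(w, b), (b, w), (w', b'), (b', w')}"
      unfolding step_flip by (auto split: if_splits simp: step_iff)
    then show "y \<in> cl P \<tau> x"
    proof cases
      case 1 then show ?thesis using cls_step[OF cls_refl] by metis
    next
      case 2 then show ?thesis using \<open>b \<in> cl P \<tau> w\<close> \<open>b' \<in> cl P \<tau> w'\<close> cls_sym[OF s] w ends by auto
    qed
  qed
  then show ?thesis using ncl_flip_le[OF P] by simp
qed

text \<open>The four ends lie in one new class, so both removed edges run inside new classes and the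
  old classes refine the new ones.\<close>

lemma ncl_flip_connected:
  assumes P: "P \<subseteq> C" and iP: "i \<in> P" and con: "w' \<in> cl P \<tau>' w"
  shows "ncl P V \<tau>' \<le> ncl P V \<tau>"
proof (rule ncr_coarse(1)[OF matchingsD(1)[OF m] matchings_symon[OF matchings_flip P] matchings_symon[OF m P]])
  note s' = matchings_symon[OF matchings_flip P]
  have e: "b \<in> cl P \<tau>' w" "b' \<in> cl P \<tau>' w"
    using cl_step[OF cls_refl[of w] iP, of \<tau>'] cl_step[OF con iP] by auto
  fix x y assume x: "x \<in> V" and "(x, y) \<in> step P \<tau>"
  then obtain c where c: "c \<in> P" "y = \<tau> c x" by (auto simp: step_iff)
  show "y \<in> cl P \<tau>' x"
  proof (cases "c = i \<and> x \<in> {w, b, w', b'}")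
    case True
    then have "x \<in> cl P \<tau>' w" "y \<in> cl P \<tau>' w" using e con c ends by auto
    then show ?thesis using cls_eq[OF s' w] by metis
  next
    case False
    then have "y = \<tau>' c x" using c by (cases "c = i") auto
    then show ?thesis using cl_step[OF cls_refl c(1), of \<tau>'] by simp
  qed
qed

text \<open>After the flip \<open>w\<close> and \<open>b\<close> are joined in both colors and form
  a face of length 2.\<close>

lemma separated_pair:
  assumes "c \<in> C" "c \<noteq> i" "\<tau> c w = b"
  shows "w' \<notin> cl {i, c} \<tau>' w"
proof -
  have cb: "\<tau> c b = w" using matchings_eqD(2)[OF m assms(1) w b] assms(3) by simp
  have c: "\<tau>' c w = b" "\<tau>' c b = w" using flip_simps(5)[OF assms(2)] assms(3) cb by simp_all
  have "cl {i, c} \<tau>' w \<subseteq> {w, b}" by (rule cl_least) (use c in auto)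
  then show ?thesis using ends nw by auto
qed

text \<open>With \<open>D = card C - 1\<close> there are \<open>D\<close> color pairs containing
  \<open>i\<close>. A pair \<open>{i, c}\<close> with \<open>c\<close> in \<open>H\<close> gains a
  face, any other loses at most one: together at least \<open>2 * card H - D\<close>. If the flip
  disconnects \<open>w\<close> from its old neighbour, all \<open>D\<close> pairs gain one.\<close>

lemma nfaces_flip:
  assumes H: "H \<subseteq> C - {i}" "\<forall>c\<in>H. \<tau> c w = b"
  shows "nfaces C V \<tau>' \<ge> nfaces C V \<tau> + 2 * int (card H) - (int (card C) - 1)"
    "w' \<notin> cl C \<tau>' w \<Longrightarrow> nfaces C V \<tau>' \<ge> nfaces C V \<tau> + (int (card C) - 1)"
proof -
  have fC: "finite C" using matchingsD(2)[OF m] .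
  let ?d = "\<lambda>c. int (ncl {i, c} V \<tau>') - int (ncl {i, c} V \<tau>)"
  have "ncl P V \<tau>' = ncl P V \<tau>" if "P \<in> pairs (C - {i})" for P
  proof (rule ncl_cong[OF m])
    fix c x assume "c \<in> P" then have "c \<noteq> i" using that by (auto simp: pairs_def)
    then show "\<tau>' c x = \<tau> c x" by simp
  qed (use that in \<open>auto simp: pairs_def\<close>)
  then have eq: "nfaces C V \<tau>' - nfaces C V \<tau> = (\<Sum>c\<in>C - {i}. ?d c)"
    unfolding nfaces_def sum_pairs_remove[OF fC i] by (simp add: sum_subtractf)
  have ci: "int (card (C - {i})) = int (card C) - 1" using fC i
    by (metis One_nat_def Suc_leI card_Diff_singleton card_gt_0_iff empty_iff of_nat_1 of_nat_diff)
  have "int (card H) - int (card (C - {i} - H)) = (\<Sum>c\<in>C - {i}. if c \<in> H then 1 else -1)"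
    using H(1) fC by (simp add: sum.If_cases Int_absorb1 Diff_eq[symmetric])
  also have "\<dots> \<le> (\<Sum>c\<in>C - {i}. ?d c)"
  proof (rule sum_mono)
    fix c assume c: "c \<in> C - {i}"
    show "(if c \<in> H then 1 else -1) \<le> ?d c"
    proof (cases "c \<in> H")
      case True
      then show ?thesis using ncl_flip_separated[of "{i, c}" c] separated_pair[of c] c i H by auto
    next
      case False
      then show ?thesis using ncl_flip_ge[of "{i, c}"] c i by auto
    qed
  qed
  moreover have "int (card (C - {i} - H)) = int (card (C - {i})) - int (card H)"
    using H(1) fC by (simp add: card_Diff_subset finite_subset card_mono of_nat_diff)
  ultimately show "nfaces C V \<tau>' \<ge> nfaces C V \<tau> + 2 * int (card H) - (int (card C) - 1)"
    using eq ci by linarith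
  assume sep: "w' \<notin> cl C \<tau>' w"
  have "int (card (C - {i})) = (\<Sum>c\<in>C - {i}. 1)" by simp
  also have "\<dots> \<le> (\<Sum>c\<in>C - {i}. ?d c)"
  proof (rule sum_mono)
    fix c assume c: "c \<in> C - {i}"
    have "cl {i, c} \<tau>' w \<subseteq> cl C \<tau>' w" by (rule cls_mono) (use c i in \<open>auto simp: step_def\<close>)
    then have "w' \<notin> cl {i, c} \<tau>' w" using sep by blast
    then show "1 \<le> ?d c" using ncl_flip_separated[of "{i, c}" c] c i by auto
  qed
  finally show "nfaces C V \<tau>' \<ge> nfaces C V \<tau> + (int (card C) - 1)" using eq ci by linarith
qed

text \<open>Without separation the number of components does not grow, so \<open>deg4\<close> falls
  by at least \<open>4 * (2 * card H - D)\<close>, where \<open>D = card C - 1\<close>. With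
  separation the additional component weighs as much as \<open>D\<close> faces, and at least that
  many faces are gained.\<close>

lemma deg4_flip:
  assumes H: "H \<subseteq> C - {i}" "\<forall>c\<in>H. \<tau> c w = b"
  shows "w' \<in> cl C \<tau>' w \<Longrightarrow> deg4 C V \<tau>' + 8 * int (card H) + 4 \<le> deg4 C V \<tau> + 4 * int (card C)"
    "w' \<notin> cl C \<tau>' w \<Longrightarrow> deg4 C V \<tau>' \<le> deg4 C V \<tau>"
proof -
  have c1: "0 \<le> int (card C) - 1" using i matchingsD(2)[OF m] by (metis One_nat_def Suc_leI card_gt_0_iff diff_ge_0_iff_ge empty_iff of_nat_1 of_nat_le_iff)
  assume "w' \<in> cl C \<tau>' w"
  then have "ncl C V \<tau>' \<le> ncl C V \<tau>" using ncl_flip_connected i by blast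
  then have "(int (card C) - 1) * int (ncl C V \<tau>') \<le> (int (card C) - 1) * int (ncl C V \<tau>)"
    using c1 by (simp add: mult_left_mono)
  then show "deg4 C V \<tau>' + 8 * int (card H) + 4 \<le> deg4 C V \<tau> + 4 * int (card C)"
    using nfaces_flip(1)[OF H] unfolding deg4_def by (simp add: algebra_simps)
next
  have c1: "0 \<le> int (card C) - 1" using i matchingsD(2)[OF m] by (metis One_nat_def Suc_leI card_gt_0_iff diff_ge_0_iff_ge empty_iff of_nat_1 of_nat_le_iff)
  assume sep: "w' \<notin> cl C \<tau>' w"
  have "ncl C V \<tau>' \<le> ncl C V \<tau> + 1" using ncl_flip_le by blast
  then have "(int (card C) - 1) * int (ncl C V \<tau>') \<le> (int (card C) - 1) * int (ncl C V \<tau> + 1)"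
    using c1 by (simp add: mult_left_mono)
  then show "deg4 C V \<tau>' \<le> deg4 C V \<tau>"
    using nfaces_flip(2)[OF H sep] unfolding deg4_def by (simp add: algebra_simps)
qed

end

section \<open>Non-negativity of the degree, and melons\<close>

definition conn :: "nat set \<Rightarrow> 'v set \<Rightarrow> (nat \<Rightarrow> 'v \<Rightarrow> 'v) \<Rightarrow> bool" where
  "conn C V \<tau> \<longleftrightarrow> (\<forall>x\<in>V. cl C \<tau> x = V)"

definition par :: "nat set \<Rightarrow> (nat \<Rightarrow> 'v \<Rightarrow> 'v) \<Rightarrow> 'v \<Rightarrow> 'v \<Rightarrow> nat set" where
  "par C \<tau> w b = {c \<in> C. \<tau> c w = b}"

lemma conn_cl: "matchings C V \<tau> \<Longrightarrow> x \<in> V \<Longrightarrow> conn C (cl C \<tau> x) \<tau>"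
  unfolding conn_def by (intro ballI cls_eq[OF matchings_symon[OF _ order_refl]])

lemma ncl_conn: "conn C V \<tau> \<Longrightarrow> V \<noteq> {} \<Longrightarrow> ncl C V \<tau> = 1"
proof -
  assume "conn C V \<tau>" "V \<noteq> {}"
  then have "cl C \<tau> ` V = {V}" by (auto simp: conn_def)
  then show ?thesis by (simp add: ncr_def)
qed

lemma card_pairs: "finite C \<Longrightarrow> 2 * int (card (pairs C)) = int (card C) * (int (card C) - 1)"
proof -
  assume "finite C"
  then have "card (pairs C) = card C choose 2" by (simp add: pairs_def n_subsets)
  also have "\<dots> = card C * (card C - 1) div 2" by (rule choose_two)
  finally have "2 * card (pairs C) = card C * (card C - 1)"
    using even_mult_iff[of "card C" "card C - 1"] by (cases "card C") auto
  then have "2 * int (card (pairs C)) = int (card C * (card C - 1))" by presburger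
  then show ?thesis by (cases "card C") (auto simp: algebra_simps)
qed

lemma deg4_pair:
  assumes m: "matchings C {w, b} \<tau>" "C \<noteq> {}" "w \<noteq> b"
  shows "deg4 C {w, b} \<tau> = 0"
proof -
  have t: "\<tau> c w = b" "\<tau> c b = w" if "c \<in> C" for c
    using matchingsD(3,4)[OF m(1) that] by blast+
  have n1: "ncl P {w, b} \<tau> = 1" if "P \<subseteq> C" "P \<noteq> {}" for P
  proof (rule ncl_conn)
    obtain c where c: "c \<in> P" using \<open>P \<noteq> {}\<close> by auto
    have "cl P \<tau> x = {w, b}" if "x \<in> {w, b}" for x
    proof
      show "cl P \<tau> x \<subseteq> {w, b}" by (rule cl_least) (use t \<open>P \<subseteq> C\<close> that in auto)
      show "{w, b} \<subseteq> cl P \<tau> x" using cl_step[OF cls_refl c, of \<tau> x] t c \<open>P \<subseteq> C\<close> that by auto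
    qed
    then show "conn P {w, b} \<tau>" by (simp add: conn_def)
  qed simp
  have "ncl P {w, b} \<tau> = 1" if "P \<in> pairs C" for P
    using that n1[of P] by (cases "P = {}") (auto simp: pairs_def)
  then have "nfaces C {w, b} \<tau> = (\<Sum>P\<in>pairs C. 1)" by (simp add: nfaces_def)
  then have "2 * nfaces C {w, b} \<tau> = int (card C) * (int (card C) - 1)"
    using card_pairs[OF matchingsD(2)[OF m(1)]] by simp
  then show ?thesis using n1[OF order_refl m(2)] m(3) unfolding deg4_def by (simp add: algebra_simps)
qed

lemma matchings_pair:
  assumes "matchings C V \<tau>" "w \<in> V" "b \<in> V" "w \<noteq> b" "\<forall>c\<in>C. \<tau> c w = b"
  shows "matchings C {w, b} \<tau>"
proof (rule matchings_sub[OF assms(1)])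
  fix x c assume "x \<in> {w, b}" "c \<in> C"
  then show "\<tau> c x \<in> {w, b}" using assms(5) matchings_eqD(2)[OF assms(1) _ assms(2,3), of c] by auto
qed (use assms in auto)

text \<open>The numerical condition says that at least half of the other colors already join the
  pair; then neither case of \<open>deg4_flip\<close> raises the degree.\<close>

lemma close_color:
  assumes m: "matchings C V \<tau>" and i: "i \<in> C" and w: "w \<in> V" and b: "b \<in> V" and wb: "w \<noteq> b"
    and H: "H \<subseteq> C - {i}" "\<forall>c\<in>H. \<tau> c w = b" "card C \<le> 2 * card H + 1"
  shows "\<exists>\<tau>'. matchings C V \<tau>' \<and> deg4 C V \<tau>' \<le> deg4 C V \<tau> \<and> \<tau>' i w = b \<and> (\<forall>j. j \<noteq> i \<longrightarrow> \<tau>' j = \<tau> j)"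
proof (cases "\<tau> i w = b")
  case False
  interpret flipping C V \<tau> i w b by unfold_locales (use assms False in auto)
  have "deg4 C V \<tau>' \<le> deg4 C V \<tau>"
    using deg4_flip[OF H(1,2)] H(3) by (cases "w' \<in> cl C \<tau>' w") auto
  then show ?thesis using matchings_flip flip_simps(1,5) by blast
qed (use m in blast)

text \<open>For a connected graph with three colors \<open>deg4\<close> is four times the Euler
  genus of the surface obtained by gluing a disc into every face. The proof avoids topology: at the
  ends of an edge the other two colors are closed one after the other, which never raises the
  degree, and then a two-vertex component of degree 0 splits off.\<close>

lemma deg4_nonneg_3:
  assumes "matchings C V \<tau>" "card C = 3"
  shows "0 \<le> deg4 C V \<tau>"
  using assms(1)
proof (induction "card V" arbitrary: V \<tau> rule: less_induct)
  case less
  show ?case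
  proof (cases "V = {}")
    case True
    then show ?thesis by (simp add: deg4_def nfaces_def ncr_def)
  next
    case False
    then obtain w where w: "w \<in> V" by auto
    obtain a c d where C: "C = {a, c, d}" "a \<noteq> c" "a \<noteq> d" "c \<noteq> d"
      using assms(2) by (auto simp: card_3_iff)
    define b where "b = \<tau> a w"
    have b: "b \<in> V" "w \<noteq> b" using matchingsD(3,4)[OF less.prems, of a w] C w by (auto simp: b_def)
    obtain \<tau>1 where 1: "matchings C V \<tau>1" "deg4 C V \<tau>1 \<le> deg4 C V \<tau>" "\<tau>1 c w = b" "\<And>j. j \<noteq> c \<Longrightarrow> \<tau>1 j = \<tau> j"
      using close_color[OF less.prems _ w b, of c "{a}"] C b_def by auto
    obtain \<tau>2 where 2: "matchings C V \<tau>2" "deg4 C V \<tau>2 \<le> deg4 C V \<tau>1" "\<tau>2 d w = b" "\<And>j. j \<noteq> d \<Longrightarrow> \<tau>2 j = \<tau>1 j"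
      using close_color[OF 1(1) _ w b, of d "{a, c}"] C b_def 1(3,4) by auto
    have all: "\<forall>e\<in>C. \<tau>2 e w = b" using 1 2 C b_def by auto
    have mp: "matchings C {w, b} \<tau>2" by (rule matchings_pair[OF 2(1) w b all])
    have mr: "matchings C (V - {w, b}) \<tau>2" by (rule matchings_compl[OF 2(1) mp]) (use w b in auto)
    have V: "V = {w, b} \<union> (V - {w, b})" using w b by auto
    have "card (V - {w, b}) < card V" using w matchingsD(1)[OF less.prems] by (intro psubset_card_mono) auto
    then have "0 \<le> deg4 C (V - {w, b}) \<tau>2" using less.hyps mr by blast
    moreover have "deg4 C V \<tau>2 = deg4 C {w, b} \<tau>2 + deg4 C (V - {w, b}) \<tau>2"
      using deg4_Un[OF mp mr] V by auto
    moreover have "deg4 C {w, b} \<tau>2 = 0" using deg4_pair[OF mp] C b by auto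
    ultimately show ?thesis using 1(2) 2(2) by simp
  qed
qed

section \<open>Bubbles: the components left when one color is omitted\<close>

lemma ncl_submod:
  assumes "matchings C V \<tau>" "A \<subseteq> C" "B \<subseteq> C"
  shows "ncl A V \<tau> + ncl B V \<tau> \<le> ncl (A \<inter> B) V \<tau> + ncl (A \<union> B) V \<tau>"
proof -
  have e: "step (A \<inter> B) \<tau> \<union> step A \<tau> = step A \<tau>" "step (A \<inter> B) \<tau> \<union> step B \<tau> = step B \<tau>"
    "step A \<tau> \<union> step B \<tau> = step (A \<union> B) \<tau>" by (auto simp: step_def)
  show ?thesis
    using ncr_submod[OF matchingsD(1)[OF assms(1)], of "step (A \<inter> B) \<tau>" "step A \<tau>" "step B \<tau>"]
      matchings_symon[OF assms(1)] assms(2,3) unfolding e by (simp add: le_infI1)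
qed

lemma pairs_3:
  assumes "card C = 3"
  shows "nfaces C V \<tau> = (\<Sum>c\<in>C. int (ncl (C - {c}) V \<tau>))"
proof -
  have fC: "finite C" using assms by (simp add: card_ge_0_finite)
  have "pairs C = (\<lambda>c. C - {c}) ` C"
  proof
    show "(\<lambda>c. C - {c}) ` C \<subseteq> pairs C" using assms by (auto simp: pairs_def)
    show "pairs C \<subseteq> (\<lambda>c. C - {c}) ` C"
    proof
      fix P assume P: "P \<in> pairs C"
      then have "card (C - P) = 1" using assms fC finite_subset[OF _ fC] by (auto simp: pairs_def card_Diff_subset)
      then obtain c where c: "C - P = {c}" by (auto simp: card_1_singleton_iff)
      then have "P = C - {c}" "c \<in> C" using P by (auto simp: pairs_def)
      then show "P \<in> (\<lambda>c. C - {c}) ` C" by auto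
    qed
  qed
  moreover have "inj_on (\<lambda>c. C - {c}) C" by (auto simp: inj_on_def)
  ultimately show ?thesis by (simp add: nfaces_def sum.reindex)
qed

text \<open>Induction on the number of colors. For three colors omitting one leaves the faces, and
  the claim is \<open>deg4_nonneg_3\<close>. In the step a color \<open>d\<close> is dropped and
  \<open>ncl_submod\<close> is applied to \<open>C - {c}\<close> and \<open>C - {d}\<close> for
  every other color \<open>c\<close>.\<close>

lemma nbubbles_le:
  assumes "matchings C V \<tau>" "3 \<le> card C"
  shows "2 * (\<Sum>c\<in>C. int (ncl (C - {c}) V \<tau>)) \<le> int (card V) + 2 * (int (card C) - 1) * int (ncl C V \<tau>)"
  using assms(2,1)
proof (induction "card C" arbitrary: C rule: nat_induct_at_least)
  case base
  then show ?case using deg4_nonneg_3[OF base(2)] pairs_3[of C V \<tau>] by (simp add: deg4_def)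
next
  case (Suc n)
  have fC: "finite C" using matchingsD(2)[OF Suc.prems] .
  obtain d where d: "d \<in> C" using Suc.hyps by (metis card.empty all_not_in_conv nat.distinct(1))
  let ?C0 = "C - {d}"
  let ?n = "\<lambda>P. int (ncl P V \<tau>)"
  have c0: "card ?C0 = n" using d Suc.hyps(3) fC by simp
  have IH: "2 * (\<Sum>c\<in>?C0. ?n (?C0 - {c})) \<le> int (card V) + 2 * (int n - 1) * ?n ?C0"
    using Suc.hyps(2)[OF c0[symmetric] matchings_mono[OF Suc.prems]] c0 by auto
  have "(\<Sum>c\<in>?C0. ?n (C - {c}) + ?n ?C0) \<le> (\<Sum>c\<in>?C0. ?n (?C0 - {c}) + ?n C)"
  proof (rule sum_mono)
    fix c assume c: "c \<in> ?C0"
    have "(C - {c}) \<inter> ?C0 = ?C0 - {c}" "(C - {c}) \<union> ?C0 = C" using c d by auto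
    then show "?n (C - {c}) + ?n ?C0 \<le> ?n (?C0 - {c}) + ?n C"
      using ncl_submod[OF Suc.prems, of "C - {c}" ?C0] by auto
  qed
  then have 1: "(\<Sum>c\<in>?C0. ?n (C - {c})) + int n * ?n ?C0 \<le> (\<Sum>c\<in>?C0. ?n (?C0 - {c})) + int n * ?n C"
    by (simp add: sum.distrib c0)
  have 2: "(\<Sum>c\<in>C. ?n (C - {c})) = ?n ?C0 + (\<Sum>c\<in>?C0. ?n (C - {c}))"
    using sum.remove[OF fC d] by simp
  have "2 * (\<Sum>c\<in>C. ?n (C - {c})) \<le> int (card V) + 2 * int n * ?n C"
    using IH 1 2 by (simp add: algebra_simps)
  then show ?case using Suc.hyps(3)[symmetric] by simp
qed

text \<open>Double counting: a pair of colors survives the removal of each of the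
  \<open>card C - 2\<close> other colors.\<close>

lemma sum_nfaces_remove:
  assumes "finite C"
  shows "(\<Sum>c\<in>C. nfaces (C - {c}) V \<tau>) = (int (card C) - 2) * nfaces C V \<tau>"
proof -
  have "pairs (C - {c}) = {P \<in> pairs C. c \<notin> P}" for c by (auto simp: pairs_def)
  then have "(\<Sum>c\<in>C. nfaces (C - {c}) V \<tau>) = (\<Sum>c\<in>C. \<Sum>P\<in>{P \<in> pairs C. c \<notin> P}. int (ncl P V \<tau>))"
    by (simp add: nfaces_def)
  also have "\<dots> = (\<Sum>P\<in>pairs C. \<Sum>c\<in>{c \<in> C. c \<notin> P}. int (ncl P V \<tau>))"
    using sum.swap_restrict[OF assms finite_pairs[OF assms]] by fast
  also have "\<dots> = (\<Sum>P\<in>pairs C. (int (card C) - 2) * int (ncl P V \<tau>))"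
  proof (rule sum.cong[OF refl])
    fix P assume P: "P \<in> pairs C"
    have "{c \<in> C. c \<notin> P} = C - P" by auto
    moreover have "card (C - P) = card C - 2" "card P \<le> card C" "card P = 2"
      using P assms finite_subset[OF _ assms, of P] card_mono[OF assms, of P]
      by (auto simp: pairs_def card_Diff_subset)
    ultimately show "(\<Sum>c\<in>{c \<in> C. c \<notin> P}. int (ncl P V \<tau>)) = (int (card C) - 2) * int (ncl P V \<tau>)"
      by (simp add: of_nat_diff)
  qed
  finally show ?thesis by (simp add: nfaces_def sum_distrib_left)
qed

text \<open>Reduces the degree to that of the bubbles. The factor \<open>card C - 2\<close> is the
  number of removed colors for which a given face is still present. The bracket is non-negative by
  \<open>nbubbles_le\<close>, so that \<open>deg4_nonneg\<close> follows by induction on the number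
  of colors.\<close>

lemma deg4_bubbles:
  assumes "finite C" "C \<noteq> {}"
  shows "(int (card C) - 2) * deg4 C V \<tau> =
    (int (card C) - 2) * (2 * int (card V) + 4 * (int (card C) - 1) * int (ncl C V \<tau>)
      - 4 * (\<Sum>c\<in>C. int (ncl (C - {c}) V \<tau>))) + (\<Sum>c\<in>C. deg4 (C - {c}) V \<tau>)"
proof -
  let ?q = "int (card C)"
  have cc: "int (card (C - {c})) = ?q - 1" if "c \<in> C" for c
    using that assms by (metis One_nat_def Suc_leI card_Diff_singleton card_gt_0_iff of_nat_1 of_nat_diff)
  have "(\<Sum>c\<in>C. deg4 (C - {c}) V \<tau>) = (\<Sum>c\<in>C. (?q - 2) * (?q - 3) * int (card V)
      + 4 * (?q - 2) * int (ncl (C - {c}) V \<tau>) - 4 * nfaces (C - {c}) V \<tau>)"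
  proof (rule sum.cong[OF refl])
    fix c assume "c \<in> C"
    from cc[OF this] show "deg4 (C - {c}) V \<tau> = (?q - 2) * (?q - 3) * int (card V)
      + 4 * (?q - 2) * int (ncl (C - {c}) V \<tau>) - 4 * nfaces (C - {c}) V \<tau>"
      unfolding deg4_def by (simp only:) (simp add: algebra_simps)
  qed
  also have "\<dots> = ?q * ((?q - 2) * (?q - 3) * int (card V))
      + 4 * (?q - 2) * (\<Sum>c\<in>C. int (ncl (C - {c}) V \<tau>)) - 4 * (\<Sum>c\<in>C. nfaces (C - {c}) V \<tau>)"
    by (simp add: sum.distrib sum_subtractf sum_distrib_left)
  also have "(\<Sum>c\<in>C. nfaces (C - {c}) V \<tau>) = (?q - 2) * nfaces C V \<tau>"
    by (rule sum_nfaces_remove[OF assms(1)])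
  finally show ?thesis unfolding deg4_def by (simp add: algebra_simps)
qed

lemma deg4_nonneg:
  assumes "matchings C V \<tau>" "3 \<le> card C"
  shows "0 \<le> deg4 C V \<tau>"
  using assms(2,1)
proof (induction "card C" arbitrary: C rule: nat_induct_at_least)
  case base then show ?case using deg4_nonneg_3 by simp
next
  case (Suc n)
  have fC: "finite C" "C \<noteq> {}" using matchingsD(2)[OF Suc.prems] Suc.hyps by auto
  have q: "int (card C) \<ge> 4" using Suc.hyps by linarith
  have "0 \<le> (\<Sum>c\<in>C. deg4 (C - {c}) V \<tau>)"
  proof (rule sum_nonneg)
    fix c assume "c \<in> C"
    then have "n = card (C - {c})" using fC Suc.hyps(3) by simp
    then show "0 \<le> deg4 (C - {c}) V \<tau>" using Suc.hyps(2) matchings_mono[OF Suc.prems] by auto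
  qed
  moreover have "0 \<le> (int (card C) - 2) * (2 * int (card V) + 4 * (int (card C) - 1) * int (ncl C V \<tau>)
      - 4 * (\<Sum>c\<in>C. int (ncl (C - {c}) V \<tau>)))"
  proof (rule mult_nonneg_nonneg)
    have "3 \<le> card C" using q by linarith
    from nbubbles_le[OF Suc.prems this] show "0 \<le> 2 * int (card V) + 4 * (int (card C) - 1) * int (ncl C V \<tau>)
      - 4 * (\<Sum>c\<in>C. int (ncl (C - {c}) V \<tau>))" by (simp add: algebra_simps)
  qed (use q in simp)
  ultimately have "0 \<le> (int (card C) - 2) * deg4 C V \<tau>" using deg4_bubbles[OF fC, of V \<tau>] by simp
  then show ?case using q by (simp add: zero_le_mult_iff)
qed

text \<open>Both terms on the right of \<open>deg4_bubbles\<close> are non-negative, so each is at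
  most the left side. The second bound says that a graph of small degree has many bubbles, about one
  for every two vertices.\<close>

lemma deg4_bubbles_le:
  assumes "matchings C V \<tau>" "4 \<le> card C"
  shows "(\<Sum>c\<in>C. deg4 (C - {c}) V \<tau>) \<le> (int (card C) - 2) * deg4 C V \<tau>" (is ?A)
    "2 * int (card V) + 4 * (int (card C) - 1) * int (ncl C V \<tau>) - deg4 C V \<tau>
      \<le> 4 * (\<Sum>c\<in>C. int (ncl (C - {c}) V \<tau>))" (is ?B)
    "c \<in> C \<Longrightarrow> deg4 (C - {c}) V \<tau> \<le> (int (card C) - 2) * deg4 C V \<tau>"
proof -
  have fC: "finite C" "C \<noteq> {}" using matchingsD(2)[OF assms(1)] assms(2) by auto
  let ?X = "2 * int (card V) + 4 * (int (card C) - 1) * int (ncl C V \<tau>)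
      - 4 * (\<Sum>c\<in>C. int (ncl (C - {c}) V \<tau>))"
  have q: "int (card C) \<ge> 4" using assms by linarith
  have nn: "0 \<le> deg4 (C - {c}) V \<tau>" if "c \<in> C" for c
    using deg4_nonneg[OF matchings_mono[OF assms(1), of "C - {c}"]] that assms(2) fC by auto
  have "3 \<le> card C" using assms(2) by simp
  from nbubbles_le[OF assms(1) this] have "0 \<le> ?X" by (simp add: algebra_simps)
  then have "0 \<le> (int (card C) - 2) * ?X"
    using q by (intro mult_nonneg_nonneg) auto
  then show A: ?A using deg4_bubbles[OF fC, of V \<tau>] by simp
  have "0 \<le> (\<Sum>c\<in>C. deg4 (C - {c}) V \<tau>)" by (rule sum_nonneg) (rule nn)
  then have "(int (card C) - 2) * ?X \<le> (int (card C) - 2) * deg4 C V \<tau>"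
    using deg4_bubbles[OF fC, of V \<tau>] by simp
  then have "?X \<le> deg4 C V \<tau>" using q by (simp add: mult_le_cancel_left)
  then show ?B by simp
  assume "c \<in> C"
  then show "deg4 (C - {c}) V \<tau> \<le> (int (card C) - 2) * deg4 C V \<tau>"
    using A member_le_sum[of c C "\<lambda>c. deg4 (C - {c}) V \<tau>"] nn fC by force
qed

section \<open>Additivity over components\<close>

lemma additive_cl:
  fixes f :: "'v set \<Rightarrow> int"
  assumes "matchings P V \<tau>" "f {} = 0"
    "\<And>V1 V2. matchings P V1 \<tau> \<Longrightarrow> matchings P V2 \<tau> \<Longrightarrow> V1 \<inter> V2 = {} \<Longrightarrow> f (V1 \<union> V2) = f V1 + f V2"
  shows "f V = (\<Sum>K\<in>cl P \<tau> ` V. f K)"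
  using assms(1)
proof (induction "card V" arbitrary: V rule: less_induct)
  case less
  show ?case
  proof (cases "V = {}")
    case False
    then obtain x where x: "x \<in> V" by auto
    let ?K = "cl P \<tau> x"
    note s = matchings_symon[OF less.prems order_refl]
    have KV: "?K \<subseteq> V" by (rule cls_subset[OF s x])
    have mK: "matchings P ?K \<tau>" by (rule matchings_cl[OF less.prems order_refl x])
    have mR: "matchings P (V - ?K) \<tau>" by (rule matchings_compl[OF less.prems mK KV])
    have "card (V - ?K) < card V" using x KV matchingsD(1)[OF less.prems]
      by (intro psubset_card_mono) (auto intro: cls_refl)
    then have IH: "f (V - ?K) = (\<Sum>K\<in>cl P \<tau> ` (V - ?K). f K)" using less.hyps mR by blast
    have "cl P \<tau> ` V = insert ?K (cl P \<tau> ` (V - ?K))" using cls_eq[OF s x] x by blast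
    moreover have "?K \<notin> cl P \<tau> ` (V - ?K)" by (metis DiffD2 cls_refl imageE)
    moreover have "f V = f ?K + f (V - ?K)"
      using assms(3)[OF mK mR] KV by (metis Diff_disjoint Diff_partition)
    ultimately show ?thesis using IH matchingsD(1)[OF mR] by simp
  qed (simp add: assms(2))
qed

lemma deg4_cl:
  assumes "matchings P V \<tau>"
  shows "deg4 P V \<tau> = (\<Sum>K\<in>cl P \<tau> ` V. deg4 P K \<tau>)"
  by (rule additive_cl[OF assms]) (auto simp: deg4_Un, simp add: deg4_def nfaces_def ncr_def)

lemma card_cl:
  assumes "matchings P V \<tau>"
  shows "int (card V) = (\<Sum>K\<in>cl P \<tau> ` V. int (card K))"
  by (rule additive_cl[OF assms]) (auto simp: card_Un_disjoint matchingsD(1))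

lemma deg4_cl_le:
  assumes "matchings P V \<tau>" "3 \<le> card P" "x \<in> V"
  shows "deg4 P (cl P \<tau> x) \<tau> \<le> deg4 P V \<tau>"
proof -
  have "0 \<le> deg4 P K \<tau>" if "K \<in> cl P \<tau> ` V" for K
    using that deg4_nonneg matchings_cl[OF assms(1) order_refl] assms(2) by auto
  then show ?thesis unfolding deg4_cl[OF assms(1)]
    using member_le_sum[of "cl P \<tau> x" "cl P \<tau> ` V" "\<lambda>K. deg4 P K \<tau>"] assms matchingsD(1)[OF assms(1)] by auto
qed

context flipping begin

text \<open>The part of \<open>w'\<close> is again connected and of degree at most 0, but smaller,
  so an induction on the number of vertices applies to it.\<close>

lemma separated_component:
  assumes C: "3 \<le> card C" and deg: "deg4 C V \<tau> \<le> 0" and H: "H \<subseteq> C - {i}" "\<forall>c\<in>H. \<tau> c w = b"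
    and sep: "w' \<notin> cl C \<tau>' w"
  shows "matchings C (cl C \<tau>' w') \<tau>'" "conn C (cl C \<tau>' w') \<tau>'" "deg4 C (cl C \<tau>' w') \<tau>' \<le> 0"
    "cl C \<tau>' w' \<subseteq> V" "card (cl C \<tau>' w') < card V" "w \<notin> cl C \<tau>' w'" "b \<notin> cl C \<tau>' w'" "b' \<in> cl C \<tau>' w'"
proof -
  note s' = matchings_symon[OF matchings_flip order_refl]
  show "matchings C (cl C \<tau>' w') \<tau>'" by (rule matchings_cl[OF matchings_flip order_refl ends(1)])
  show "conn C (cl C \<tau>' w') \<tau>'" by (rule conn_cl[OF matchings_flip ends(1)])
  have "deg4 C V \<tau>' \<le> 0" using deg4_flip(2)[OF H sep] deg by simp
  then show "deg4 C (cl C \<tau>' w') \<tau>' \<le> 0" using deg4_cl_le[OF matchings_flip C ends(1)] by simp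
  show sub: "cl C \<tau>' w' \<subseteq> V" by (rule cls_subset[OF s' ends(1)])
  show nw': "w \<notin> cl C \<tau>' w'" using sep cls_sym[OF s' ends(1)] by auto
  then show "card (cl C \<tau>' w') < card V" using sub w matchingsD(1)[OF m] by (intro psubset_card_mono) auto
  show "b \<notin> cl C \<tau>' w'"
  proof
    assume "b \<in> cl C \<tau>' w'"
    from cl_step[OF this i] show False using nw' by simp
  qed
  show "b' \<in> cl C \<tau>' w'" using cl_step[OF cls_refl[of w'] i, of \<tau>'] by simp
qed

text \<open>Carries a melon from the part \<open>K\<close> of the flipped graph back to the old
  graph. Of two disjoint melons in \<open>K\<close> at least one is not the pair of ends of the new
  edge, so it does not use that edge; this is why the induction provides two. If \<open>K\<close>
  has just two vertices, they are joined by all colors but \<open>i\<close>.\<close>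

lemma pull_melon:
  assumes K: "matchings C K \<tau>'" "w \<notin> K" "b \<notin> K" "w' \<in> K" "b' \<in> K"
    and M: "card K > 2 \<Longrightarrow> \<exists>x y u v. x \<in> K \<and> y \<in> K \<and> u \<in> K \<and> v \<in> K \<and> {x, y} \<inter> {u, v} = {} \<and>
      card C - 1 \<le> card (par C \<tau>' x y) \<and> card C - 1 \<le> card (par C \<tau>' u v)"
  shows "\<exists>x y. x \<in> K \<and> y \<in> K \<and> card C - 1 \<le> card (par C \<tau> x y)"
proof (cases "card K > 2")
  case True
  then obtain x y where xy: "x \<in> K" "y \<in> K" "{x, y} \<noteq> {w', b'}" "card C - 1 \<le> card (par C \<tau>' x y)"
    using M by (metis Int_absorb insert_not_empty)
  have "par C \<tau>' x y \<subseteq> par C \<tau> x y"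
  proof
    fix c assume c: "c \<in> par C \<tau>' x y"
    show "c \<in> par C \<tau> x y"
    proof (cases "c = i")
      case True
      then have y: "\<tau>' i x = y" using c by (simp add: par_def)
      then have "x \<noteq> w'" "x \<noteq> b'" using xy(3) by auto
      moreover have "x \<noteq> w" "x \<noteq> b" using xy(1) K by auto
      ultimately have "\<tau> i x = y" using y by simp
      then show ?thesis using c True by (simp add: par_def)
    qed (use c in \<open>auto simp: par_def\<close>)
  qed
  then have "card (par C \<tau>' x y) \<le> card (par C \<tau> x y)"
    using matchingsD(2)[OF m] by (intro card_mono) (auto simp: par_def)
  then show ?thesis using xy by (meson le_trans)
next
  case False
  have "card {w', b'} \<le> card K" by (rule card_mono) (use K matchingsD(1)[OF K(1)] in auto)
  then have "card {w', b'} = card K" using False ends(7) by simp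
  then have Keq: "K = {w', b'}" using card_subset_eq[OF matchingsD(1)[OF K(1)], of "{w', b'}"] K by auto
  have "C - {i} \<subseteq> par C \<tau> w' b'"
  proof
    fix c assume c: "c \<in> C - {i}"
    then have "\<tau>' c w' \<in> K" "\<tau>' c w' \<noteq> w'" using matchingsD(3,4)[OF K(1) _ K(4)] by blast+
    moreover have "\<tau>' c = \<tau> c" using c flip_simps(5)[of c] by blast
    ultimately show "c \<in> par C \<tau> w' b'" using c Keq by (auto simp: par_def)
  qed
  then have "card (C - {i}) \<le> card (par C \<tau> w' b')"
    using matchingsD(2)[OF m] by (intro card_mono) (auto simp: par_def)
  then show ?thesis using K i by auto
qed

end

text \<open>With four colors, degree at most 0 means that four times the number of faces is at least
  \<open>6 * card V + 12\<close>. If no face had length 2, every face would have at least four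
  vertices, and each of the six color pairs at most \<open>card V / 4\<close> faces.\<close>

lemma digon_exists:
  assumes m: "matchings C V \<tau>" "card C = 4" "conn C V \<tau>" "V \<noteq> {}" "deg4 C V \<tau> \<le> 0"
  shows "\<exists>w\<in>V. \<exists>b\<in>V. w \<noteq> b \<and> 2 \<le> card (par C \<tau> w b)"
proof (rule ccontr)
  assume no: "\<not> ?thesis"
  have fC: "finite C" using matchingsD(2)[OF m(1)] .
  have big: "4 \<le> card K" if P: "P \<in> pairs C" and K: "K \<in> cl P \<tau> ` V" for P K
  proof -
    obtain c d where cd: "P = {c, d}" "c \<noteq> d" "c \<in> C" "d \<in> C"
      using P by (auto simp: pairs_def card_2_iff)
    obtain x where x: "x \<in> V" "K = cl P \<tau> x" using K by auto
    have mK: "matchings P K \<tau>" using matchings_cl[OF m(1) _ x(1)] P x by (auto simp: pairs_def)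
    have "\<tau> c x \<noteq> \<tau> d x"
    proof
      assume e: "\<tau> c x = \<tau> d x"
      have "{c, d} \<subseteq> par C \<tau> x (\<tau> c x)" using cd e by (auto simp: par_def)
      then have "card {c, d} \<le> card (par C \<tau> x (\<tau> c x))" using fC by (intro card_mono) (auto simp: par_def)
      then show False using no x(1) cd matchingsD(3,4)[OF m(1) cd(3) x(1)] by fastforce
    qed
    then have "card {x, \<tau> c x, \<tau> d x} = 3" using matchingsD(4)[OF m(1) _ x(1)] cd by (simp add: card_insert_if) metis
    moreover have "{x, \<tau> c x, \<tau> d x} \<subseteq> K"
      using cl_step[OF cls_refl[of x], of _ P \<tau>] cd x by auto
    ultimately have "3 \<le> card K" using card_mono[OF matchingsD(1)[OF mK]] by metis
    moreover have "even (card K)" using even_card_matchings[OF mK] cd by auto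
    ultimately show ?thesis by (cases "card K = 3") auto
  qed
  have "4 * int (ncl P V \<tau>) \<le> int (card V)" if P: "P \<in> pairs C" for P
  proof -
    have mP: "matchings P V \<tau>" using matchings_mono[OF m(1)] P by (auto simp: pairs_def)
    have "(\<Sum>K\<in>cl P \<tau> ` V. 4) \<le> (\<Sum>K\<in>cl P \<tau> ` V. int (card K))"
      by (rule sum_mono) (use big[OF P] in force)
    then show ?thesis using card_cl[OF mP] by (simp add: ncr_def)
  qed
  then have "4 * nfaces C V \<tau> \<le> (\<Sum>P\<in>pairs C. int (card V))"
    unfolding nfaces_def sum_distrib_left by (intro sum_mono)
  moreover have "card (pairs C) = 6" using card_pairs[OF fC] m(2) by simp
  ultimately have "4 * nfaces C V \<tau> \<le> 6 * int (card V)" by simp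
  then show False using m(5) ncl_conn[OF m(3,4)] m(2) by (simp add: deg4_def)
qed

section \<open>Two disjoint melons in degree 0\<close>

definition two_melons :: "nat set \<Rightarrow> 'v set \<Rightarrow> (nat \<Rightarrow> 'v \<Rightarrow> 'v) \<Rightarrow> bool" where
  "two_melons C V \<tau> \<longleftrightarrow> (\<exists>x y u v. x \<in> V \<and> y \<in> V \<and> u \<in> V \<and> v \<in> V \<and> {x, y} \<inter> {u, v} = {} \<and>
      card C - 1 \<le> card (par C \<tau> x y) \<and> card C - 1 \<le> card (par C \<tau> u v))"

text \<open>A flip at a pair joined by \<open>card C - 2\<close> colors lowers the degree unless it
  separates. As the degree cannot become negative, it separates, and the part cut off yields a
  melon. Flipping the one missing color at a melon cuts this melon off, and the other part yields a
  second melon disjoint from it.\<close>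

lemma two_melons_step:
  fixes V :: "'v set"
  assumes a: "matchings C V \<tau>" "4 \<le> card C" "conn C V \<tau>" "2 < card V" "deg4 C V \<tau> \<le> 0"
    and IH: "\<And>(V' :: 'v set) \<tau>'. matchings C V' \<tau>' \<Longrightarrow> card V' < card V \<Longrightarrow> conn C V' \<tau>' \<Longrightarrow> 2 < card V' \<Longrightarrow>
       deg4 C V' \<tau>' \<le> 0 \<Longrightarrow> two_melons C V' \<tau>'"
    and ex: "w0 \<in> V" "b0 \<in> V" "w0 \<noteq> b0" "card C - 2 \<le> card (par C \<tau> w0 b0)"
  shows "two_melons C V \<tau>"
proof -
  have fC: "finite C" using matchingsD(2)[OF a(1)] .
  have flipK: "\<exists>x y. x \<in> K \<and> y \<in> K \<and> card C - 1 \<le> card (par C \<tau> x y)"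
    if "flipping C V \<tau> i w b" "\<tau> i w \<notin> cl C (flip i w b \<tau>) w" "K = cl C (flip i w b \<tau>) (\<tau> i w)" for i w b K
  proof -
    interpret flipping C V \<tau> i w b by fact
    note k = separated_component[OF _ a(5), of "{}", OF _ _ _ that(2)]
    show ?thesis unfolding that(3)
      by (rule pull_melon) (use k a(2) IH[of "cl C \<tau>' w'" \<tau>'] in \<open>auto simp: two_melons_def\<close>)
  qed
  have "\<exists>w\<in>V. \<exists>b\<in>V. card C - 1 \<le> card (par C \<tau> w b)"
  proof (cases "card C - 1 \<le> card (par C \<tau> w0 b0)")
    case False
    then have "par C \<tau> w0 b0 \<noteq> C" by auto
    then obtain i where ii: "i \<in> C" "\<tau> i w0 \<noteq> b0" by (auto simp: par_def)
    have fl: "flipping C V \<tau> i w0 b0" by unfold_locales (use a(1) ex ii in auto)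
    interpret flipping C V \<tau> i w0 b0 by fact
    let ?H = "par C \<tau> w0 b0"
    have H: "?H \<subseteq> C - {i}" "\<forall>c\<in>?H. \<tau> c w0 = b0" using ii by (auto simp: par_def)
    have sep: "w' \<notin> cl C \<tau>' w0"
    proof
      assume "w' \<in> cl C \<tau>' w0"
      then have "deg4 C V \<tau>' + 8 * int (card ?H) + 4 \<le> 4 * int (card C)"
        using deg4_flip(1)[OF H] a(5) by simp
      moreover have "0 \<le> deg4 C V \<tau>'" using deg4_nonneg[OF matchings_flip] a(2) by simp
      moreover have "int (card C) \<le> int (card ?H) + 2" using ex(4) by linarith
      ultimately show False using a(2) by linarith
    qed
    show ?thesis using flipK[OF fl sep refl] cls_subset[OF matchings_symon[OF matchings_flip order_refl] ends(1)] by blast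
  qed (use ex in blast)
  then obtain w b where ab: "w \<in> V" "b \<in> V" "card C - 1 \<le> card (par C \<tau> w b)" by blast
  then have "par C \<tau> w b \<noteq> {}" using a(2) by auto
  then obtain c where c: "c \<in> C" "\<tau> c w = b" by (auto simp: par_def)
  then have ne: "w \<noteq> b" using matchingsD(4)[OF a(1)] ab by blast
  have "par C \<tau> w b \<noteq> C"
  proof
    assume "par C \<tau> w b = C"
    then have all: "\<forall>c\<in>C. \<tau> c w = b" by (auto simp: par_def)
    have mp: "matchings C {w, b} \<tau>" by (rule matchings_pair[OF a(1) ab(1,2) ne all])
    have "cl C \<tau> w \<subseteq> {w, b}" by (rule cls_subset[OF matchings_symon[OF mp order_refl]]) simp
    then have "card V \<le> 2" using a(3) ab(1) card_mono[of "{w, b}" V] ne by (simp add: conn_def)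
    then show False using a(4) by simp
  qed
  then obtain i where ii: "i \<in> C" "\<tau> i w \<noteq> b" by (auto simp: par_def)
  have fl: "flipping C V \<tau> i w b" by unfold_locales (use a(1) ab ne ii in auto)
  interpret flipping C V \<tau> i w b by fact
  have H: "par C \<tau> w b \<subseteq> C - {i}" using ii by (auto simp: par_def)
  have "par C \<tau> w b = C - {i}" by (rule card_subset_eq) (use H fC ii ab(3) card_mono[OF _ H] in auto)
  then have all: "\<tau>' c w = b" if "c \<in> C" for c using that by (cases "c = i") (auto simp: par_def)
  have mp: "matchings C {w, b} \<tau>'" by (rule matchings_pair[OF matchings_flip ab(1,2) ne]) (use all in auto)
  have "cl C \<tau>' w \<subseteq> {w, b}" by (rule cls_subset[OF matchings_symon[OF mp order_refl]]) simp
  then have sep: "w' \<notin> cl C \<tau>' w" using ends nw by auto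
  obtain x y where xy: "x \<in> cl C \<tau>' w'" "y \<in> cl C \<tau>' w'" "card C - 1 \<le> card (par C \<tau> x y)"
    using flipK[OF fl sep refl] by blast
  have k: "cl C \<tau>' w' \<subseteq> V" "w \<notin> cl C \<tau>' w'" "b \<notin> cl C \<tau>' w'"
    using separated_component(4,6,7)[OF _ a(5), of "{}", OF _ _ _ sep] a(2) by auto
  have "{w, b} \<inter> {x, y} = {}" using xy k by auto
  then show ?thesis unfolding two_melons_def using ab xy k(1)
    by (intro exI[of _ w] exI[of _ b] exI[of _ x] exI[of _ y] conjI) auto
qed

text \<open>Double induction, on the numbers of colors and of vertices.
  \<open>two_melons_step\<close> asks for a pair joined by all but two colors. For four colors
  \<open>digon_exists\<close> provides it. For more colors a bubble has degree at most 0 by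
  \<open>deg4_bubbles_le\<close>, and a melon in it has just the required number of edges.\<close>

theorem two_melons:
  assumes "4 \<le> card C" "matchings C V \<tau>" "conn C V \<tau>" "2 < card V" "deg4 C V \<tau> \<le> 0"
  shows "two_melons C V \<tau>"
  using assms
proof (induction "card C" arbitrary: C V \<tau> rule: nat_induct_at_least)
  case base
  show ?case using base(2-)
  proof (induction "card V" arbitrary: V \<tau> rule: less_induct)
    case less
    have "V \<noteq> {}" using less.prems(3) by auto
    then obtain w b where "w \<in> V" "b \<in> V" "w \<noteq> b" "2 \<le> card (par C \<tau> w b)"
      using digon_exists[OF less.prems(1) base(1)[symmetric] less.prems(2) _ less.prems(4)] by blast
    then show ?case using less base(1) by (intro two_melons_step[of C V \<tau> w b]) auto
  qed
next
  case (Suc n)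
  note IHC = Suc.hyps(2)
  show ?case using Suc.prems
  proof (induction "card V" arbitrary: V \<tau> rule: less_induct)
    case less
    have fC: "finite C" using matchingsD(2)[OF less.prems(1)] .
    have q: "5 \<le> card C" using Suc.hyps by simp
    obtain c where c: "c \<in> C" using q by (metis card.empty all_not_in_conv not_numeral_le_zero)
    obtain x where x: "x \<in> V" using less.prems(3) by (metis card.empty all_not_in_conv not_less_zero)
    let ?P = "C - {c}"
    let ?K = "cl ?P \<tau> x"
    have cP: "card ?P = card C - 1" using c fC by simp
    have mP: "matchings ?P V \<tau>" by (rule matchings_mono[OF less.prems(1)]) auto
    have "(int (card C) - 2) * deg4 C V \<tau> \<le> 0" using less.prems(4) q by (intro mult_nonneg_nonpos) auto
    then have "deg4 ?P V \<tau> \<le> 0" using deg4_bubbles_le(3)[OF less.prems(1) _ c] q by simp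
    moreover have "3 \<le> card ?P" using cP q by linarith
    ultimately have dK: "deg4 ?P ?K \<tau> \<le> 0" using deg4_cl_le[OF mP _ x] by fastforce
    have mK: "matchings ?P ?K \<tau>" by (rule matchings_cl[OF mP order_refl x])
    have KV: "?K \<subseteq> V" by (rule cls_subset[OF matchings_symon[OF mP order_refl] x])
    have "\<exists>w b. w \<in> ?K \<and> b \<in> ?K \<and> w \<noteq> b \<and> card C - 2 \<le> card (par ?P \<tau> w b)"
    proof (cases "2 < card ?K")
      case True
      then have "two_melons ?P ?K \<tau>" using IHC[of ?P ?K \<tau>] mK dK conn_cl[OF mP x] cP Suc.hyps by auto
      then obtain w b where wb: "w \<in> ?K" "b \<in> ?K" "card ?P - 1 \<le> card (par ?P \<tau> w b)"
        unfolding two_melons_def by blast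
      then have "par ?P \<tau> w b \<noteq> {}" using cP q by auto
      then obtain d where "d \<in> ?P" "\<tau> d w = b" by (auto simp: par_def)
      then have "w \<noteq> b" using matchingsD(4)[OF mK _ wb(1)] by metis
      then show ?thesis using wb cP by (metis diff_diff_left one_add_one)
    next
      case False
      have "card ?P \<noteq> 0" using cP q by linarith
      then obtain d where d: "d \<in> ?P" by (metis card.empty ex_in_conv)
      have td: "\<tau> d x \<in> ?K" "\<tau> d x \<noteq> x" using matchingsD(3,4)[OF mK d cls_refl] by auto
      have "{x, \<tau> d x} = ?K"
        by (rule card_seteq) (use td False matchingsD(1)[OF mK] in auto)
      then have "par ?P \<tau> x (\<tau> d x) = ?P"
        using matchingsD(3,4)[OF mK _ cls_refl] unfolding par_def by blast
      then show ?thesis using td cP by (metis cls_refl diff_le_mono2 one_le_numeral)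
    qed
    then obtain w b where wb: "w \<in> ?K" "b \<in> ?K" "w \<noteq> b" "card C - 2 \<le> card (par ?P \<tau> w b)" by blast
    have "card (par ?P \<tau> w b) \<le> card (par C \<tau> w b)" by (rule card_mono) (use fC in \<open>auto simp: par_def\<close>)
    then show ?case using less wb KV q by (intro two_melons_step[of C V \<tau> w b]) auto
  qed
qed

section \<open>Cutting links and dipoles\<close>

text \<open>
  The set \<open>R\<close> of marked half-edges records the root edge and the edges created by cutting; an edge
  contributes two elements. A link between two dipoles occurs four times in \<open>links\<close>, once for each of
  the two orders of the vertices of each dipole.
\<close>

definition unm :: "nat set \<Rightarrow> (nat \<Rightarrow> 'v \<Rightarrow> 'v) \<Rightarrow> ('v \<times> nat) set \<Rightarrow> 'v \<Rightarrow> 'v \<Rightarrow> nat set" where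
  "unm C \<tau> R w b = {c \<in> C. \<tau> c w = b \<and> (w, c) \<notin> R}"

text \<open>The last condition is melon-freeness up to marks: with \<open>card C = D + 1\<close> a
  melon would have \<open>D\<close> unmarked edges.\<close>

definition marked :: "nat set \<Rightarrow> 'v set \<Rightarrow> (nat \<Rightarrow> 'v \<Rightarrow> 'v) \<Rightarrow> ('v \<times> nat) set \<Rightarrow> bool" where
  "marked C V \<tau> R \<longleftrightarrow> matchings C V \<tau> \<and> 4 \<le> card C \<and> R \<subseteq> V \<times> C \<and> (\<forall>(x, c)\<in>R. (\<tau> c x, c) \<in> R) \<and>
     (\<forall>w\<in>V. \<forall>b\<in>V. card (unm C \<tau> R w b) \<le> card C - 2)"

definition udip :: "nat set \<Rightarrow> (nat \<Rightarrow> 'v \<Rightarrow> 'v) \<Rightarrow> ('v \<times> nat) set \<Rightarrow> 'v \<Rightarrow> 'v \<Rightarrow> bool" where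
  "udip C \<tau> R w b \<longleftrightarrow> card (unm C \<tau> R w b) = card C - 2"

text \<open>Both edges of a link have the same color, as in a chain and unlike in a general
  pre-chain. The condition \<open>\<tau> i w \<noteq> b\<close> keeps out the edges of the dipole
  itself.\<close>

definition links :: "nat set \<Rightarrow> 'v set \<Rightarrow> (nat \<Rightarrow> 'v \<Rightarrow> 'v) \<Rightarrow> ('v \<times> nat) set \<Rightarrow> ('v \<times> 'v \<times> nat) set" where
  "links C V \<tau> R = {(w, b, i). w \<in> V \<and> b \<in> V \<and> i \<in> C \<and> udip C \<tau> R w b \<and> \<tau> i w \<noteq> b \<and>
     udip C \<tau> R (\<tau> i w) (\<tau> i b) \<and> (w, i) \<notin> R \<and> (b, i) \<notin> R}"

lemma markedD:
  assumes "marked C V \<tau> R"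
  shows "matchings C V \<tau>" "4 \<le> card C" "R \<subseteq> V \<times> C" "(x, c) \<in> R \<Longrightarrow> (\<tau> c x, c) \<in> R"
    "w \<in> V \<Longrightarrow> b \<in> V \<Longrightarrow> card (unm C \<tau> R w b) \<le> card C - 2" "finite V" "finite C" "finite R"
    "finite (unm C \<tau> R w b)"
proof -
  show "matchings C V \<tau>" "4 \<le> card C" "R \<subseteq> V \<times> C" "(x, c) \<in> R \<Longrightarrow> (\<tau> c x, c) \<in> R"
    "w \<in> V \<Longrightarrow> b \<in> V \<Longrightarrow> card (unm C \<tau> R w b) \<le> card C - 2"
    using assms unfolding marked_def by blast+
  then show "finite V" "finite C" using matchingsD by blast+
  then show "finite R" "finite (unm C \<tau> R w b)"
    using \<open>R \<subseteq> V \<times> C\<close> by (auto simp: unm_def intro: finite_subset[of R "V \<times> C"])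
qed

lemma mark_iff:
  assumes "marked C V \<tau> R" "c \<in> C" "x \<in> V" shows "(\<tau> c x, c) \<in> R \<longleftrightarrow> (x, c) \<in> R"
  using markedD(4)[OF assms(1)] matchingsD(5)[OF markedD(1)[OF assms(1)] assms(2,3)] by metis

lemma unm_sym:
  assumes "marked C V \<tau> R" "w \<in> V" "b \<in> V" shows "unm C \<tau> R w b = unm C \<tau> R b w"
proof -
  have "unm C \<tau> R x y \<subseteq> unm C \<tau> R y x" if "x \<in> V" "y \<in> V" for x y
    using mark_iff[OF assms(1) _ that(1)] matchingsD(5)[OF markedD(1)[OF assms(1)] _ that(1)]
    by (auto simp: unm_def)
  then show ?thesis using assms by blast
qed

lemma udip_sym:
  assumes "marked C V \<tau> R" "w \<in> V" "b \<in> V" shows "udip C \<tau> R w b \<longleftrightarrow> udip C \<tau> R b w"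
  using unm_sym[OF assms] by (simp add: udip_def)

lemma udip_mem:
  assumes "marked C V \<tau> R" "w \<in> V" "udip C \<tau> R w b" shows "b \<in> V" "w \<noteq> b"
proof -
  have "unm C \<tau> R w b \<noteq> {}" using assms(3) markedD(2)[OF assms(1)] by (auto simp: udip_def)
  then obtain c where "c \<in> C" "\<tau> c w = b" by (auto simp: unm_def)
  then show "b \<in> V" "w \<noteq> b" using matchingsD(3,4)[OF markedD(1)[OF assms(1)] _ assms(2)] by blast+
qed

lemma finite_links: "marked C V \<tau> R \<Longrightarrow> finite (links C V \<tau> R)"
  by (rule finite_subset[of _ "V \<times> V \<times> C"]) (auto simp: links_def dest: markedD)

lemma links_sym:
  assumes a: "marked C V \<tau> R" and l: "(w, b, i) \<in> links C V \<tau> R"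
  shows "(b, w, i) \<in> links C V \<tau> R" "(\<tau> i w, \<tau> i b, i) \<in> links C V \<tau> R"
proof -
  note m = markedD(1)[OF a]
  have d: "w \<in> V" "b \<in> V" "i \<in> C" "udip C \<tau> R w b" "\<tau> i w \<noteq> b" "udip C \<tau> R (\<tau> i w) (\<tau> i b)"
    "(w, i) \<notin> R" "(b, i) \<notin> R" using l by (auto simp: links_def)
  have v: "\<tau> i w \<in> V" "\<tau> i b \<in> V" "\<tau> i b \<noteq> w" "\<tau> i (\<tau> i w) = w" "\<tau> i (\<tau> i b) = b"
    using matchingsD(3,5)[OF m d(3)] matchings_eqD(2)[OF m d(3)] d by blast+
  show "(b, w, i) \<in> links C V \<tau> R" using d v udip_sym[OF a] by (auto simp: links_def)
  have "\<tau> i (\<tau> i w) \<noteq> \<tau> i b" using v by auto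
  then show "(\<tau> i w, \<tau> i b, i) \<in> links C V \<tau> R"
    using d v mark_iff[OF a d(3)] by (auto simp: links_def)
qed

lemma unm_restrict: "w \<in> K \<Longrightarrow> unm C \<tau> (R \<inter> K \<times> UNIV) w b = unm C \<tau> R w b"
  by (auto simp: unm_def)

lemma udip_restrict: "w \<in> K \<Longrightarrow> udip C \<tau> (R \<inter> K \<times> UNIV) w b = udip C \<tau> R w b"
  by (simp add: udip_def unm_restrict)

lemma marked_restrict:
  assumes "marked C V \<tau> R" "matchings C K \<tau>" "K \<subseteq> V"
  shows "marked C K \<tau> (R \<inter> K \<times> UNIV)"
  unfolding marked_def
proof (intro conjI ballI)
  show "R \<inter> K \<times> UNIV \<subseteq> K \<times> C" using markedD(3)[OF assms(1)] by auto
  fix e assume e: "e \<in> R \<inter> K \<times> UNIV"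
  then obtain x c where "e = (x, c)" "(x, c) \<in> R" "x \<in> K" by auto
  moreover then have "\<tau> c x \<in> K" using matchingsD(3)[OF assms(2)] markedD(3)[OF assms(1)] by auto
  ultimately show "case e of (x, c) \<Rightarrow> (\<tau> c x, c) \<in> R \<inter> K \<times> UNIV" using markedD(4)[OF assms(1)] by auto
next
  fix w b assume "w \<in> K" "b \<in> K"
  then show "card (unm C \<tau> (R \<inter> K \<times> UNIV) w b) \<le> card C - 2"
    using unm_restrict[of w K C \<tau> R b] markedD(5)[OF assms(1), of w b] assms(3) by auto
qed (use assms markedD(2) in auto)

lemma links_restrict:
  assumes "marked C V \<tau> R" "matchings C K \<tau>" "K \<subseteq> V"
  shows "links C K \<tau> (R \<inter> K \<times> UNIV) = links C V \<tau> R \<inter> K \<times> UNIV"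
proof -
  have "(w, b, i) \<in> links C K \<tau> (R \<inter> K \<times> UNIV) \<longleftrightarrow> (w, b, i) \<in> links C V \<tau> R \<inter> K \<times> UNIV" for w b i
  proof (cases "w \<in> K \<and> i \<in> C")
    case True
    then have "\<tau> i w \<in> K" using matchingsD(3)[OF assms(2)] by blast
    moreover have "b \<in> K" if "udip C \<tau> R w b"
      using udip_mem(1)[OF marked_restrict[OF assms]] True that udip_restrict[of w K C \<tau> R b] by blast
    ultimately show ?thesis using True assms(3) udip_restrict[of _ K C \<tau> R] by (auto simp: links_def)
  qed (auto simp: links_def)
  then show ?thesis by (intro set_eqI) (metis prod_cases3)
qed

lemma card_split:
  assumes "finite A" "V = K1 \<union> K2" "K1 \<inter> K2 = {}" "A \<subseteq> V \<times> UNIV"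
  shows "card A = card (A \<inter> K1 \<times> UNIV) + card (A \<inter> K2 \<times> UNIV)"
proof -
  have "A = (A \<inter> K1 \<times> UNIV) \<union> (A \<inter> K2 \<times> UNIV)" using assms by auto
  moreover have "(A \<inter> K1 \<times> UNIV) \<inter> (A \<inter> K2 \<times> UNIV) = {}" using assms by auto
  ultimately show ?thesis using assms(1) by (metis card_Un_disjoint finite_Int)
qed

section \<open>Cuts: flips that mark the new edges\<close>

locale mflip = flipping C V \<tau> i w b
  for C :: "nat set" and V :: "'v set" and \<tau> i w b +
  fixes R :: "('v \<times> nat) set"
  assumes a: "marked C V \<tau> R"
begin

definition "R' = R \<union> {w, b, w', b'} \<times> {i}"

text \<open>Both new edges are marked, so a cut creates no unmarked parallel edges. Hence it
  preserves \<open>marked\<close>, and it creates neither dipoles nor links.\<close>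

lemma unm_flip: "unm C \<tau>' R' x y \<subseteq> unm C \<tau> R x y"
proof
  fix c assume c: "c \<in> unm C \<tau>' R' x y"
  then have "c \<noteq> i \<or> x \<notin> {w, b, w', b'}" by (auto simp: unm_def R'_def)
  then have "\<tau>' c x = \<tau> c x" by (cases "c = i") auto
  then show "c \<in> unm C \<tau> R x y" using c by (auto simp: unm_def R'_def)
qed

lemma marked_flip: "marked C V \<tau>' R'"
  unfolding marked_def
proof (intro conjI ballI)
  show "R' \<subseteq> V \<times> C" using markedD(3)[OF a] ends w b i by (auto simp: R'_def)
  fix e assume e: "e \<in> R'"
  obtain x c where xc: "e = (x, c)" by fastforce
  show "case e of (x, c) \<Rightarrow> (\<tau>' c x, c) \<in> R'"
  proof (cases "c = i \<and> x \<in> {w, b, w', b'}")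
    case True then show ?thesis using xc by (auto simp: R'_def)
  next
    case False
    then have "(x, c) \<in> R" "\<tau>' c x = \<tau> c x" using e xc by (auto simp: R'_def) (cases "c = i"; auto)+
    then show ?thesis using xc markedD(4)[OF a] by (auto simp: R'_def)
  qed
next
  fix x y assume "x \<in> V" "y \<in> V"
  then show "card (unm C \<tau>' R' x y) \<le> card C - 2"
    using card_mono[OF markedD(9)[OF a] unm_flip[of x y]] markedD(5)[OF a, of x y] by linarith
qed (use matchings_flip markedD(2)[OF a] in auto)

lemma udip_flip: assumes "x \<in> V" "y \<in> V" "udip C \<tau>' R' x y" shows "udip C \<tau> R x y"
  using card_mono[OF markedD(9)[OF a] unm_flip[of x y]] markedD(5)[OF a assms(1,2)] assms(3)
  by (simp add: udip_def)

lemma links_flip: "links C V \<tau>' R' \<subseteq> links C V \<tau> R"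
  "(x, y, i) \<in> links C V \<tau>' R' \<Longrightarrow> x \<notin> {w, b, w', b'}"
proof
  fix e assume e: "e \<in> links C V \<tau>' R'"
  obtain x y c where xyc: "e = (x, y, c)" by (cases e)
  have d: "x \<in> V" "y \<in> V" "c \<in> C" "udip C \<tau>' R' x y" "\<tau>' c x \<noteq> y" "udip C \<tau>' R' (\<tau>' c x) (\<tau>' c y)"
    "(x, c) \<notin> R'" "(y, c) \<notin> R'" using e xyc by (auto simp: links_def)
  have "\<tau>' c x = \<tau> c x" "\<tau>' c y = \<tau> c y" using d(7,8) by (cases "c = i"; auto simp: R'_def)+
  then show "e \<in> links C V \<tau> R"
    using d xyc udip_flip matchingsD(3)[OF m d(3)] by (auto simp: links_def R'_def)
next
  show "(x, y, i) \<in> links C V \<tau>' R' \<Longrightarrow> x \<notin> {w, b, w', b'}" by (auto simp: links_def R'_def)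
qed

lemma card_links_flip: "(w, b, i) \<in> links C V \<tau> R \<Longrightarrow> card (links C V \<tau>' R') + 4 \<le> card (links C V \<tau> R)"
proof -
  assume l: "(w, b, i) \<in> links C V \<tau> R"
  let ?X = "{(w, b, i), (b, w, i), (w', b', i), (b', w', i)}"
  have "(w', b', i) \<in> links C V \<tau> R" "(b, w, i) \<in> links C V \<tau> R" using links_sym[OF a l] by auto
  then have X: "?X \<subseteq> links C V \<tau> R" using l links_sym(1)[OF a] by auto
  moreover have "?X \<inter> links C V \<tau>' R' = {}" using links_flip(2) by blast
  moreover have "card ?X = 4" using wb nw ends by auto
  moreover have "card (?X \<union> links C V \<tau>' R') = card ?X + card (links C V \<tau>' R')"
    using calculation finite_links[OF marked_flip] by (intro card_Un_disjoint) auto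
  moreover have "card (?X \<union> links C V \<tau>' R') \<le> card (links C V \<tau> R)"
    using X links_flip(1) finite_links[OF a] by (intro card_mono) auto
  ultimately show ?thesis by linarith
qed

lemma card_marks_flip: "(w, i) \<notin> R \<Longrightarrow> (b, i) \<notin> R \<Longrightarrow> card R' = card R + 4"
proof -
  assume "(w, i) \<notin> R" "(b, i) \<notin> R"
  then have "R \<inter> {w, b, w', b'} \<times> {i} = {}" using mark_iff[OF a i] w b by auto
  moreover have "card ({w, b, w', b'} \<times> {i}) = 4" using wb nw ends by (simp add: card_cartesian_product)
  ultimately show ?thesis unfolding R'_def using markedD(8)[OF a] by (subst card_Un_disjoint) auto
qed

lemma flip_cover: assumes "conn C V \<tau>" shows "V = cl C \<tau>' w \<union> cl C \<tau>' w'"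
proof
  let ?S = "cl C \<tau>' w \<union> cl C \<tau>' w'"
  note s' = matchings_symon[OF matchings_flip order_refl]
  have e: "b \<in> ?S" "b' \<in> ?S" "w \<in> ?S" "w' \<in> ?S"
    using cl_step[OF cls_refl[of w] i, of \<tau>'] cl_step[OF cls_refl[of w'] i, of \<tau>'] by auto
  show "?S \<subseteq> V" using cls_subset[OF s'] w ends by blast
  have "cl C \<tau> w \<subseteq> ?S"
  proof (rule cl_least)
    fix y c assume y: "y \<in> ?S" and c: "c \<in> C"
    show "\<tau> c y \<in> ?S"
    proof (cases "c = i \<and> y \<in> {w, b, w', b'}")
      case True then show ?thesis using e ends by auto
    next
      case False
      then have "\<tau> c y = \<tau>' c y" by (cases "c = i") auto
      then show ?thesis using y cl_step[OF _ c, of y \<tau>'] by auto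
    qed
  qed (use e in auto)
  then show "V \<subseteq> ?S" using assms w by (auto simp: conn_def)
qed

abbreviation "K1 \<equiv> cl C \<tau>' w"
abbreviation "K2 \<equiv> cl C \<tau>' w'"
abbreviation "R1 \<equiv> R' \<inter> K1 \<times> UNIV"
abbreviation "R2 \<equiv> R' \<inter> K2 \<times> UNIV"

lemma flip_parts:
  "matchings C K1 \<tau>'" "matchings C K2 \<tau>'" "K1 \<subseteq> V" "K2 \<subseteq> V" "marked C K1 \<tau>' R1" "marked C K2 \<tau>' R2"
  "conn C K1 \<tau>'" "conn C K2 \<tau>'"
  "links C K1 \<tau>' R1 = links C V \<tau>' R' \<inter> K1 \<times> UNIV" "links C K2 \<tau>' R2 = links C V \<tau>' R' \<inter> K2 \<times> UNIV"
  "b \<in> K1" "b' \<in> K2"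
proof -
  show K: "matchings C K1 \<tau>'" "matchings C K2 \<tau>'"
    using matchings_cl[OF matchings_flip order_refl] w ends by blast+
  show KV: "K1 \<subseteq> V" "K2 \<subseteq> V"
    using cls_subset[OF matchings_symon[OF matchings_flip order_refl]] w ends by blast+
  show "marked C K1 \<tau>' R1" "marked C K2 \<tau>' R2" using marked_restrict[OF marked_flip] K KV by blast+
  show "conn C K1 \<tau>'" "conn C K2 \<tau>'" using conn_cl[OF matchings_flip] w ends by blast+
  show "links C K1 \<tau>' R1 = links C V \<tau>' R' \<inter> K1 \<times> UNIV" "links C K2 \<tau>' R2 = links C V \<tau>' R' \<inter> K2 \<times> UNIV"
    using links_restrict[OF marked_flip] K KV by blast+
  show "b \<in> K1" "b' \<in> K2"
    using cl_step[OF cls_refl[of w] i, of \<tau>'] cl_step[OF cls_refl[of w'] i, of \<tau>'] by auto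
qed

lemma separated_parts:
  assumes con: "conn C V \<tau>" and sep: "w' \<notin> K1"
  shows "V = K1 \<union> K2" "K1 \<inter> K2 = {}" "card V = card K1 + card K2"
    "card R' = card R1 + card R2"
    "card (links C V \<tau>' R') = card (links C K1 \<tau>' R1) + card (links C K2 \<tau>' R2)"
    "deg4 C V \<tau>' = deg4 C K1 \<tau>' + deg4 C K2 \<tau>'"
proof -
  show V: "V = K1 \<union> K2" by (rule flip_cover[OF con])
  show d: "K1 \<inter> K2 = {}"
    by (rule cls_disjoint[OF matchings_symon[OF matchings_flip order_refl] w ends(1) sep])
  have "card (K1 \<union> K2) = card K1 + card K2"
    using d flip_parts(3,4) markedD(6)[OF a] finite_subset by (metis card_Un_disjoint)
  then show "card V = card K1 + card K2" using V by simp
  show "card R' = card R1 + card R2"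
    by (rule card_split[OF markedD(8)[OF marked_flip] V d]) (use markedD(3)[OF marked_flip] in auto)
  show "card (links C V \<tau>' R') = card (links C K1 \<tau>' R1) + card (links C K2 \<tau>' R2)"
    unfolding flip_parts(9,10) by (rule card_split[OF finite_links[OF marked_flip] V d]) (auto simp: links_def)
  have "deg4 C (K1 \<union> K2) \<tau>' = deg4 C K1 \<tau>' + deg4 C K2 \<tau>'" by (rule deg4_Un[OF flip_parts(1,2) d])
  then show "deg4 C V \<tau>' = deg4 C K1 \<tau>' + deg4 C K2 \<tau>'" using V by simp
qed

end

text \<open>If there are more than two vertices, each of two disjoint melons must contain a marked
  edge, so each contains exactly one and there are no others. Cutting off one melon leaves a graph
  of the same kind, with the new edge in place of the lost mark. So the graph is a chain of dipoles
  closed at both ends: \<open>m\<close> dipoles have \<open>2 * m\<close> vertices and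
  \<open>4 * (m - 1)\<close> links in the fourfold count. The last conclusion, that a marked edge is
  parallel to a dipole, is what shows that the melon cut off was linked to the rest.\<close>

lemma linear_melonic:
  assumes "marked C V \<tau> R" "conn C V \<tau>" "V \<noteq> {}" "deg4 C V \<tau> \<le> 0" "card R \<le> 4"
  shows "2 * card V \<le> card (links C V \<tau> R) + 4 \<and> card R = 4 \<and> (\<forall>(x, c)\<in>R. udip C \<tau> R x (\<tau> c x))"
  using assms
proof (induction "card V" arbitrary: V \<tau> R rule: less_induct)
  case less
  note a = less.prems(1) and con = less.prems(2)
  note m = markedD(1)[OF a] and q = markedD(2)[OF a] and fC = markedD(7)[OF a] and fV = markedD(6)[OF a]
  obtain x0 where x0: "x0 \<in> V" using less.prems(3) by auto
  have "C \<noteq> {}" using q by auto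
  then obtain c0 where c0: "c0 \<in> C" by auto
  show ?case
  proof (cases "2 < card V")
    case False
    let ?y = "\<tau> c0 x0"
    have y: "?y \<in> V" "?y \<noteq> x0" using matchingsD(3,4)[OF m c0 x0] by auto
    have V: "V = {x0, ?y}" by (rule card_seteq[symmetric]) (use y x0 fV False in auto)
    have t: "\<tau> c x0 = ?y" "\<tau> c ?y = x0" if "c \<in> C" for c
      using matchingsD(3,4)[OF m that] x0 y V by blast+
    let ?M = "{c \<in> C. (x0, c) \<in> R}"
    have R: "R = {x0, ?y} \<times> ?M"
    proof
      show "R \<subseteq> {x0, ?y} \<times> ?M" using markedD(3)[OF a] V mark_iff[OF a _ x0] t by auto
      show "{x0, ?y} \<times> ?M \<subseteq> R" using mark_iff[OF a _ x0] t by auto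
    qed
    have cR: "card R = 2 * card ?M" by (subst R) (use y in \<open>simp add: card_cartesian_product\<close>)
    have u: "unm C \<tau> R x0 ?y = C - ?M" using t by (auto simp: unm_def)
    have "card (C - ?M) = card C - card ?M" "card ?M \<le> card C" using fC by (auto simp: card_Diff_subset intro: card_mono)
    moreover have "card (C - ?M) \<le> card C - 2" using markedD(5)[OF a x0 y(1)] u by simp
    ultimately have "2 \<le> card ?M" using q by linarith
    then have 2: "card ?M = 2" using cR less.prems(5) by simp
    then have ud: "udip C \<tau> R x0 ?y" using \<open>card (C - ?M) = card C - card ?M\<close> u by (simp add: udip_def)
    have "udip C \<tau> R x (\<tau> c x)" if "(x, c) \<in> R" for x c
      using that markedD(3)[OF a] V t ud udip_sym[OF a x0 y(1)] by fastforce
    then show ?thesis using 2 cR False by auto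
  next
    case True
    obtain x y u v where xy: "x \<in> V" "y \<in> V" "card C - 1 \<le> card (par C \<tau> x y)"
      and uv: "u \<in> V" "v \<in> V" "card C - 1 \<le> card (par C \<tau> u v)" and dj: "{x, y} \<inter> {u, v} = {}"
      using two_melons[OF q m con True less.prems(4)] unfolding two_melons_def by metis
    have key: "\<exists>c\<in>par C \<tau> p s. (p, c) \<in> R \<and> (s, c) \<in> R \<and> p \<noteq> s"
      if ps: "p \<in> V" "s \<in> V" "card C - 1 \<le> card (par C \<tau> p s)" for p s
    proof -
      have "par C \<tau> p s \<noteq> unm C \<tau> R p s" using markedD(5)[OF a ps(1,2)] ps(3) q by auto
      then obtain c where c: "c \<in> C" "\<tau> c p = s" "(p, c) \<in> R" by (auto simp: par_def unm_def)
      then show ?thesis using markedD(4)[OF a] matchingsD(4)[OF m c(1) ps(1)] by (auto simp: par_def)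
    qed
    obtain m1 where m1: "m1 \<in> par C \<tau> x y" "(x, m1) \<in> R" "(y, m1) \<in> R" "x \<noteq> y" using key[OF xy] by blast
    obtain m2 where m2: "m2 \<in> par C \<tau> u v" "(u, m2) \<in> R" "(v, m2) \<in> R" "u \<noteq> v" using key[OF uv] by blast
    let ?R = "{(x, m1), (y, m1), (u, m2), (v, m2)}"
    have cR: "card ?R = 4" using m1(4) m2(4) dj by auto
    have R: "?R = R" by (rule card_seteq) (use m1 m2 cR less.prems(5) markedD(8)[OF a] in auto)
    have up: "udip C \<tau> R p s" if ps: "p \<in> V" "s \<in> V" "card C - 1 \<le> card (par C \<tau> p s)"
        and one: "\<And>c. (p, c) \<in> R \<Longrightarrow> c = c1" for p s c1
    proof -
      have "par C \<tau> p s - {c1} \<subseteq> unm C \<tau> R p s" using one by (auto simp: par_def unm_def)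
      then have "card (par C \<tau> p s - {c1}) \<le> card (unm C \<tau> R p s)" using markedD(9)[OF a] by (intro card_mono) auto
      moreover have "card (par C \<tau> p s) - 1 \<le> card (par C \<tau> p s - {c1})" by (metis One_nat_def card_Diff1_le card_Diff_singleton_if diff_le_self le_refl)
      ultimately show ?thesis using markedD(5)[OF a ps(1,2)] ps(3) by (simp add: udip_def)
    qed
    have uxy: "udip C \<tau> R x y" by (rule up[OF xy, of m1]) (use R dj m1(4) in auto)
    have uuv: "udip C \<tau> R u v" by (rule up[OF uv, of m2]) (use R dj m2(4) in auto)
    have uR: "udip C \<tau> R z (\<tau> c z)" if "(z, c) \<in> R" for z c
    proof -
      have "\<tau> m1 x = y" "\<tau> m1 y = x" "\<tau> m2 u = v" "\<tau> m2 v = u"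
        using m1(1) m2(1) matchings_eqD(2)[OF m] xy uv by (auto simp: par_def)
      moreover have "udip C \<tau> R y x" "udip C \<tau> R v u" using uxy uuv udip_sym[OF a] xy uv by blast+
      ultimately show ?thesis using that uxy uuv unfolding R[symmetric] by auto
    qed
    have "par C \<tau> x y \<noteq> C"
    proof
      assume p: "par C \<tau> x y = C"
      have "C - {m1} \<subseteq> unm C \<tau> R x y" using p R dj m1(4) by (auto simp: par_def unm_def)
      then have "card (C - {m1}) \<le> card (unm C \<tau> R x y)" using markedD(9)[OF a] by (intro card_mono) auto
      then show False using uxy q m1(1) by (auto simp: udip_def par_def)
    qed
    \<comment> \<open>The only color that leads out of the first melon; cutting there splits it
      off.\<close>
    then obtain j where j: "j \<in> C" "\<tau> j x \<noteq> y" by (auto simp: par_def)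
    interpret mflip C V \<tau> j x y R by unfold_locales (use m a j xy m1(4) in auto)
    have H: "par C \<tau> x y \<subseteq> C - {j}" using j by (auto simp: par_def)
    have "par C \<tau> x y = C - {j}" by (rule card_subset_eq) (use H fC j xy(3) card_mono[OF _ H] in auto)
    then have all: "\<tau>' c x = y" if "c \<in> C" for c using that by (cases "c = j") (auto simp: par_def)
    have mp: "matchings C {x, y} \<tau>'" by (rule matchings_pair[OF matchings_flip xy(1,2) m1(4)]) (use all in auto)
    have sub: "K1 \<subseteq> {x, y}" using cls_subset[OF matchings_symon[OF mp order_refl]] by blast
    then have sep: "w' \<notin> K1" using ends nw by auto
    note sp = separated_parts[OF con sep]
    note k = separated_component[OF _ less.prems(4), of "{}", OF _ _ _ sep]
    have K1: "K1 = {x, y}" using sub flip_parts(11) by auto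
    have "R2 \<subseteq> {(u, m2), (v, m2), (w', j), (b', j)}"
      unfolding R'_def by (subst R[symmetric]) (use k(6,7) q in auto)
    then have cR2: "card R2 \<le> 4" using card_mono[of "{(u, m2), (v, m2), (w', j), (b', j)}" R2]
      by (simp add: card_insert_if split: if_splits)
    have ne: "K2 \<noteq> {}" using cls_refl[of w'] by blast
    have IH: "2 * card K2 \<le> card (links C K2 \<tau>' R2) + 4 \<and> (\<forall>(x, c)\<in>R2. udip C \<tau>' R2 x (\<tau>' c x))"
      using less.hyps[OF k(5) flip_parts(6,8) ne k(3) cR2] q by auto
    have "(w', j) \<in> R2" by (auto simp: R'_def)
    then have "udip C \<tau>' R2 w' b'" using IH by force
    then have "udip C \<tau>' R' w' b'" using udip_restrict[of w' K2 C \<tau>' R' b'] by simp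
    then have ud: "udip C \<tau> R w' b'" using udip_flip ends by blast
    have "(x, j) \<notin> R" "(y, j) \<notin> R" using R dj m1 j(2) matchings_eqD(2)[OF m j(1) xy(1,2)] by (auto simp: par_def)
    then have "(x, y, j) \<in> links C V \<tau> R" using xy j uxy ud by (auto simp: links_def)
    then have "card (links C V \<tau>' R') + 4 \<le> card (links C V \<tau> R)" by (rule card_links_flip)
    then have "2 * card V \<le> card (links C V \<tau> R) + 4" using IH sp(3,5) K1 m1(4) by simp
    then show ?thesis using uR cR R by auto
  qed
qed

section \<open>The bound on the defect\<close>

definition free_dipole :: "nat set \<Rightarrow> (nat \<Rightarrow> 'v \<Rightarrow> 'v) \<Rightarrow> ('v \<times> nat) set \<Rightarrow> 'v \<Rightarrow> 'v \<Rightarrow> bool" where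
  "free_dipole C \<tau> R w b \<longleftrightarrow> udip C \<tau> R w b \<and> (\<forall>c. (w, c) \<notin> R \<and> (b, c) \<notin> R)"

text \<open>
  A separated part for which the induction hypothesis fails has degree \<open>0\<close> and at most two marked
  edges, so it is a chain by \<open>linear_melonic\<close>; removing it changes neither side of the bound.
\<close>

theorem defect_bound:
  fixes \<alpha> \<beta> \<gamma> :: int
  assumes pos: "0 \<le> \<alpha>" "0 \<le> \<beta>" "0 \<le> \<gamma>"
    and base: "\<And>(V :: 'v set) \<tau> R. marked C V \<tau> R \<Longrightarrow> conn C V \<tau> \<Longrightarrow> V \<noteq> {} \<Longrightarrow> R \<noteq> {} \<Longrightarrow>
      (\<And>w b. w \<in> V \<Longrightarrow> b \<in> V \<Longrightarrow> \<not> free_dipole C \<tau> R w b) \<Longrightarrow>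
      2 * int (card V) \<le> \<alpha> * deg4 C V \<tau> + \<beta> * int (card R) + \<gamma>"
    and B: "B = 5 * \<beta> + \<gamma> + 1" and A: "A = \<alpha> + \<gamma> + 4 * B"
  assumes "marked C (V :: 'v set) \<tau> R" "conn C V \<tau>" "V \<noteq> {}" "R \<noteq> {}" "1 \<le> deg4 C V \<tau> \<or> 5 \<le> card R"
  shows "2 * int (card V) - int (card (links C V \<tau> R)) \<le> A * deg4 C V \<tau> + B * (int (card R) - 4)"
  using assms(7-)
\<comment> \<open>The measure is the number of unmarked half-edges. Every cut marks some of them,
  whether or not it separates.\<close>
proof (induction "card (V \<times> C - R)" arbitrary: V \<tau> R rule: less_induct)
  case less
  note a = less.prems(1) and con = less.prems(2)
  note m = markedD(1)[OF a] and q = markedD(2)[OF a] and fC = markedD(7)[OF a] and fV = markedD(6)[OF a]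
  \<comment> \<open>\<open>A\<close> and \<open>B\<close> are made for the case without cuts. At
    positive degree the summand \<open>\<gamma> + 4 * B\<close> of \<open>A\<close> pays for
    \<open>\<gamma>\<close> and for a negative \<open>B * (card R - 4)\<close>. At degree 0 there
    are at least five marks, so \<open>card R \<le> 5 * (card R - 4)\<close>, and
    \<open>B = 5 * \<beta> + \<gamma> + 1\<close> suffices.\<close>
  have AB: "0 \<le> B" "B \<le> A" "4 \<le> A" "0 \<le> A" using A B pos by auto
  have nonneg: "0 \<le> deg4 C V \<tau>" using deg4_nonneg[OF m] q by simp
  show ?case
  proof (cases "\<exists>w b. w \<in> V \<and> b \<in> V \<and> free_dipole C \<tau> R w b \<or> (\<exists>i. (w, b, i) \<in> links C V \<tau> R)")
    case False
    then have "2 * int (card V) \<le> \<alpha> * deg4 C V \<tau> + \<beta> * int (card R) + \<gamma>" using base[OF less.prems(1-4)] by blast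
    also have "\<dots> \<le> A * deg4 C V \<tau> + B * (int (card R) - 4)"
    proof (cases "1 \<le> deg4 C V \<tau>")
      case True
      have "(\<gamma> + 4 * B) * 1 \<le> (\<gamma> + 4 * B) * deg4 C V \<tau>" using True pos AB by (intro mult_left_mono) auto
      moreover have "\<beta> * int (card R) \<le> B * int (card R)" using B pos by (intro mult_right_mono) auto
      ultimately show ?thesis unfolding A by (simp add: algebra_simps)
    next
      case False
      then have r: "5 \<le> int (card R)" "deg4 C V \<tau> = 0" using less.prems(5) nonneg by auto
      have "\<beta> * int (card R) \<le> \<beta> * (5 * (int (card R) - 4))" using r pos by (intro mult_left_mono) auto
      moreover have "(\<gamma> + 1) * 1 \<le> (\<gamma> + 1) * (int (card R) - 4)" using r pos by (intro mult_left_mono) auto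
      ultimately show ?thesis unfolding B using r by (simp add: algebra_simps)
    qed
    finally show ?thesis by linarith
  next
    case True
    \<comment> \<open>A free dipole is cut only when no link is left; then the induction hypothesis
      applies to both parts. If it failed for the first part, this part would be the dipole alone,
      which would have had \<open>D = card C - 1\<close> unmarked edges; if it failed for the
      second, the cut would have been at a link.\<close>
    have "\<exists>w b i. w \<in> V \<and> b \<in> V \<and> i \<in> C \<and> udip C \<tau> R w b \<and> \<tau> i w \<noteq> b \<and> (w, i) \<notin> R \<and> (b, i) \<notin> R \<and>
      ((w, b, i) \<in> links C V \<tau> R \<or> links C V \<tau> R = {} \<and> free_dipole C \<tau> R w b)"
    proof (cases "links C V \<tau> R = {}")
      case False
      then obtain w b i where "(w, b, i) \<in> links C V \<tau> R" by (metis ex_in_conv prod_cases3)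
      then show ?thesis by (intro exI[of _ w] exI[of _ b] exI[of _ i]) (auto simp: links_def)
    next
      case L: True
      then obtain w b where wb: "w \<in> V" "b \<in> V" "free_dipole C \<tau> R w b" using True by auto
      then have "card (unm C \<tau> R w b) = card C - 2" by (simp add: free_dipole_def udip_def)
      then have "unm C \<tau> R w b \<noteq> C" using q by auto
      then obtain i where "i \<in> C" "\<tau> i w \<noteq> b" using wb(3) by (auto simp: unm_def free_dipole_def)
      then show ?thesis using wb L by (intro exI[of _ w] exI[of _ b] exI[of _ i]) (auto simp: free_dipole_def)
    qed
    then obtain w b j where d: "w \<in> V" "b \<in> V" "j \<in> C" "udip C \<tau> R w b" "\<tau> j w \<noteq> b" "(w, j) \<notin> R" "(b, j) \<notin> R"
      and alt: "(w, b, j) \<in> links C V \<tau> R \<or> links C V \<tau> R = {} \<and> free_dipole C \<tau> R w b" by blast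
    have wb': "w \<noteq> b" using udip_mem[OF a d(1,4)] by simp
    interpret mflip C V \<tau> j w b R by unfold_locales (use m a d wb' in auto)
    let ?H = "par C \<tau> w b" and ?L = "links C V \<tau> R" and ?L' = "links C V \<tau>' R'"
    let ?r = "int (card R)" and ?\<delta> = "deg4 C V \<tau>"
    have H: "?H \<subseteq> C - {j}" "\<forall>c\<in>?H. \<tau> c w = b" using d by (auto simp: par_def)
    have "unm C \<tau> R w b \<subseteq> ?H" by (auto simp: par_def unm_def)
    then have h: "int (card C) - 2 \<le> int (card ?H)"
      using d(4) card_mono[of ?H "unm C \<tau> R w b"] fC finite_subset[OF H(1)] by (auto simp: udip_def)
    have rR: "int (card R') = ?r + 4" using card_marks_flip[OF d(6,7)] by simp
    have L'L: "card ?L' \<le> card ?L" using links_flip(1) finite_links[OF a] by (rule card_mono[rotated])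
    show ?thesis
    proof (cases "w' \<in> K1")
      case True
      have "deg4 C V \<tau>' + 8 * int (card ?H) + 4 \<le> ?\<delta> + 4 * int (card C)" by (rule deg4_flip(1)[OF H True])
      \<comment> \<open>As \<open>card ?H\<close> is at least \<open>card C - 2\<close>, the fall is
        at least \<open>4 * (card C - 3)\<close>, hence at least 4. This pays for the four new marks
        because \<open>B \<le> A\<close>.\<close>
      then have d': "deg4 C V \<tau>' \<le> ?\<delta> - 4" using h q by linarith
      have "V = K1" using flip_cover[OF con] cls_eq[OF matchings_symon[OF matchings_flip order_refl] w True] by simp
      then have con': "conn C V \<tau>'" using flip_parts(7) by simp
      have "V \<times> C - R' \<subset> V \<times> C - R" using d by (auto simp: R'_def)
      then have "card (V \<times> C - R') < card (V \<times> C - R)" using fV fC by (intro psubset_card_mono) auto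
      then have "2 * int (card V) - int (card ?L') \<le> A * deg4 C V \<tau>' + B * (int (card R') - 4)"
      proof (rule less.hyps[OF _ marked_flip con' less.prems(3)])
        show "R' \<noteq> {}" using less.prems(4) by (auto simp: R'_def)
        have "1 \<le> card R" using less.prems(4) markedD(8)[OF a] by (simp add: Suc_le_eq card_gt_0_iff)
        then show "1 \<le> deg4 C V \<tau>' \<or> 5 \<le> card R'" using rR by linarith
      qed
      moreover have "A * deg4 C V \<tau>' \<le> A * (?\<delta> - 4)" using d' AB by (intro mult_left_mono) auto
      ultimately show ?thesis using L'L rR AB by (simp add: algebra_simps)
    next
      case sep: False
      note sp = separated_parts[OF con sep]
      have d': "deg4 C K1 \<tau>' + deg4 C K2 \<tau>' \<le> ?\<delta>" using deg4_flip(2)[OF H sep] sp(6) by simp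
      have nn: "0 \<le> deg4 C K1 \<tau>'" "0 \<le> deg4 C K2 \<tau>'" using deg4_nonneg[OF flip_parts(1)] deg4_nonneg[OF flip_parts(2)] q by auto
      have rs: "int (card R1) + int (card R2) = ?r + 4" using sp(4) rR by simp
      have R1: "(w, j) \<in> R1" "(w', j) \<in> R2" by (auto simp: R'_def)
      have less1: "card (K \<times> C - R' \<inter> K \<times> UNIV) < card (V \<times> C - R)" if "K \<subseteq> V" for K
      proof (rule psubset_card_mono)
        have "K \<times> C - R' \<inter> K \<times> UNIV \<subseteq> V \<times> C - R" using that by (auto simp: R'_def)
        moreover have "(w, j) \<notin> K \<times> C - R' \<inter> K \<times> UNIV" "(w, j) \<in> V \<times> C - R" using d by (auto simp: R'_def)
        ultimately show "K \<times> C - R' \<inter> K \<times> UNIV \<subset> V \<times> C - R" by blast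
      qed (use fV fC in auto)
      let ?D1 = "2 * int (card K1) - int (card (links C K1 \<tau>' R1))"
      let ?D2 = "2 * int (card K2) - int (card (links C K2 \<tau>' R2))"
      have D: "2 * int (card V) - int (card ?L') = ?D1 + ?D2" using sp(3,5) by simp
      have IH1: "?D1 \<le> A * deg4 C K1 \<tau>' + B * (int (card R1) - 4)" if "1 \<le> deg4 C K1 \<tau>' \<or> 5 \<le> card R1"
        using less.hyps[OF less1[OF flip_parts(3)] flip_parts(5,7) _ _ that] R1(1) cls_refl by blast
      have IH2: "?D2 \<le> A * deg4 C K2 \<tau>' + B * (int (card R2) - 4)" if "1 \<le> deg4 C K2 \<tau>' \<or> 5 \<le> card R2"
        using less.hyps[OF less1[OF flip_parts(4)] flip_parts(6,8) _ _ that] R1(2) cls_refl by blast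
      have lin1: "?D1 \<le> 4" "card R1 = 4" if "\<not> (1 \<le> deg4 C K1 \<tau>' \<or> 5 \<le> card R1)"
      proof -
        have "K1 \<noteq> {}" by (metis cls_refl empty_iff)
        from linear_melonic[OF flip_parts(5,7) this] that show "?D1 \<le> 4" "card R1 = 4" by linarith+
      qed
      have lin2: "?D2 \<le> 4" "card R2 = 4" "udip C \<tau>' R2 w' b'" if "\<not> (1 \<le> deg4 C K2 \<tau>' \<or> 5 \<le> card R2)"
      proof -
        have l: "2 * card K2 \<le> card (links C K2 \<tau>' R2) + 4 \<and> card R2 = 4 \<and> (\<forall>(x, c)\<in>R2. udip C \<tau>' R2 x (\<tau>' c x))"
        proof (rule linear_melonic[OF flip_parts(6,8)])
          show "K2 \<noteq> {}" by (metis cls_refl empty_iff)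
        qed (use that in auto)
        then show "?D2 \<le> 4" "card R2 = 4" by auto
        show "udip C \<tau>' R2 w' b'" using l R1(2) by force
      qed
      have mono: "A * deg4 C K1 \<tau>' + A * deg4 C K2 \<tau>' \<le> A * ?\<delta>"
        using mult_left_mono[OF d' AB(4)] by (simp add: algebra_simps)
      have A1: "0 \<le> A * deg4 C K1 \<tau>'" "0 \<le> A * deg4 C K2 \<tau>'" using AB nn by auto
      have brs: "B * int (card R1) + B * int (card R2) = B * ?r + B * 4"
        using rs by (simp flip: distrib_left)
      show ?thesis
      proof (cases "(w, b, j) \<in> ?L")
        case True
        \<comment> \<open>A part to which the induction hypothesis does not apply has defect at most
          4 and exactly four marks. So the other part has \<open>card R\<close> marks, and the four
          occurrences of the link that are lost make up for the defect. If it applies to neither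
          part, the total defect is at most 4, and \<open>A\<close> covers this since the degree is
          then positive.\<close>
        have L4: "int (card ?L') + 4 \<le> int (card ?L)" using card_links_flip[OF True] by simp
        consider "1 \<le> deg4 C K1 \<tau>' \<or> 5 \<le> card R1" "1 \<le> deg4 C K2 \<tau>' \<or> 5 \<le> card R2"
          | "1 \<le> deg4 C K1 \<tau>' \<or> 5 \<le> card R1" "\<not> (1 \<le> deg4 C K2 \<tau>' \<or> 5 \<le> card R2)"
          | "\<not> (1 \<le> deg4 C K1 \<tau>' \<or> 5 \<le> card R1)" "1 \<le> deg4 C K2 \<tau>' \<or> 5 \<le> card R2"
          | "\<not> (1 \<le> deg4 C K1 \<tau>' \<or> 5 \<le> card R1)" "\<not> (1 \<le> deg4 C K2 \<tau>' \<or> 5 \<le> card R2)" by blast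
        then show ?thesis
        proof cases
          case 1 then show ?thesis using IH1 IH2 D L4 mono brs AB by (simp add: algebra_simps)
        next
          case 2
          then have "int (card R1) = ?r" using lin2(2) rs by simp
          then show ?thesis using 2 IH1 lin2(1) D L4 mono A1 by (simp add: algebra_simps)
        next
          case 3
          then have "int (card R2) = ?r" using lin1(2) rs by simp
          then show ?thesis using 3 IH2 lin1(1) D L4 mono A1 by (simp add: algebra_simps)
        next
          case 4
          then have r4: "card R = 4" using lin1(2) lin2(2) rs by simp
          then have "1 \<le> ?\<delta>" using less.prems(5) by simp
          then have "A * 1 \<le> A * ?\<delta>" using AB by (intro mult_left_mono) auto
          moreover have "B * (?r - 4) = 0" using r4 by simp
          ultimately show ?thesis using lin1(1)[OF 4(1)] lin2(1)[OF 4(2)] D L4 AB by linarith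
        qed
      next
        case False
        then have L0: "?L = {}" and fr: "free_dipole C \<tau> R w b" using alt by auto
        have "1 \<le> deg4 C K1 \<tau>' \<or> 5 \<le> card R1"
        proof (rule ccontr)
          assume n: "\<not> ?thesis"
          have "links C K1 \<tau>' R1 = {}" using L0 links_flip(1) flip_parts(9) by auto
          then have "card K1 \<le> 2" using lin1(1)[OF n] by simp
          then have "K1 = {w, b}" using card_seteq[of K1 "{w, b}"] flip_parts(11) wb markedD(6)[OF flip_parts(5)] by auto
          then have all: "\<tau>' c w = b" if "c \<in> C" for c using matchingsD(3,4)[OF flip_parts(1) that cls_refl] by auto
          have "C - {j} \<subseteq> unm C \<tau> R w b"
          proof
            fix c assume c: "c \<in> C - {j}"
            then have "\<tau> c w = b" using all[of c] by auto
            then show "c \<in> unm C \<tau> R w b" using c fr by (auto simp: unm_def free_dipole_def)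
          qed
          then have "card (C - {j}) \<le> card C - 2"
            using card_mono[OF markedD(9)[OF a]] markedD(5)[OF a d(1,2)] by (meson le_trans)
          then show False using q d(3) by simp
        qed
        moreover have "1 \<le> deg4 C K2 \<tau>' \<or> 5 \<le> card R2"
        proof (rule ccontr)
          assume n: "\<not> ?thesis"
          have "udip C \<tau>' R' w' b'" using lin2(3)[OF n] udip_restrict[of w' K2 C \<tau>' R' b'] by simp
          then have "udip C \<tau> R w' b'" using udip_flip ends by blast
          then have "(w, b, j) \<in> ?L" using d by (auto simp: links_def)
          then show False using False by simp
        qed
        ultimately show ?thesis using IH1 IH2 D L'L mono brs AB by (simp add: algebra_simps)
      qed
    qed
  qed
qed

section \<open>Graphs without free dipoles\<close>

lemma near_melon:
  assumes m: "matchings P K \<tau>" and con: "conn P K \<tau>" and K: "K \<noteq> {}" and P: "4 \<le> card P"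
    and deg: "deg4 P K \<tau> \<le> 0"
  shows "\<exists>w\<in>K. \<exists>b\<in>K. card P - 1 \<le> card (par P \<tau> w b)"
proof (cases "2 < card K")
  case True
  then show ?thesis using two_melons[OF P m con True deg] unfolding two_melons_def by metis
next
  case False
  obtain x where x: "x \<in> K" using K by auto
  have "P \<noteq> {}" using P by auto
  then obtain d where d: "d \<in> P" by auto
  have td: "\<tau> d x \<in> K" "\<tau> d x \<noteq> x" using matchingsD(3,4)[OF m d x] by auto
  have "{x, \<tau> d x} = K" by (rule card_seteq) (use x td False matchingsD(1)[OF m] in auto)
  then have "par P \<tau> x (\<tau> d x) = P" using matchingsD(3,4)[OF m _ x] unfolding par_def by blast
  then show ?thesis using x td by (metis diff_le_self)
qed

text \<open>A bubble of degree 0 contains a pair joined by \<open>card C - 2\<close> colors, which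
  is a free dipole unless there is a mark at it; so such a bubble contains a marked vertex. Any
  other bubble contributes at least 1 to the degree of the bubbles. This bounds the number of
  bubbles from above, and \<open>deg4_bubbles_le\<close> bounds it from below by the number of
  vertices. The bubbles must have four colors for \<open>near_melon\<close>, hence
  \<open>5 \<le> card C\<close>.\<close>

lemma no_free_dipoles_high:
  assumes a: "marked C V \<tau> R" and con: "conn C V \<tau>" and V: "V \<noteq> {}" and q: "5 \<le> card C"
    and nf: "\<And>w b. w \<in> V \<Longrightarrow> b \<in> V \<Longrightarrow> \<not> free_dipole C \<tau> R w b"
  shows "2 * int (card V) \<le> 4 * int (card C) * deg4 C V \<tau> + 4 * int (card C) * int (card R)"
proof -
  note m = markedD(1)[OF a]
  have fC: "finite C" and fV: "finite V" using markedD[OF a] by auto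
  let ?T = "fst ` R"
  have T: "card ?T \<le> card R" using card_image_le[OF markedD(8)[OF a]] .
  have touched: "K \<inter> ?T \<noteq> {}"
    if c: "c \<in> C" and K: "K \<in> cl (C - {c}) \<tau> ` V" and d: "deg4 (C - {c}) K \<tau> \<le> 0" for c K
  proof
    assume no: "K \<inter> ?T = {}"
    let ?P = "C - {c}"
    have mP: "matchings ?P V \<tau>" by (rule matchings_mono[OF m]) auto
    have cP: "card ?P = card C - 1" using c fC by simp
    obtain x where x: "x \<in> V" "K = cl ?P \<tau> x" using K by auto
    have mK: "matchings ?P K \<tau>" and cK: "conn ?P K \<tau>" and KV: "K \<subseteq> V"
      using matchings_cl[OF mP order_refl x(1)] conn_cl[OF mP x(1)]
        cls_subset[OF matchings_symon[OF mP order_refl] x(1)] x(2) by auto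
    have "K \<noteq> {}" using x(2) cls_refl[of x] by blast
    moreover have "4 \<le> card ?P" using cP q by simp
    ultimately obtain w b where wb: "w \<in> K" "b \<in> K" "card ?P - 1 \<le> card (par ?P \<tau> w b)"
      using near_melon[OF mK cK _ _ d] by blast
    have nt: "(w, e) \<notin> R" "(b, e) \<notin> R" for e using no wb by force+
    have "par ?P \<tau> w b \<subseteq> unm C \<tau> R w b" using nt by (auto simp: par_def unm_def)
    then have "card (par ?P \<tau> w b) \<le> card (unm C \<tau> R w b)" using markedD(9)[OF a] by (rule card_mono[rotated])
    moreover have "card (unm C \<tau> R w b) \<le> card C - 2" using markedD(5)[OF a] wb KV by blast
    ultimately have "udip C \<tau> R w b" using wb(3) cP by (simp add: udip_def)
    then show False using nf[of w b] nt wb KV by (auto simp: free_dipole_def)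
  qed
  have bub: "int (ncl (C - {c}) V \<tau>) \<le> int (card R) + deg4 (C - {c}) V \<tau>" if c: "c \<in> C" for c
  proof -
    let ?P = "C - {c}" and ?S = "cl (C - {c}) \<tau> ` V"
    have mP: "matchings ?P V \<tau>" by (rule matchings_mono[OF m]) auto
    have cP: "3 \<le> card ?P" using c fC q by simp
    have sm: "symon V (step ?P \<tau>)" by (rule matchings_symon[OF mP order_refl])
    have nn: "0 \<le> deg4 ?P K \<tau>" if "K \<in> ?S" for K
      using that deg4_nonneg[OF matchings_cl[OF mP order_refl] cP] by auto
    have "(if K \<in> cl ?P \<tau> ` (?T \<inter> V) then 0 else 1) \<le> deg4 ?P K \<tau>" if K: "K \<in> ?S" for K
    proof (cases "deg4 ?P K \<tau> \<le> 0")
      case True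
      obtain x where x: "x \<in> V" "K = cl ?P \<tau> x" using K by auto
      obtain y where y: "y \<in> K" "y \<in> ?T" using touched[OF c K True] by auto
      have "cl ?P \<tau> y = K" "y \<in> V" using cls_eq[OF sm x(1), of y] cls_subset[OF sm x(1)] y x(2) by blast+
      then have "K \<in> cl ?P \<tau> ` (?T \<inter> V)" using y(2) by blast
      then show ?thesis using nn[OF K] by simp
    qed auto
    then have "(\<Sum>K\<in>?S. if K \<in> cl ?P \<tau> ` (?T \<inter> V) then 0 else 1) \<le> deg4 ?P V \<tau>"
      unfolding deg4_cl[OF mP] by (rule sum_mono)
    moreover have "(\<Sum>K\<in>?S. if K \<in> cl ?P \<tau> ` (?T \<inter> V) then 0 else 1 :: int)
        = int (card (?S - cl ?P \<tau> ` (?T \<inter> V)))"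
      using fV by (simp add: sum.If_cases Diff_eq)
    moreover have "card ?S \<le> card (?S - cl ?P \<tau> ` (?T \<inter> V)) + card (cl ?P \<tau> ` (?T \<inter> V))"
    proof -
      have "card ?S \<le> card ((?S - cl ?P \<tau> ` (?T \<inter> V)) \<union> cl ?P \<tau> ` (?T \<inter> V))"
        by (rule card_mono) (use fV in auto)
      then show ?thesis using card_Un_le le_trans by blast
    qed
    moreover have "card (cl ?P \<tau> ` (?T \<inter> V)) \<le> card R"
    proof -
      have "card (cl ?P \<tau> ` (?T \<inter> V)) \<le> card (?T \<inter> V)" using fV by (intro card_image_le) auto
      also have "\<dots> \<le> card ?T" using markedD(8)[OF a] by (intro card_mono) auto
      finally show ?thesis using T by simp
    qed
    ultimately show ?thesis unfolding ncr_def by linarith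
  qed
  have "(\<Sum>c\<in>C. int (ncl (C - {c}) V \<tau>)) \<le> (\<Sum>c\<in>C. int (card R) + deg4 (C - {c}) V \<tau>)"
    by (rule sum_mono) (rule bub)
  also have "\<dots> \<le> int (card C) * int (card R) + (int (card C) - 2) * deg4 C V \<tau>"
    using deg4_bubbles_le(1)[OF m] q by (simp add: sum.distrib)
  finally have "4 * (\<Sum>c\<in>C. int (ncl (C - {c}) V \<tau>)) \<le> 4 * int (card C) * int (card R) + 4 * int (card C) * deg4 C V \<tau> - 8 * deg4 C V \<tau>"
    by (simp add: algebra_simps)
  moreover have "2 * int (card V) + 4 * (int (card C) - 1) - deg4 C V \<tau> \<le> 4 * (\<Sum>c\<in>C. int (ncl (C - {c}) V \<tau>))"
    using deg4_bubbles_le(2)[OF m] q ncl_conn[OF con V] by simp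
  moreover have "0 \<le> deg4 C V \<tau>" using deg4_nonneg[OF m] q by simp
  moreover have "0 \<le> 4 * (int (card C) - 1)" using q by simp
  ultimately show ?thesis by linarith
qed

section \<open>The case D = 3: commuting colors away from long faces\<close>

definition nbh :: "nat set \<Rightarrow> (nat \<Rightarrow> 'v \<Rightarrow> 'v) \<Rightarrow> 'v set \<Rightarrow> 'v set" where
  "nbh C \<tau> S = S \<union> (\<Union>c\<in>C. \<tau> c ` S)"

lemma card_nbh:
  assumes "finite S" "finite C" shows "card (nbh C \<tau> S) \<le> (1 + card C) * card S" "finite (nbh C \<tau> S)"
proof -
  have "card (\<Union>c\<in>C. \<tau> c ` S) \<le> (\<Sum>c\<in>C. card (\<tau> c ` S))" by (rule card_UN_le[OF assms(2)])
  also have "\<dots> \<le> (\<Sum>c\<in>C. card S)" by (rule sum_mono) (rule card_image_le[OF assms(1)])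
  finally have "card (\<Union>c\<in>C. \<tau> c ` S) \<le> card C * card S" by simp
  then show "card (nbh C \<tau> S) \<le> (1 + card C) * card S"
    unfolding nbh_def using card_Un_le[of S "\<Union>c\<in>C. \<tau> c ` S"] by simp
  show "finite (nbh C \<tau> S)" using assms by (simp add: nbh_def)
qed

lemma nbh_step: "matchings C V \<tau> \<Longrightarrow> c \<in> C \<Longrightarrow> y \<in> V \<Longrightarrow> y \<notin> nbh C \<tau> S \<Longrightarrow> \<tau> c y \<notin> S"
proof
  assume a: "matchings C V \<tau>" "c \<in> C" "y \<in> V" "y \<notin> nbh C \<tau> S" and "\<tau> c y \<in> S"
  then have "\<tau> c (\<tau> c y) \<in> nbh C \<tau> S" unfolding nbh_def by blast
  then show False using matchingsD(5)[OF a(1-3)] a(4) by simp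
qed

text \<open>
  The set \<open>X\<close> is the orbit of \<open>v\<close> under the involutions in \<open>P\<close>, built up one color at a time; commutation
  is only needed at vertices at distance less than \<open>card P\<close> from \<open>v\<close>.
\<close>

lemma commuting_cube:
  assumes m: "matchings C V \<tau>" and v: "v \<in> V" "v \<notin> (nbh C \<tau> ^^ k) S"
    and com: "\<And>x c d. x \<in> V \<Longrightarrow> x \<notin> S \<Longrightarrow> c \<in> C \<Longrightarrow> d \<in> C \<Longrightarrow> \<tau> c (\<tau> d x) = \<tau> d (\<tau> c x)"
    and P: "P \<subseteq> C" "card P \<le> k + 1"
  shows "\<exists>X\<subseteq>V. v \<in> X \<and> card X \<le> 2 ^ card P \<and> (\<forall>x\<in>X. \<forall>c\<in>P. \<tau> c x \<in> X) \<and>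
    (card P \<le> k \<longrightarrow> X \<inter> (nbh C \<tau> ^^ (k - card P)) S = {})"
proof -
  have "finite P" using P(1) matchingsD(2)[OF m] finite_subset by blast
  then show ?thesis using P
  proof (induction P)
    case empty
    show ?case by (intro exI[of _ "{v}"]) (use v in auto)
  next
    case (insert c P)
    then obtain X where X: "X \<subseteq> V" "v \<in> X" "card X \<le> 2 ^ card P" "\<And>x d. x \<in> X \<Longrightarrow> d \<in> P \<Longrightarrow> \<tau> d x \<in> X"
      "X \<inter> (nbh C \<tau> ^^ (k - card P)) S = {}" by auto
    have cP: "card (insert c P) = Suc (card P)" "card P \<le> k" using insert by auto
    have c: "c \<in> C" using insert by auto
    have "S \<subseteq> (nbh C \<tau> ^^ j) S" for j by (induction j) (auto simp: nbh_def)
    then have XS: "x \<notin> S" if "x \<in> X" for x using that X(5) by blast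
    let ?Y = "X \<union> \<tau> c ` X"
    have fX: "finite X" using X(1) matchingsD(1)[OF m] finite_subset by blast
    show ?case
    proof (intro exI[of _ ?Y] conjI ballI impI)
      show "?Y \<subseteq> V" using X(1) matchingsD(3)[OF m c] by auto
      show "card ?Y \<le> 2 ^ card (insert c P)"
        using card_Un_le[of X "\<tau> c ` X"] card_image_le[OF fX, of "\<tau> c"] X(3) cP by simp
      show "\<tau> d x \<in> ?Y" if x: "x \<in> ?Y" and d: "d \<in> insert c P" for x d
      proof (cases "x \<in> X")
        case True then show ?thesis using d X(4) by auto
      next
        case False
        then obtain y where y: "y \<in> X" "x = \<tau> c y" using x by auto
        have yV: "y \<in> V" using y X(1) by auto
        show ?thesis
        proof (cases "d = c")
          case True then show ?thesis using y matchingsD(5)[OF m c yV] by auto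
        next
          case False
          then have "d \<in> P" "d \<in> C" using d insert.prems by auto
          then show ?thesis using com[OF yV XS[OF y(1)], of d c] c X(4)[OF y(1)] y by auto
        qed
      qed
      assume "card (insert c P) \<le> k"
      then have e: "k - card P = Suc (k - card (insert c P))" using cP by simp
      let ?N = "(nbh C \<tau> ^^ (k - card (insert c P))) S"
      have "X \<inter> nbh C \<tau> ?N = {}" using X(5) unfolding e by simp
      moreover have "?N \<subseteq> nbh C \<tau> ?N" by (auto simp: nbh_def)
      ultimately show "?Y \<inter> ?N = {}" using nbh_step[OF m c, of _ ?N] X(1) by blast
    qed (use X in auto)
  qed
qed

text \<open>If the two colors did not commute at \<open>x\<close>, the face of \<open>x\<close>
  would have five different vertices.\<close>

lemma short_face_commute:
  assumes m: "matchings C V \<tau>" and c: "c \<in> C" "d \<in> C" "c \<noteq> d" and x: "x \<in> V" and s: "card (cl {c, d} \<tau> x) \<le> 4"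
  shows "\<tau> c (\<tau> d x) = \<tau> d (\<tau> c x)"
proof (rule ccontr)
  assume ne: "\<not> ?thesis"
  have v: "\<tau> c x \<in> V" "\<tau> d x \<in> V" using matchingsD(3)[OF m] c x by auto
  note i = matchingsD(5)[OF m c(1)] matchingsD(5)[OF m c(2)] and n = matchingsD(4)[OF m c(1)] matchingsD(4)[OF m c(2)]
  have cd: "\<tau> c x \<noteq> \<tau> d x" using ne i x by metis
  have "\<tau> c (\<tau> d x) \<noteq> x" "\<tau> d (\<tau> c x) \<noteq> x" using cd i x v by metis+
  moreover have "\<tau> c (\<tau> d x) \<noteq> \<tau> d x" "\<tau> d (\<tau> c x) \<noteq> \<tau> c x" "\<tau> c x \<noteq> x" "\<tau> d x \<noteq> x" using n v x by auto
  moreover have "\<tau> c (\<tau> d x) \<noteq> \<tau> c x" "\<tau> d (\<tau> c x) \<noteq> \<tau> d x" using i v x n by metis+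
  ultimately have "card {x, \<tau> c x, \<tau> d x, \<tau> c (\<tau> d x), \<tau> d (\<tau> c x)} = 5" using ne cd by auto
  moreover have "{x, \<tau> c x, \<tau> d x, \<tau> c (\<tau> d x), \<tau> d (\<tau> c x)} \<subseteq> cl {c, d} \<tau> x"
    using cl_step[OF cls_refl[of x], of c "{c, d}" \<tau>] cl_step[OF cls_refl[of x], of d "{c, d}" \<tau>]
      cl_step[of "\<tau> c x" "{c, d}" \<tau> x d] cl_step[of "\<tau> d x" "{c, d}" \<tau> x c] by auto
  moreover have "{c, d} \<subseteq> C" using c by auto
  from matchingsD(1)[OF matchings_cl[OF m this x]] have "finite (cl {c, d} \<tau> x)" .
  ultimately have "5 \<le> card (cl {c, d} \<tau> x)" by (metis card_mono)
  then show False using s by simp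
qed

text \<open>The sum of length minus 4 over all faces is \<open>deg4 C V \<tau> - 12\<close>. A face
  of length 2 without marks would be a free dipole, so marks bound the negative terms, and at most
  \<open>5 * deg4 C V \<tau> + 60 * card R\<close> vertices lie on faces of length 6 or more. Three
  neighbourhood steps multiply this by at most \<open>5 ^ 3 = 125\<close>. Either the result covers
  \<open>V\<close>, or some vertex has an orbit of at most \<open>2 ^ 4\<close> vertices, which is
  all of \<open>V\<close>. Doubling gives 1250, 15000 and 32.\<close>

lemma no_free_dipoles_3:
  assumes a: "marked C V \<tau> R" and con: "conn C V \<tau>" and V: "V \<noteq> {}" and q: "card C = 4"
    and nf: "\<And>w b. w \<in> V \<Longrightarrow> b \<in> V \<Longrightarrow> \<not> free_dipole C \<tau> R w b"
  shows "2 * int (card V) \<le> 1250 * deg4 C V \<tau> + 15000 * int (card R) + 32"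
proof -
  note m = markedD(1)[OF a]
  have fC: "finite C" and fV: "finite V" using markedD[OF a] by auto
  let ?T = "fst ` R"
  have T: "card ?T \<le> card R" using card_image_le[OF markedD(8)[OF a]] .
  have touched: "K \<inter> ?T \<noteq> {}" if P: "P \<in> pairs C" and K: "K \<in> cl P \<tau> ` V" and d: "card K \<le> 2" for P K
  proof
    assume no: "K \<inter> ?T = {}"
    have P2: "P \<subseteq> C" "card P = 2" using P by (auto simp: pairs_def)
    then have "P \<noteq> {}" by auto
    then obtain c where c: "c \<in> P" by auto
    obtain x where x: "x \<in> V" "K = cl P \<tau> x" using K by auto
    have mK: "matchings P K \<tau>" using matchings_cl[OF m P2(1) x(1)] x(2) by simp
    have KV: "K \<subseteq> V" using cls_subset[OF matchings_symon[OF m P2(1)] x(1)] x(2) by simp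
    have xK: "x \<in> K" using x(2) by simp
    have tc: "\<tau> c x \<in> K" "\<tau> c x \<noteq> x" using matchingsD(3,4)[OF mK c xK] by auto
    have "{x, \<tau> c x} = K" by (rule card_seteq) (use xK tc d matchingsD(1)[OF mK] in auto)
    then have all: "\<tau> e x = \<tau> c x" if "e \<in> P" for e using matchingsD(3,4)[OF mK that xK] by auto
    have nt: "(x, e) \<notin> R" "(\<tau> c x, e) \<notin> R" for e using no xK tc by force+
    have "P \<subseteq> unm C \<tau> R x (\<tau> c x)" using all nt P2 by (auto simp: unm_def)
    then have "2 \<le> card (unm C \<tau> R x (\<tau> c x))" using card_mono[OF markedD(9)[OF a]] P2 by metis
    moreover have "card (unm C \<tau> R x (\<tau> c x)) \<le> card C - 2" using markedD(5)[OF a] xK tc KV by blast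
    ultimately have "udip C \<tau> R x (\<tau> c x)" using q by (simp add: udip_def)
    then show False using nf[of x "\<tau> c x"] nt xK tc KV by (auto simp: free_dipole_def)
  qed
  define bad where "bad = (\<lambda>P. {x \<in> V. 5 \<le> card (cl P \<tau> x)})"
  have badP: "int (card (bad P)) \<le> 5 * (int (card V) - 4 * int (ncl P V \<tau>)) + 10 * int (card R)" if P: "P \<in> pairs C" for P
  proof -
    have P2: "P \<subseteq> C" "card P = 2" "P \<noteq> {}" using P by (auto simp: pairs_def)
    have mP: "matchings P V \<tau>" by (rule matchings_mono[OF m P2(1)])
    have sm: "symon V (step P \<tau>)" by (rule matchings_symon[OF mP order_refl])
    let ?S = "cl P \<tau> ` V" and ?D = "cl P \<tau> ` (?T \<inter> V)"
    have "bad P \<subseteq> (\<Union>K\<in>?S. if 5 \<le> card K then K else {})"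
    proof
      fix x assume "x \<in> bad P"
      then have "x \<in> V" "5 \<le> card (cl P \<tau> x)" by (auto simp: bad_def)
      then show "x \<in> (\<Union>K\<in>?S. if 5 \<le> card K then K else {})"
        by (intro UN_I[of "cl P \<tau> x"]) auto
    qed
    moreover have "finite (\<Union>K\<in>?S. if 5 \<le> card K then K else {})"
      using fV matchingsD(1)[OF matchings_cl[OF mP order_refl]] by auto
    ultimately have "card (bad P) \<le> (\<Sum>K\<in>?S. card (if 5 \<le> card K then K else {}))"
      using card_mono card_UN_le[of ?S "\<lambda>K. if 5 \<le> card K then K else {}"] fV by (meson finite_imageI le_trans)
    then have "int (card (bad P)) \<le> (\<Sum>K\<in>?S. int (card (if 5 \<le> card K then K else {})))"
      by (simp flip: of_nat_sum)
    \<comment> \<open>For a face with \<open>n\<close> vertices, \<open>n \<le> 5 * (n - 4)\<close>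
      as soon as \<open>n\<close> is at least 5. The 10 compensates for the value -10 at a face of
      length 2, which must meet a mark.\<close>
    also have "\<dots> \<le> (\<Sum>K\<in>?S. 5 * (int (card K) - 4) + (if K \<in> ?D then 10 else 0))"
    proof (rule sum_mono)
      fix K assume K: "K \<in> ?S"
      obtain x where x: "x \<in> V" "K = cl P \<tau> x" using K by auto
      have mK: "matchings P K \<tau>" using matchings_cl[OF mP order_refl x(1)] x(2) by simp
      have "even (card K)" by (rule even_card_matchings[OF mK P2(3)])
      moreover have "card K \<noteq> 0" using x(2) matchingsD(1)[OF mK] by (metis card_0_eq cls_refl empty_iff)
      ultimately have "card K = 2 \<or> 4 \<le> card K" by presburger
      then consider "card K = 2" | "4 \<le> card K" by blast
      then show "int (card (if 5 \<le> card K then K else {})) \<le> 5 * (int (card K) - 4) + (if K \<in> ?D then 10 else 0)"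
      proof cases
        case 1
        then obtain y where y: "y \<in> K" "y \<in> ?T" using touched[OF P K] by auto
        have "cl P \<tau> y = K" "y \<in> V" using cls_eq[OF sm x(1), of y] cls_subset[OF sm x(1)] y x(2) by blast+
        then have "K \<in> ?D" using y(2) by blast
        then show ?thesis using 1 by simp
      qed auto
    qed
    also have "\<dots> = 5 * (\<Sum>K\<in>?S. int (card K)) - 20 * int (card ?S) + (\<Sum>K\<in>?S. if K \<in> ?D then 10 else 0)"
      by (simp add: sum.distrib sum_subtractf sum_distrib_left algebra_simps)
    also have "(\<Sum>K\<in>?S. int (card K)) = int (card V)" using card_cl[OF mP] by simp
    also have "(\<Sum>K\<in>?S. if K \<in> ?D then 10 else 0 :: int) = 10 * int (card (?S \<inter> ?D))"
      using fV by (simp add: sum.If_cases)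
    finally have "int (card (bad P)) \<le> 5 * int (card V) - 20 * int (card ?S) + 10 * int (card (?S \<inter> ?D))" .
    moreover have "card (?S \<inter> ?D) \<le> card R"
    proof -
      have "card (?S \<inter> ?D) \<le> card ?D" using fV by (intro card_mono) auto
      also have "\<dots> \<le> card (?T \<inter> V)" using fV by (intro card_image_le) auto
      also have "\<dots> \<le> card ?T" using markedD(8)[OF a] by (intro card_mono) auto
      finally show ?thesis using T by simp
    qed
    ultimately show ?thesis by (simp add: ncr_def)
  qed
  let ?B = "\<Union>P\<in>pairs C. bad P"
  have "card ?B \<le> (\<Sum>P\<in>pairs C. card (bad P))" by (rule card_UN_le[OF finite_pairs[OF fC]])
  then have "int (card ?B) \<le> (\<Sum>P\<in>pairs C. int (card (bad P)))" by (simp flip: of_nat_sum)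
  also have "\<dots> \<le> (\<Sum>P\<in>pairs C. 5 * (int (card V) - 4 * int (ncl P V \<tau>)) + 10 * int (card R))"
    by (rule sum_mono) (rule badP)
  also have "\<dots> = int (card (pairs C)) * (5 * int (card V) + 10 * int (card R)) - 20 * nfaces C V \<tau>"
    by (simp add: nfaces_def sum.distrib sum_subtractf sum_distrib_left algebra_simps)
  finally have "int (card ?B) \<le> int (card (pairs C)) * (5 * int (card V) + 10 * int (card R)) - 20 * nfaces C V \<tau>" .
  moreover have "card (pairs C) = 6" using card_pairs[OF fC] q by simp
  moreover have "deg4 C V \<tau> = 6 * int (card V) + 12 - 4 * nfaces C V \<tau>"
    using ncl_conn[OF con V] q by (simp add: deg4_def)
  ultimately have B: "int (card ?B) \<le> 5 * deg4 C V \<tau> + 60 * int (card R)" by simp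
  have fB: "finite ?B" using fV fC by (auto simp: bad_def finite_pairs)
  let ?N = "(nbh C \<tau> ^^ 3) ?B"
  have N: "card ?N \<le> 125 * card ?B"
  proof -
    have "card (nbh C \<tau> S) \<le> 5 * card S" "finite (nbh C \<tau> S)" if "finite S" for S
      using card_nbh[OF that fC, of \<tau>] q by auto
    note n = this
    have "card ?N \<le> 5 * card (nbh C \<tau> (nbh C \<tau> ?B))" using n[OF n(2)[OF n(2)[OF fB]]] by (simp add: numeral_3_eq_3)
    also have "\<dots> \<le> 5 * (5 * (5 * card ?B))" using n[OF fB] n[OF n(2)[OF fB]] by simp
    finally show ?thesis by simp
  qed
  have fN: "finite ?N" by (simp add: numeral_3_eq_3 card_nbh(2) fC fB)
  have nonneg: "0 \<le> deg4 C V \<tau>" using deg4_nonneg[OF m] q by simp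
  show ?thesis
  proof (cases "V \<subseteq> ?N")
    case True
    then have "card V \<le> card ?N" using fN by (rule card_mono[rotated])
    then show ?thesis using N B nonneg by linarith
  next
    case False
    then obtain v where v: "v \<in> V" "v \<notin> ?N" by auto
    have com: "\<tau> c (\<tau> d x) = \<tau> d (\<tau> c x)" if x: "x \<in> V" "x \<notin> ?B" and cd: "c \<in> C" "d \<in> C" for x c d
    proof (cases "c = d")
      case False
      then have "{c, d} \<in> pairs C" using cd by (auto simp: pairs_def)
      then have "x \<notin> bad {c, d}" using x by blast
      then show ?thesis using short_face_commute[OF m cd False x(1)] x(1) by (simp add: bad_def)
    qed simp
    obtain X where X: "X \<subseteq> V" "v \<in> X" "card X \<le> 2 ^ card C" "\<forall>x\<in>X. \<forall>c\<in>C. \<tau> c x \<in> X"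
      using commuting_cube[OF m v com order_refl] q by auto
    have "cl C \<tau> v \<subseteq> X" by (rule cl_least) (use X in auto)
    then have "V = X" using con v(1) X(1) by (auto simp: conn_def)
    then have "card V \<le> 16" using X(3) q by simp
    then show ?thesis using nonneg by linarith
  qed
qed

theorem defect_bounded:
  assumes "4 \<le> card C"
  shows "\<exists>A B. 0 \<le> A \<and> 0 \<le> B \<and> (\<forall>(V :: 'v set) \<tau> R. marked C V \<tau> R \<longrightarrow> conn C V \<tau> \<longrightarrow> V \<noteq> {} \<longrightarrow> R \<noteq> {} \<longrightarrow>
    1 \<le> deg4 C V \<tau> \<or> 5 \<le> card R \<longrightarrow>
    2 * int (card V) - int (card (links C V \<tau> R)) \<le> A * deg4 C V \<tau> + B * (int (card R) - 4))"
proof -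
  obtain \<alpha> \<beta> \<gamma> :: int where pos: "0 \<le> \<alpha>" "0 \<le> \<beta>" "0 \<le> \<gamma>"
    and base: "\<And>(V :: 'v set) \<tau> R. marked C V \<tau> R \<Longrightarrow> conn C V \<tau> \<Longrightarrow> V \<noteq> {} \<Longrightarrow> R \<noteq> {} \<Longrightarrow>
      (\<And>w b. w \<in> V \<Longrightarrow> b \<in> V \<Longrightarrow> \<not> free_dipole C \<tau> R w b) \<Longrightarrow>
      2 * int (card V) \<le> \<alpha> * deg4 C V \<tau> + \<beta> * int (card R) + \<gamma>"
  proof (cases "card C = 4")
    case True
    show thesis
    proof (rule that[of 1250 15000 32])
      fix V :: "'v set" and \<tau> R
      assume "marked C V \<tau> R" "conn C V \<tau>" "V \<noteq> {}" "\<And>w b. w \<in> V \<Longrightarrow> b \<in> V \<Longrightarrow> \<not> free_dipole C \<tau> R w b"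
      from no_free_dipoles_3[OF this(1-3) True this(4)]
      show "2 * int (card V) \<le> 1250 * deg4 C V \<tau> + 15000 * int (card R) + 32" by blast
    qed auto
  next
    case False
    then have q: "5 \<le> card C" using assms by simp
    show thesis
    proof (rule that[of "4 * int (card C)" "4 * int (card C)" 0])
      fix V :: "'v set" and \<tau> R
      assume "marked C V \<tau> R" "conn C V \<tau>" "V \<noteq> {}" "\<And>w b. w \<in> V \<Longrightarrow> b \<in> V \<Longrightarrow> \<not> free_dipole C \<tau> R w b"
      from no_free_dipoles_high[OF this(1-3) q this(4)]
      show "2 * int (card V) \<le> 4 * int (card C) * deg4 C V \<tau> + 4 * int (card C) * int (card R) + 0" by simp
    qed auto
  qed
  define B where "B = 5 * \<beta> + \<gamma> + 1"
  define A where "A = \<alpha> + \<gamma> + 4 * B"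
  have "0 \<le> A" "0 \<le> B" using pos by (auto simp: A_def B_def)
  then show ?thesis using defect_bound[OF pos base B_def A_def] by blast
qed

section \<open>Rooted colored graphs as families of matchings\<close>

lemma colored_graphD:
  assumes "colored_graph D G"
  shows "finite (verts G)" "finite (edges G)" "whites G \<inter> blacks G = {}"
    "e \<in> edges G \<Longrightarrow> white_end G e \<in> whites G" "e \<in> edges G \<Longrightarrow> black_end G e \<in> blacks G"
    "e \<in> edges G \<Longrightarrow> color G e \<le> D"
    "w \<in> whites G \<Longrightarrow> c \<le> D \<Longrightarrow> \<exists>!e. e \<in> edges G \<and> white_end G e = w \<and> color G e = c"
    "b \<in> blacks G \<Longrightarrow> c \<le> D \<Longrightarrow> \<exists>!e. e \<in> edges G \<and> black_end G e = b \<and> color G e = c"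
    "verts G \<noteq> {}" "u \<in> verts G \<Longrightarrow> v \<in> verts G \<Longrightarrow> (u, v) \<in> (adjacency G (edges G))\<^sup>*"
  using assms unfolding colored_graph_def by blast+

definition ed :: "('v, 'e) graph \<Rightarrow> nat \<Rightarrow> 'v \<Rightarrow> 'e" where
  "ed G c v = (THE e. e \<in> edges G \<and> color G e = c \<and> (white_end G e = v \<or> black_end G e = v))"

definition nbr :: "('v, 'e) graph \<Rightarrow> nat \<Rightarrow> 'v \<Rightarrow> 'v" where
  "nbr G c v = (if white_end G (ed G c v) = v then black_end G (ed G c v) else white_end G (ed G c v))"

lemma ed_unique:
  assumes cg: "colored_graph D G" and v: "v \<in> verts G" "c \<le> D"
  shows "\<exists>!e. e \<in> edges G \<and> color G e = c \<and> (white_end G e = v \<or> black_end G e = v)"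
proof (cases "v \<in> whites G")
  case True
  then have "black_end G e \<noteq> v" if "e \<in> edges G" for e using colored_graphD(3,5)[OF cg] that by blast
  then show ?thesis using colored_graphD(7)[OF cg True v(2)] by metis
next
  case False
  then have "v \<in> blacks G" using v by (simp add: verts_def)
  moreover have "white_end G e \<noteq> v" if "e \<in> edges G" for e using colored_graphD(4)[OF cg] that False by blast
  ultimately show ?thesis using colored_graphD(8)[OF cg _ v(2)] by metis
qed

lemma ed:
  assumes cg: "colored_graph D G" and v: "v \<in> verts G" "c \<le> D"
  shows "ed G c v \<in> edges G" "color G (ed G c v) = c" "white_end G (ed G c v) = v \<or> black_end G (ed G c v) = v"
  using theI'[OF ed_unique[OF assms]] unfolding ed_def by blast+

lemma ed_eq:
  assumes cg: "colored_graph D G" and e: "e \<in> edges G"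
  shows "ed G (color G e) (white_end G e) = e" "ed G (color G e) (black_end G e) = e"
proof -
  have v: "white_end G e \<in> verts G" "black_end G e \<in> verts G" "color G e \<le> D"
    using colored_graphD(4-6)[OF cg e] by (auto simp: verts_def)
  show "ed G (color G e) (white_end G e) = e" "ed G (color G e) (black_end G e) = e"
    unfolding ed_def by (rule the1_equality[OF ed_unique[OF cg _ v(3)]]; use v e in auto)+
qed

lemma ends_ne: "colored_graph D G \<Longrightarrow> e \<in> edges G \<Longrightarrow> white_end G e \<noteq> black_end G e"
  using colored_graphD(3)[of D G] colored_graphD(4,5)[of D G e] by auto

lemma nbr_ends:
  assumes "colored_graph D G" "e \<in> edges G"
  shows "nbr G (color G e) (white_end G e) = black_end G e" "nbr G (color G e) (black_end G e) = white_end G e"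
  using ed_eq[OF assms] ends_ne[OF assms] by (auto simp: nbr_def)

lemma nbr_white:
  assumes cg: "colored_graph D G" and w: "w \<in> whites G" "c \<le> D"
  shows "white_end G (ed G c w) = w" "black_end G (ed G c w) = nbr G c w" "nbr G c w \<in> blacks G"
proof -
  have v: "w \<in> verts G" using w by (simp add: verts_def)
  note e = ed[OF cg v w(2)]
  have "black_end G (ed G c w) \<noteq> w" using colored_graphD(3)[OF cg] colored_graphD(5)[OF cg e(1)] w(1) by auto
  then show 1: "white_end G (ed G c w) = w" using e(3) by blast
  then show "black_end G (ed G c w) = nbr G c w" by (simp add: nbr_def)
  then show "nbr G c w \<in> blacks G" using colored_graphD(5)[OF cg e(1)] by simp
qed

lemma nbr_black:
  assumes cg: "colored_graph D G" and b: "b \<in> blacks G" "c \<le> D"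
  shows "black_end G (ed G c b) = b" "white_end G (ed G c b) = nbr G c b" "nbr G c b \<in> whites G"
proof -
  have v: "b \<in> verts G" using b by (simp add: verts_def)
  note e = ed[OF cg v b(2)]
  have n: "white_end G (ed G c b) \<noteq> b" using colored_graphD(3)[OF cg] colored_graphD(4)[OF cg e(1)] b(1) by auto
  then show 1: "black_end G (ed G c b) = b" using e(3) by blast
  show "white_end G (ed G c b) = nbr G c b" using n by (simp add: nbr_def)
  then show "nbr G c b \<in> whites G" using colored_graphD(4)[OF cg e(1)] by simp
qed

lemma matchings_nbr:
  assumes cg: "colored_graph D G" shows "matchings {..D} (verts G) (nbr G)"
  unfolding matchings_def
proof (intro conjI ballI)
  fix c x assume c: "c \<in> {..D}" and x: "x \<in> verts G"
  let ?e = "ed G c x"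
  have e: "?e \<in> edges G" "color G ?e = c" "white_end G ?e = x \<or> black_end G ?e = x" using ed[OF cg x] c by auto
  have n: "nbr G c (white_end G ?e) = black_end G ?e" "nbr G c (black_end G ?e) = white_end G ?e"
    using nbr_ends[OF cg e(1)] e(2) by auto
  show "nbr G c x \<in> verts G" "nbr G c x \<noteq> x" "nbr G c (nbr G c x) = x"
    using e(3) n ends_ne[OF cg e(1)] colored_graphD(4,5)[OF cg e(1)] by (auto simp: verts_def)
qed (use colored_graphD(1)[OF cg] in auto)

lemma adjacency_iff:
  assumes cg: "colored_graph D G" and P: "P \<subseteq> {..D}" and u: "u \<in> verts G"
  shows "(u, v) \<in> adjacency G {e \<in> edges G. color G e \<in> P} \<longleftrightarrow> (u, v) \<in> step P (nbr G)"
proof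
  assume "(u, v) \<in> adjacency G {e \<in> edges G. color G e \<in> P}"
  then obtain e where e: "e \<in> edges G" "color G e \<in> P" "{u, v} = {white_end G e, black_end G e}"
    by (auto simp: adjacency_def)
  then have "v = nbr G (color G e) u" using nbr_ends[OF cg e(1)] by (auto simp: doubleton_eq_iff)
  then show "(u, v) \<in> step P (nbr G)" using e by (auto simp: step_iff)
next
  assume "(u, v) \<in> step P (nbr G)"
  then obtain c where c: "c \<in> P" "v = nbr G c u" by (auto simp: step_iff)
  note e = ed[OF cg u, of c]
  have "{u, v} = {white_end G (ed G c u), black_end G (ed G c u)}"
    using c e P by (auto simp: nbr_def)
  moreover have "ed G c u \<in> {e \<in> edges G. color G e \<in> P}" using e c P by auto
  ultimately show "(u, v) \<in> adjacency G {e \<in> edges G. color G e \<in> P}"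
    unfolding adjacency_def c(2) by blast
qed

lemma adjacency_star:
  assumes cg: "colored_graph D G" and P: "P \<subseteq> {..D}" and u: "u \<in> verts G"
  shows "(u, v) \<in> (adjacency G {e \<in> edges G. color G e \<in> P})\<^sup>* \<longleftrightarrow> v \<in> cl P (nbr G) u"
proof -
  let ?A = "adjacency G {e \<in> edges G. color G e \<in> P}"
  have s: "symon (verts G) (step P (nbr G))" by (rule matchings_symon[OF matchings_nbr[OF cg] P])
  have sA: "symon (verts G) ?A"
  proof (rule symonI)
    fix x y assume xy: "x \<in> verts G" "(x, y) \<in> ?A"
    have "(x, y) \<in> step P (nbr G)" using adjacency_iff[OF cg P xy(1)] xy(2) by blast
    from symonD[OF s xy(1) this] show "y \<in> verts G \<and> (y, x) \<in> ?A" using adjacency_iff[OF cg P] by blast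
  qed
  have "cls ?A u = cl P (nbr G) u" by (rule cls_cong[OF sA s adjacency_iff[OF cg P] u])
  then show ?thesis by (auto simp: cls_def)
qed

lemma conn_nbr: assumes cg: "colored_graph D G" shows "conn {..D} (verts G) (nbr G)"
  unfolding conn_def
proof
  fix x assume x: "x \<in> verts G"
  have e: "{e \<in> edges G. color G e \<in> {..D}} = edges G" using colored_graphD(6)[OF cg] by auto
  show "cl {..D} (nbr G) x = verts G"
  proof
    show "cl {..D} (nbr G) x \<subseteq> verts G" by (rule cls_subset[OF matchings_symon[OF matchings_nbr[OF cg] order_refl] x])
    show "verts G \<subseteq> cl {..D} (nbr G) x"
      using colored_graphD(10)[OF cg x] adjacency_star[OF cg order_refl x] unfolding e by blast
  qed
qed

text \<open>A face is a set of edges, a class a set of vertices. The edges determine the class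
  because every class contains a white vertex.\<close>

lemma card_faces:
  assumes cg: "colored_graph D G" and c: "c \<le> D" "c' \<le> D"
  shows "card (faces G c c') = ncl {c, c'} (verts G) (nbr G)"
proof -
  let ?P = "{c, c'}"
  let ?F = "{e \<in> edges G. color G e \<in> ?P}"
  let ?g = "\<lambda>K. {e \<in> ?F. white_end G e \<in> K}"
  have P: "?P \<subseteq> {..D}" using c by auto
  note m = matchings_nbr[OF cg]
  have s: "symon (verts G) (step ?P (nbr G))" by (rule matchings_symon[OF m P])
  have "faces G c c' = (\<lambda>v. ?g (cl ?P (nbr G) v)) ` verts G"
    unfolding faces_def Let_def by (rule image_cong[OF refl]) (use adjacency_star[OF cg P] in blast)
  then have "faces G c c' = ?g ` (cl ?P (nbr G) ` verts G)" by (simp add: image_image)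
  moreover have "inj_on ?g (cl ?P (nbr G) ` verts G)"
  proof (rule inj_onI)
    fix K K' assume K: "K \<in> cl ?P (nbr G) ` verts G" and K': "K' \<in> cl ?P (nbr G) ` verts G" and eq: "?g K = ?g K'"
    obtain x where x: "x \<in> verts G" "K = cl ?P (nbr G) x" using K by auto
    obtain y where y: "y \<in> verts G" "K' = cl ?P (nbr G) y" using K' by auto
    have "\<exists>u\<in>K. u \<in> whites G"
    proof (cases "x \<in> whites G")
      case False
      then have "nbr G c x \<in> whites G" using x(1) nbr_black(3)[OF cg _ c(1)] by (auto simp: verts_def)
      moreover have "nbr G c x \<in> K" using cl_step[OF cls_refl[of x], of c ?P "nbr G"] x by simp
      ultimately show ?thesis by blast
    qed (use x in auto)
    then obtain u where u: "u \<in> K" "u \<in> whites G" by blast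
    then have uv: "u \<in> verts G" by (simp add: verts_def)
    have "ed G c u \<in> ?g K" using ed(1,2)[OF cg uv c(1)] nbr_white(1)[OF cg u(2) c(1)] u(1) by auto
    then have "u \<in> K'" unfolding eq using nbr_white(1)[OF cg u(2) c(1)] by auto
    then show "K = K'" using u x y cls_eq[OF s x(1)] cls_eq[OF s y(1)] by metis
  qed
  ultimately show ?thesis by (simp add: card_image ncr_def)
qed

lemma num_faces_nfaces:
  assumes cg: "colored_graph D G"
  shows "int (num_faces D G) = nfaces {..D} (verts G) (nbr G)"
proof -
  let ?I = "{(c, c'). c < c' \<and> c' \<le> D}"
  have "\<not> empty_graph G" using colored_graphD(9)[OF cg] by (simp add: empty_graph_def)
  then have "int (num_faces D G) = (\<Sum>p\<in>?I. int (case p of (c, c') \<Rightarrow> card (faces G c c')))"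
    by (simp add: num_faces_def case_prod_unfold)
  also have "\<dots> = (\<Sum>p\<in>?I. int (ncl (case p of (c, c') \<Rightarrow> {c, c'}) (verts G) (nbr G)))"
    by (rule sum.cong) (auto simp: card_faces[OF cg])
  also have "\<dots> = (\<Sum>P\<in>pairs {..D}. int (ncl P (verts G) (nbr G)))"
  proof (rule sum.reindex_bij_betw)
    show "bij_betw (\<lambda>p. case p of (c, c') \<Rightarrow> {c, c'}) ?I (pairs {..D})"
      unfolding bij_betw_def
    proof
      show "inj_on (\<lambda>p. case p of (c, c') \<Rightarrow> {c, c'}) ?I"
        by (auto simp: inj_on_def doubleton_eq_iff)
      show "(\<lambda>p. case p of (c, c') \<Rightarrow> {c, c'}) ` ?I = pairs {..D}"
      proof
        show "pairs {..D} \<subseteq> (\<lambda>p. case p of (c, c') \<Rightarrow> {c, c'}) ` ?I"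
        proof
          fix P assume P: "P \<in> pairs {..D}"
          then obtain a b where ab: "P = {a, b}" "a \<noteq> b" by (auto simp: pairs_def card_2_iff)
          have "P = {min a b, max a b}" "min a b < max a b" "max a b \<le> D"
            using ab P by (auto simp: pairs_def min_def max_def)
          then show "P \<in> (\<lambda>p. case p of (c, c') \<Rightarrow> {c, c'}) ` ?I" by force
        qed
      qed (auto simp: pairs_def)
    qed
  qed
  finally show ?thesis by (simp add: nfaces_def)
qed

lemma deg4_degree:
  assumes cg: "colored_graph D G"
  shows "deg4 {..D} (verts G) (nbr G) = 4 * degree D G"
proof -
  note m = matchings_nbr[OF cg]
  have n1: "ncl {..D} (verts G) (nbr G) = 1" by (rule ncl_conn[OF conn_nbr[OF cg] colored_graphD(9)[OF cg]])
  have "even (card (verts G))" using even_card_matchings[OF m] by auto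
  then have v: "2 * int (card (verts G) div 2) = int (card (verts G))" by presburger
  have "even (D * (D - 1))" by (cases D) auto
  then have "2 * (D * (D - 1) div 2) = D * (D - 1)" by presburger
  then have "2 * int (D * (D - 1) div 2) = int (D * (D - 1))" by presburger
  also have "int (D * (D - 1)) = int D * (int D - 1)" by (cases D) (auto simp: algebra_simps)
  finally have d: "2 * int (D * (D - 1) div 2) = int D * (int D - 1)" .
  have "4 * degree D G = (2 * int (D * (D - 1) div 2)) * (2 * int (card (verts G) div 2)) + 4 * int D - 4 * int (num_faces D G)"
    by (simp add: degree_def)
  then show ?thesis unfolding d v num_faces_nfaces[OF cg] by (simp add: deg4_def n1)
qed

section \<open>The rooted melon-free graph as a marked graph\<close>

locale rgraph =
  fixes D :: nat and G :: "('v, 'e) graph" and e0 :: 'e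
  assumes D: "3 \<le> D" and cg: "colored_graph D G" and e0: "e0 \<in> edges G" and rt: "root G = Some e0"
    and mf: "melon_free D G"
begin

definition "R = {(white_end G e0, color G e0), (black_end G e0, color G e0)}"

abbreviation "C \<equiv> {..D}"
abbreviation "V \<equiv> verts G"
abbreviation "\<tau> \<equiv> nbr G"

lemma R_iff: "x \<in> V \<Longrightarrow> c \<le> D \<Longrightarrow> (x, c) \<in> R \<longleftrightarrow> ed G c x = e0"
  using ed_eq[OF cg e0] ed[OF cg, of x c] by (auto simp: R_def)

lemma edges_between_par:
  assumes "w \<in> whites G" "b \<in> blacks G"
  shows "bij_betw (color G) (edges_between G w b) (par C \<tau> w b)"
    "bij_betw (color G) (edges_between G w b - {e0}) (unm C \<tau> R w b)"
proof -
  have inj: "inj_on (color G) (edges_between G w b)"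
    using ed_eq(1)[OF cg] unfolding inj_on_def edges_between_def by (metis (mono_tags, lifting) mem_Collect_eq)
  have par: "color G ` edges_between G w b = par C \<tau> w b"
  proof
    show "color G ` edges_between G w b \<subseteq> par C \<tau> w b"
      using nbr_ends(1)[OF cg] colored_graphD(6)[OF cg] by (auto simp: edges_between_def par_def)
    show "par C \<tau> w b \<subseteq> color G ` edges_between G w b"
    proof
      fix c assume "c \<in> par C \<tau> w b"
      then have c: "c \<le> D" "\<tau> c w = b" by (auto simp: par_def)
      have v: "w \<in> V" using assms by (simp add: verts_def)
      have "ed G c w \<in> edges_between G w b" "color G (ed G c w) = c"
        using ed[OF cg v c(1)] nbr_white[OF cg assms(1) c(1)] c by (auto simp: edges_between_def)
      then show "c \<in> color G ` edges_between G w b" by force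
    qed
  qed
  show 1: "bij_betw (color G) (edges_between G w b) (par C \<tau> w b)" using inj par by (simp add: bij_betw_def)
  have "e = e0 \<longleftrightarrow> (w, color G e) \<in> R" if "e \<in> edges_between G w b" for e
  proof -
    have e: "e \<in> edges G" "white_end G e = w" using that by (auto simp: edges_between_def)
    show ?thesis using R_iff[of w "color G e"] ed_eq(1)[OF cg e(1)] e colored_graphD(6)[OF cg e(1)] assms by (auto simp: verts_def)
  qed
  then have "unm C \<tau> R w b = color G ` (edges_between G w b - {e0})"
    using par by (auto simp: unm_def par_def)
  then show "bij_betw (color G) (edges_between G w b - {e0}) (unm C \<tau> R w b)"
    using inj by (simp add: bij_betw_def inj_on_diff)
qed

lemma unm_white_le:
  assumes "w \<in> whites G" "b \<in> blacks G" shows "card (unm C \<tau> R w b) \<le> card C - 2"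
proof (rule ccontr)
  assume "\<not> ?thesis"
  then have "D \<le> card (edges_between G w b - {e0})"
    using bij_betw_same_card[OF edges_between_par(2)[OF assms]] by simp
  then obtain F where "F \<subseteq> edges_between G w b - {e0}" "card F = D" by (metis obtain_subset_with_card_n)
  then have "melon D G w b" using assms rt by (auto simp: melon_def)
  then show False using mf by (simp add: melon_free_def)
qed

lemma card_R: "card R = 2"
  using ends_ne[OF cg e0] by (simp add: R_def)

lemma marked: "marked C V \<tau> R"
  unfolding marked_def
proof (intro conjI ballI)
  note m = matchings_nbr[OF cg]
  show "matchings C V \<tau>" by (rule m)
  show "4 \<le> card C" using D by simp
  show "R \<subseteq> V \<times> C" using colored_graphD(4-6)[OF cg e0] by (auto simp: R_def verts_def)
  fix e assume "e \<in> R" then show "case e of (x, c) \<Rightarrow> (\<tau> c x, c) \<in> R"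
    using nbr_ends[OF cg e0] by (auto simp: R_def)
next
  fix w b assume wb: "w \<in> V" "b \<in> V"
  note m = matchings_nbr[OF cg]
  have em: "unm C \<tau> R w b = {}" if "\<And>c. c \<le> D \<Longrightarrow> \<tau> c w \<noteq> b" using that by (auto simp: unm_def)
  consider "w \<in> whites G" "b \<in> blacks G" | "w \<in> blacks G" "b \<in> whites G" | "unm C \<tau> R w b = {}"
    using wb em nbr_white(3)[OF cg, of w] nbr_black(3)[OF cg, of w] by (auto simp: verts_def)
  then show "card (unm C \<tau> R w b) \<le> card C - 2"
  proof cases
    case 2
    have "(\<tau> c x, c) \<in> R \<longleftrightarrow> (x, c) \<in> R" if "x \<in> V" "c \<le> D" for x c
      using nbr_ends[OF cg e0] matchingsD(5)[OF m, of c x] that by (auto simp: R_def)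
    then have "unm C \<tau> R w b = unm C \<tau> R b w"
      using matchingsD(5)[OF m] wb by (fastforce simp: unm_def)
    then show ?thesis using unm_white_le 2 by simp
  qed (use unm_white_le in auto)
qed

lemma con: "conn C V \<tau>" by (rule conn_nbr[OF cg])

text \<open>In degree 0 there would be four marked half-edges by \<open>linear_melonic\<close>, but
  the root edge gives only two. So \<open>defect_bounded\<close> applies.\<close>

lemma degree_pos: "1 \<le> deg4 C V \<tau>"
proof (rule ccontr)
  assume "\<not> ?thesis"
  then have "card R = 4" using linear_melonic[OF marked con colored_graphD(9)[OF cg]] card_R by simp
  then show False using card_R by simp
qed

end

theorem defect_degree:
  assumes "3 \<le> D"
  shows "\<exists>N::nat. \<forall>(G :: ('v, 'e) graph) e0. rgraph D G e0 \<longrightarrow> degree D G = int \<delta> \<longrightarrow>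
     2 * card (verts G) \<le> N + card (links {..D} (verts G) (nbr G) (rgraph.R G e0))"
proof -
  obtain A B :: int where AB: "0 \<le> A" "0 \<le> B" "\<forall>(V :: 'v set) \<tau> R. marked {..D} V \<tau> R \<longrightarrow> conn {..D} V \<tau> \<longrightarrow> V \<noteq> {} \<longrightarrow> R \<noteq> {} \<longrightarrow>
    1 \<le> deg4 {..D} V \<tau> \<or> 5 \<le> card R \<longrightarrow>
    2 * int (card V) - int (card (links {..D} V \<tau> R)) \<le> A * deg4 {..D} V \<tau> + B * (int (card R) - 4)"
    using defect_bounded[of "{..D}"] assms by auto
  show ?thesis
  proof (intro exI[of _ "nat (A * (4 * int \<delta>))"] allI impI)
    fix G :: "('v, 'e) graph" and e0
    assume "rgraph D G e0" and d: "degree D G = int \<delta>"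
    then interpret rgraph D G e0 by simp
    have ne: "R \<noteq> {}" by (simp add: R_def)
    have "2 * int (card V) - int (card (links C V \<tau> R)) \<le> A * deg4 C V \<tau> + B * (int (card R) - 4)"
      using AB(3) marked con colored_graphD(9)[OF cg] degree_pos ne by blast
    \<comment> \<open>Here \<open>card R = 2\<close>, so the term with \<open>B\<close> is at most
      0.\<close>
    also have "\<dots> \<le> A * (4 * int \<delta>)" using card_R AB(2) deg4_degree[OF cg] d by simp
    finally show "2 * card V \<le> nat (A * (4 * int \<delta>)) + card (links C V \<tau> R)" by linarith
  qed
qed

section \<open>Full vertices\<close>

text \<open>Only for \<open>D = 3\<close> can a vertex lie in two dipoles; it then has two edges in each of them.\<close>

lemma two_partners:
  assumes a: "marked C V \<tau> R" and w: "w \<in> V" and u: "udip C \<tau> R w b1" "udip C \<tau> R w b2" "b1 \<noteq> b2"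
  shows "unm C \<tau> R w b1 \<union> unm C \<tau> R w b2 = C" "card C = 4"
    "(w, b1, c) \<in> links C V \<tau> R \<Longrightarrow> e \<in> unm C \<tau> R w b1 \<Longrightarrow> \<tau> e b2 = \<tau> c b1"
proof -
  note m = markedD(1)[OF a] and q = markedD(2)[OF a] and fC = markedD(7)[OF a]
  have two: "unm C \<tau> R x y \<union> unm C \<tau> R x z = C \<and> card C = 4"
    if "udip C \<tau> R x y" "udip C \<tau> R x z" "y \<noteq> z" for x y z
  proof -
    have sub: "unm C \<tau> R x y \<union> unm C \<tau> R x z \<subseteq> C" by (auto simp: unm_def)
    have "unm C \<tau> R x y \<inter> unm C \<tau> R x z = {}" using that(3) by (auto simp: unm_def)
    then have "card (unm C \<tau> R x y \<union> unm C \<tau> R x z) = 2 * (card C - 2)"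
      using that(1,2) markedD(9)[OF a] by (simp add: card_Un_disjoint udip_def)
    moreover have "card (unm C \<tau> R x y \<union> unm C \<tau> R x z) \<le> card C" using sub fC by (rule card_mono[rotated])
    ultimately have "card C = 4" "card (unm C \<tau> R x y \<union> unm C \<tau> R x z) = card C" using q by auto
    then show ?thesis using card_subset_eq[OF fC sub] by simp
  qed
  show U: "unm C \<tau> R w b1 \<union> unm C \<tau> R w b2 = C" "card C = 4" using two[OF u] by auto
  assume l: "(w, b1, c) \<in> links C V \<tau> R" and e: "e \<in> unm C \<tau> R w b1"
  have d: "b1 \<in> V" "c \<in> C" "\<tau> c w \<noteq> b1" "udip C \<tau> R (\<tau> c w) (\<tau> c b1)" using l by (auto simp: links_def)
  have b2: "b2 \<in> V" using udip_mem(1)[OF a w u(2)] .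
  have "c \<in> unm C \<tau> R w b2" using d U by (auto simp: unm_def)
  then have cw: "\<tau> c w = b2" by (simp add: unm_def)
  have "\<tau> c b1 \<noteq> w" using matchings_eqD(2)[OF m d(2) w d(1)] d(3) by simp
  moreover have "udip C \<tau> R b2 w" using udip_sym[OF a w b2] u(2) by simp
  ultimately have "unm C \<tau> R b2 w \<union> unm C \<tau> R b2 (\<tau> c b1) = C" using two[of b2 w "\<tau> c b1"] d(4) cw by simp
  moreover have "unm C \<tau> R b2 w = unm C \<tau> R w b2" using unm_sym[OF a w b2] by simp
  moreover have "e \<in> C" "e \<notin> unm C \<tau> R w b2" using e u(3) by (auto simp: unm_def)
  ultimately have "e \<in> unm C \<tau> R b2 (\<tau> c b1)" by blast
  then show "\<tau> e b2 = \<tau> c b1" by (simp add: unm_def)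
qed

lemma closed_4:
  assumes con: "conn C V \<tau>" and x: "x \<in> V"
    and cl: "\<And>y c. y \<in> {x, x1, x2, x3} \<Longrightarrow> c \<in> C \<Longrightarrow> \<tau> c y \<in> {x, x1, x2, x3}"
  shows "card V \<le> 4"
proof -
  have "cl C \<tau> x \<subseteq> {x, x1, x2, x3}" by (rule cl_least) (use cl in auto)
  then have "V \<subseteq> {x, x1, x2, x3}" using con x by (simp add: conn_def)
  then have "card V \<le> card {x, x1, x2, x3}" by (rule card_mono[rotated]) auto
  also have "\<dots> \<le> 4" by (simp add: card_insert_if)
  finally show ?thesis .
qed

text \<open>The neighbours of \<open>w\<close> are just \<open>b1\<close> and \<open>b2\<close>,
  each in two colors. Two different links at \<open>w\<close> give \<open>b1\<close> and
  \<open>b2\<close> the same other neighbour in all remaining colors, so these four vertices are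
  closed under all colors. This is the reason for the condition \<open>5 \<le> card V\<close>
  below.\<close>

lemma small_graph_1:
  assumes a: "marked C V \<tau> R" and con: "conn C V \<tau>" and w: "w \<in> V"
    and u: "udip C \<tau> R w b1" "udip C \<tau> R w b2" "b1 \<noteq> b2"
    and l: "(w, b1, c) \<in> links C V \<tau> R" "(w, b, d) \<in> links C V \<tau> R" "(b1, c) \<noteq> (b, d)"
  shows "card V \<le> 4"
proof -
  note m = markedD(1)[OF a]
  let ?U1 = "unm C \<tau> R w b1" and ?U2 = "unm C \<tau> R w b2" and ?z = "\<tau> c b1"
  have U: "?U1 \<union> ?U2 = C" "card C = 4" using two_partners(1,2)[OF a w u] by auto
  have t: "\<tau> e w = b1" if "e \<in> ?U1" for e using that by (simp add: unm_def)
  have t2: "\<tau> e w = b2" if "e \<in> ?U2" for e using that by (simp add: unm_def)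
  have V: "b1 \<in> V" "b2 \<in> V" using udip_mem(1)[OF a w] u by blast+
  have cC: "c \<in> C" "d \<in> C" "\<tau> c w \<noteq> b1" "\<tau> d w \<noteq> b" "udip C \<tau> R w b" using l by (auto simp: links_def)
  have c2: "c \<in> ?U2" using U cC t by auto
  have U1: "\<tau> e b2 = ?z" if "e \<in> ?U1" for e using two_partners(3)[OF a w u l(1) that] .
  have ne: "?U1 \<noteq> {}" using u(1) U by (auto simp: udip_def)
  have cU: "card ?U2 = 2" using u(2) U by (simp add: udip_def)
  have bb: "b = b1 \<or> b = b2"
  proof (rule ccontr)
    assume "\<not> ?thesis"
    then have "unm C \<tau> R w b \<inter> (?U1 \<union> ?U2) = {}" by (auto simp: unm_def)
    then have "unm C \<tau> R w b = {}" unfolding U(1) by (auto simp: unm_def)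
    then show False using cC(5) U(2) by (simp add: udip_def)
  qed
  have U2: "\<tau> e b1 = ?z" if e: "e \<in> ?U2" for e
  proof (cases "b = b1")
    case True
    then have "d \<in> ?U2" "c \<noteq> d" using U cC t l(3) by auto
    then have "?U2 = {c, d}" using c2 cU card_subset_eq[of ?U2 "{c, d}"] markedD(9)[OF a] by auto
    moreover have "\<tau> d b1 = ?z" using two_partners(3)[OF a w u, of d] l(2) True U1 ne by fastforce
    ultimately show ?thesis using e by auto
  next
    case False
    then have b: "b = b2" using bb by simp
    have "d \<in> ?U1" using U cC t2 b by auto
    then have "\<tau> d b2 = ?z" using U1 by simp
    moreover have "\<tau> e b1 = \<tau> d b2" using two_partners(3)[OF a w u(2,1) u(3)[symmetric], of d e] l(2) b e by simp
    ultimately show ?thesis by simp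
  qed
  show ?thesis
  proof (rule closed_4[OF con w, of b1 b2 ?z])
    fix y e assume y: "y \<in> {w, b1, b2, ?z}" and e: "e \<in> C"
    have i: "\<tau> e (\<tau> e x) = x" if "x \<in> V" for x using matchingsD(5)[OF m e that] .
    consider "e \<in> ?U1" | "e \<in> ?U2" using e U by auto
    then show "\<tau> e y \<in> {w, b1, b2, ?z}"
    proof cases
      case 1
      have "\<tau> e w = b1" "\<tau> e b2 = ?z" using 1 t U1 by auto
      moreover have "\<tau> e b1 = w" "\<tau> e ?z = b2" using i[OF w] i[OF V(2)] calculation by auto
      ultimately show ?thesis using y by auto
    next
      case 2
      have "\<tau> e w = b2" "\<tau> e b1 = ?z" using 2 t2 U2 by auto
      moreover have "\<tau> e b2 = w" "\<tau> e ?z = b1" using i[OF w] i[OF V(1)] calculation by auto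
      ultimately show ?thesis using y by auto
    qed
  qed
qed

text \<open>The dipole of a full vertex is linked on both sides, as in the interior of a
  chain.\<close>

definition full :: "nat set \<Rightarrow> 'v set \<Rightarrow> (nat \<Rightarrow> 'v \<Rightarrow> 'v) \<Rightarrow> ('v \<times> nat) set \<Rightarrow> 'v \<Rightarrow> bool" where
  "full C V \<tau> R w \<longleftrightarrow> (\<exists>b i j. i \<noteq> j \<and> (w, b, i) \<in> links C V \<tau> R \<and> (w, b, j) \<in> links C V \<tau> R)"

lemma full_unique:
  assumes a: "marked C V \<tau> R" and con: "conn C V \<tau>" and n: "5 \<le> card V" and f: "full C V \<tau> R w"
    and u: "udip C \<tau> R w b1" "udip C \<tau> R w b2"
  shows "b1 = b2"
proof (rule ccontr)
  assume ne: "b1 \<noteq> b2"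
  obtain b i j where l: "i \<noteq> j" "(w, b, i) \<in> links C V \<tau> R" "(w, b, j) \<in> links C V \<tau> R" using f by (auto simp: full_def)
  have w: "w \<in> V" and ub: "udip C \<tau> R w b" using l by (auto simp: links_def)
  obtain b' where "b' \<noteq> b" "udip C \<tau> R w b'" using ne u by metis
  then have "card V \<le> 4" using small_graph_1[OF a con w ub _ _ l(2,3)] l(1) by auto
  then show False using n by simp
qed

lemma full_struct:
  assumes a: "marked C V \<tau> R" and con: "conn C V \<tau>" and n: "5 \<le> card V" and f: "full C V \<tau> R w"
    and u: "udip C \<tau> R w b"
  obtains i j where "i \<in> C" "j \<in> C" "i \<noteq> j" "par C \<tau> w b = C - {i, j}" "unm C \<tau> R w b = C - {i, j}"
    "(w, b, i) \<in> links C V \<tau> R" "(w, b, j) \<in> links C V \<tau> R"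
proof -
  obtain b' i j where l: "i \<noteq> j" "(w, b', i) \<in> links C V \<tau> R" "(w, b', j) \<in> links C V \<tau> R" using f by (auto simp: full_def)
  then have "b' = b" using full_unique[OF a con n f _ u] by (auto simp: links_def)
  note l = l[unfolded this]
  have ij: "i \<in> C" "j \<in> C" "\<tau> i w \<noteq> b" "\<tau> j w \<noteq> b" using l by (auto simp: links_def)
  have p: "par C \<tau> w b \<subseteq> C - {i, j}" "unm C \<tau> R w b \<subseteq> par C \<tau> w b" using ij by (auto simp: par_def unm_def)
  have fC: "finite (C - {i, j})" using markedD(7)[OF a] by simp
  have "card (C - {i, j}) = card C - 2" using ij l(1) markedD(7)[OF a] by (simp add: card_Diff_subset)
  then have "unm C \<tau> R w b = C - {i, j}" using card_subset_eq[OF fC, of "unm C \<tau> R w b"] p u by (auto simp: udip_def)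
  then show thesis using that ij l p by blast
qed

lemma full_partner:
  assumes a: "marked C V \<tau> R" and con: "conn C V \<tau>" and n: "5 \<le> card V" and f: "full C V \<tau> R w" and u: "udip C \<tau> R w b"
  shows "full C V \<tau> R b"
proof -
  obtain i j where "i \<noteq> j" "(w, b, i) \<in> links C V \<tau> R" "(w, b, j) \<in> links C V \<tau> R" using full_struct[OF assms] by metis
  then show ?thesis using links_sym(1)[OF a] unfolding full_def by blast
qed

text \<open>The links at a full vertex use the two colors that leave its only dipole, so there are
  at most two. A vertex that is not full begins at most one: two links from the same dipole would
  make it full, and two from different dipoles would make the graph small.\<close>

lemma nonfull_count:
  assumes a: "marked C V \<tau> R" and con: "conn C V \<tau>" and n: "5 \<le> card V"
  shows "card {w \<in> V. \<not> full C V \<tau> R w} + card (links C V \<tau> R) \<le> 2 * card V"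
proof -
  let ?L = "\<lambda>w. {p. (w, fst p, snd p) \<in> links C V \<tau> R}"
  have fV: "finite V" using markedD(6)[OF a] .
  have fL: "finite (?L w)" for w
    by (rule finite_subset[of _ "V \<times> C"]) (use markedD(6,7)[OF a] in \<open>auto simp: links_def\<close>)
  have "links C V \<tau> R = Sigma V ?L" by (auto simp: links_def)
  then have cL: "card (links C V \<tau> R) = (\<Sum>w\<in>V. card (?L w))" using card_SigmaI[OF fV, of ?L] fL by simp
  have "card {w \<in> V. \<not> full C V \<tau> R w} = (\<Sum>w\<in>V. if full C V \<tau> R w then 0 else 1)"
    using fV by (simp add: sum.If_cases Int_def)
  then have "card {w \<in> V. \<not> full C V \<tau> R w} + card (links C V \<tau> R)
      = (\<Sum>w\<in>V. (if full C V \<tau> R w then 0 else 1) + card (?L w))" using cL by (simp add: sum.distrib)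
  also have "\<dots> \<le> (\<Sum>w\<in>V. 2)"
  proof (rule sum_mono)
    fix w assume w: "w \<in> V"
    show "(if full C V \<tau> R w then 0 else 1) + card (?L w) \<le> 2"
    proof (cases "full C V \<tau> R w")
      case True
      then obtain b where u: "udip C \<tau> R w b" by (auto simp: full_def links_def)
      have "?L w \<subseteq> {b} \<times> (C - unm C \<tau> R w b)"
        using full_unique[OF a con n True _ u] by (auto simp: links_def unm_def)
      then have "card (?L w) \<le> card ({b} \<times> (C - unm C \<tau> R w b))"
        using markedD(7)[OF a] by (intro card_mono) auto
      also have "\<dots> = card C - (card C - 2)" using u markedD(9)[OF a]
        by (simp add: card_cartesian_product udip_def card_Diff_subset unm_def)
      finally show ?thesis using True by simp
    next
      case False
      have "x = y" if x: "x \<in> ?L w" and y: "y \<in> ?L w" for x y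
      proof (rule ccontr)
        assume ne: "x \<noteq> y"
        obtain b i b' j where xy: "x = (b, i)" "y = (b', j)" by fastforce
        have l: "(w, b, i) \<in> links C V \<tau> R" "(w, b', j) \<in> links C V \<tau> R" using x y xy by auto
        show False
        proof (cases "b = b'")
          case True then show False using l ne xy False by (auto simp: full_def)
        next
          case nb: False
          have "card V \<le> 4"
            by (rule small_graph_1[OF a con w _ _ nb l]) (use l ne xy in \<open>auto simp: links_def\<close>)
          then show False using n by simp
        qed
      qed
      then have "card (?L w) \<le> Suc 0" using fL[of w] by (simp only: card_le_Suc0_iff_eq) blast
      then show ?thesis using False by simp
    qed
  qed
  finally show ?thesis by simp
qed

text \<open>If both links led to the same dipole, the two dipoles together would be closed under all
  colors and form a graph of four vertices.\<close>

lemma link_ends_distinct: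
  assumes a: "marked C V \<tau> R" and con: "conn C V \<tau>" and n: "5 \<le> card V"
    and l: "(w, b, i) \<in> links C V \<tau> R" "(w, b, j) \<in> links C V \<tau> R" "i \<noteq> j" and f': "full C V \<tau> R (\<tau> i w)"
  shows "\<tau> i w \<noteq> \<tau> j w"
proof
  assume e: "\<tau> i w = \<tau> j w"
  note m = markedD(1)[OF a]
  have d: "w \<in> V" "b \<in> V" "i \<in> C" "j \<in> C" "udip C \<tau> R w b" "\<tau> i w \<noteq> b" "udip C \<tau> R (\<tau> i w) (\<tau> i b)"
    "udip C \<tau> R (\<tau> j w) (\<tau> j b)" "\<tau> j w \<noteq> b" using l by (auto simp: links_def)
  have eb: "\<tau> i b = \<tau> j b" using full_unique[OF a con n f' d(7)] d(8) e by simp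
  have v: "\<tau> i w \<in> V" "\<tau> i b \<in> V" using matchingsD(3)[OF m d(3)] d by auto
  have two: "\<tau> c x = y" if u: "udip C \<tau> R x y" "\<tau> i x \<noteq> y" "\<tau> j x \<noteq> y" and c: "c \<in> C" "c \<noteq> i" "c \<noteq> j" for x y c
  proof -
    have "unm C \<tau> R x y \<subseteq> C - {i, j}" using u by (auto simp: unm_def)
    moreover have "card (C - {i, j}) = card C - 2" using d l(3) markedD(7)[OF a] by (simp add: card_Diff_subset)
    ultimately have "unm C \<tau> R x y = C - {i, j}"
      using card_subset_eq[of "C - {i, j}" "unm C \<tau> R x y"] u(1) markedD(7)[OF a] by (auto simp: udip_def)
    then show ?thesis using c by (auto simp: unm_def)
  qed
  let ?x = "\<tau> i w" and ?y = "\<tau> i b"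
  have inv: "\<tau> i ?x = w" "\<tau> j ?x = w" "\<tau> i ?y = b" "\<tau> j ?y = b" 
    using matchingsD(5)[OF m d(3)] matchingsD(5)[OF m d(4)] d e eb by metis+
  have ne: "w \<noteq> ?y" "b \<noteq> ?x" using d matchings_eqD(2)[OF m d(3,1,2)] by auto
  have t: "\<tau> c w = b" "\<tau> c b = w" "\<tau> c ?x = ?y" "\<tau> c ?y = ?x" if c: "c \<in> C" "c \<noteq> i" "c \<noteq> j" for c
  proof -
    show 1: "\<tau> c w = b" by (rule two[OF d(5) d(6) _ c]) (use d e in simp)
    then show "\<tau> c b = w" using matchings_eqD(2)[OF m c(1) d(1,2)] by simp
    show 2: "\<tau> c ?x = ?y" by (rule two[OF d(7) _ _ c]) (use inv ne in auto)
    then show "\<tau> c ?y = ?x" using matchings_eqD(2)[OF m c(1) v] by simp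
  qed
  have "card V \<le> 4"
  proof (rule closed_4[OF con d(1), of b ?x ?y])
    fix z c assume z: "z \<in> {w, b, ?x, ?y}" and c: "c \<in> C"
    consider "c = i" | "c = j" | "c \<noteq> i" "c \<noteq> j" by blast
    then show "\<tau> c z \<in> {w, b, ?x, ?y}"
    proof cases
      case 1 then show ?thesis using z inv by auto
    next
      case 2 then show ?thesis using z inv e[symmetric] eb[symmetric] by auto
    next
      case 3 then show ?thesis using z t[OF c 3] by auto
    qed
  qed
  then show False using n by simp
qed

section \<open>Reversal of pre-chains\<close>

definition rev_pc :: "('v, 'e) prechain \<Rightarrow> ('v, 'e) prechain" where
  "rev_pc p = \<lparr>dipoles = rev (dipoles p), left_w = right_w p, left_b = right_b p,
     right_w = left_w p, right_b = left_b p\<rparr>"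

lemma rev_pc_simps [simp]: "dipoles (rev_pc p) = rev (dipoles p)" "left_w (rev_pc p) = right_w p"
  "left_b (rev_pc p) = right_b p" "right_w (rev_pc p) = left_w p" "right_b (rev_pc p) = left_b p"
  "internal_verts (rev_pc p) = internal_verts p" "internal_edges G (rev_pc p) = internal_edges G p"
  by (auto simp: rev_pc_def internal_verts_def internal_edges_def)

lemma prechain_rev: assumes "prechain D G p" shows "prechain D G (rev_pc p)"
proof -
  let ?ds = "dipoles p"
  have p: "?ds \<noteq> []" "distinct (map fst ?ds)" "distinct (map snd ?ds)" "\<forall>(w, b) \<in> set ?ds. dipole D G w b"
    "\<forall>i. Suc i < length ?ds \<longrightarrow>
        edges_between G (fst (?ds ! i)) (snd (?ds ! Suc i)) \<noteq> {} \<and>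
        edges_between G (fst (?ds ! Suc i)) (snd (?ds ! i)) \<noteq> {}"
    "{left_w p, left_b p, right_w p, right_b p} \<subseteq> edges G - internal_edges G p"
    "white_end G (left_w p) = fst (hd ?ds)" "black_end G (left_b p) = snd (hd ?ds)"
    "white_end G (right_w p) = fst (last ?ds)" "black_end G (right_b p) = snd (last ?ds)"
    "distinct [left_w p, left_b p, right_w p, right_b p]" "root G \<notin> Some ` internal_edges G p"
    using assms unfolding prechain_def Let_def by blast+
  have adj: "edges_between G (fst (rev ?ds ! i)) (snd (rev ?ds ! Suc i)) \<noteq> {} \<and>
        edges_between G (fst (rev ?ds ! Suc i)) (snd (rev ?ds ! i)) \<noteq> {}" if i: "Suc i < length ?ds" for i
  proof -
    let ?k = "length ?ds - Suc (Suc i)"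
    have "rev ?ds ! i = ?ds ! Suc ?k" "rev ?ds ! Suc i = ?ds ! ?k" "Suc ?k < length ?ds"
      using i by (auto simp: rev_nth Suc_diff_Suc)
    then show ?thesis using p(5) by auto
  qed
  show ?thesis unfolding prechain_def Let_def
    using p adj by (auto simp: rev_map[symmetric] hd_rev last_rev)
qed

section \<open>Dipoles between two other dipoles\<close>

context rgraph begin

lemmas matching = matchings_nbr[OF cg]

lemma whites_blacks: "w \<in> whites G \<Longrightarrow> w \<in> V" "b \<in> blacks G \<Longrightarrow> b \<in> V" "x \<in> whites G \<Longrightarrow> x \<notin> blacks G"
  using colored_graphD(3)[OF cg] by (auto simp: verts_def)

lemma nbr_color:
  "c \<in> C \<Longrightarrow> w \<in> whites G \<Longrightarrow> \<tau> c w \<in> blacks G" "c \<in> C \<Longrightarrow> b \<in> blacks G \<Longrightarrow> \<tau> c b \<in> whites G"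
  using nbr_white(3)[OF cg] nbr_black(3)[OF cg] by auto

lemma white_edge:
  assumes "c \<le> D" "x \<in> whites G"
  shows "black_end G (ed G c x) = \<tau> c x" "white_end G (ed G c x) = x" "ed G c x \<in> edges G"
  using nbr_white[OF cg assms(2,1)] ed[OF cg whites_blacks(1)[OF assms(2)] assms(1)] by auto

lemma black_edge:
  assumes "c \<le> D" "x \<in> blacks G"
  shows "white_end G (ed G c x) = \<tau> c x" "black_end G (ed G c x) = x" "ed G c x \<in> edges G"
  using nbr_black[OF cg assms(2,1)] ed[OF cg whites_blacks(2)[OF assms(2)] assms(1)] by auto

lemma dipole_iff: "dipole D G w b \<longleftrightarrow> w \<in> whites G \<and> b \<in> blacks G \<and> card (par C \<tau> w b) = D - 1"
  using bij_betw_same_card[OF edges_between_par(1)] by (auto simp: dipole_def)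

lemma dipole_udip:
  assumes "dipole D G w b" "root G \<notin> Some ` edges_between G w b" shows "udip C \<tau> R w b"
proof -
  have wb: "w \<in> whites G" "b \<in> blacks G" "card (edges_between G w b) = D - 1" using assms(1) by (auto simp: dipole_def)
  have "edges_between G w b - {e0} = edges_between G w b" using assms(2) rt by auto
  then show ?thesis using bij_betw_same_card[OF edges_between_par(2)[OF wb(1,2)]] wb(3) by (simp add: udip_def)
qed

text \<open>The shape of an inner dipole of a chain. The neighbours are required to be dipoles in
  the sense of \<open>dipole\<close> and not of \<open>udip\<close>, since maximality of pre-chains
  refers to the former. Each color exchanges white and black, so the neighbour over \<open>i\<close>
  has the white vertex \<open>\<tau> i b\<close> and the black vertex
  \<open>\<tau> i w\<close>.\<close>

definition biflank :: "nat \<Rightarrow> nat \<Rightarrow> 'v \<Rightarrow> 'v \<Rightarrow> bool" where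
  "biflank i j w b \<longleftrightarrow> w \<in> whites G \<and> b \<in> blacks G \<and> i \<in> C \<and> j \<in> C \<and> i \<noteq> j \<and> par C \<tau> w b = C - {i, j} \<and>
     (\<forall>c\<in>C. (w, c) \<notin> R \<and> (b, c) \<notin> R) \<and> dipole D G (\<tau> i b) (\<tau> i w) \<and> dipole D G (\<tau> j b) (\<tau> j w) \<and>
     \<tau> i w \<noteq> \<tau> j w \<and> \<tau> i b \<noteq> \<tau> j b"

lemma biflank_sym: "biflank i j w b \<Longrightarrow> biflank j i w b"
  unfolding biflank_def by (metis insert_commute)

lemma card_C2: "i \<in> C \<Longrightarrow> j \<in> C \<Longrightarrow> i \<noteq> j \<Longrightarrow> card (C - {i, j}) = D - 1"
  by (simp add: card_Diff_subset)

lemma biflank_dipole: "biflank i j w b \<Longrightarrow> dipole D G w b"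
  using card_C2 unfolding biflank_def dipole_iff by auto

lemma biflankD:
  assumes "biflank i j w b"
  shows "w \<in> whites G" "b \<in> blacks G" "i \<in> C" "j \<in> C" "i \<noteq> j" "c \<in> C \<Longrightarrow> c \<noteq> i \<Longrightarrow> c \<noteq> j \<Longrightarrow> \<tau> c w = b"
    "c \<in> C \<Longrightarrow> c \<noteq> i \<Longrightarrow> c \<noteq> j \<Longrightarrow> \<tau> c b = w" "\<tau> i w \<noteq> b" "\<tau> j w \<noteq> b" "\<tau> i b \<noteq> w" "\<tau> j b \<noteq> w"
    "c \<in> C \<Longrightarrow> (w, c) \<notin> R" "c \<in> C \<Longrightarrow> (b, c) \<notin> R"
    "dipole D G (\<tau> i b) (\<tau> i w)" "dipole D G (\<tau> j b) (\<tau> j w)" "\<tau> i w \<noteq> \<tau> j w" "\<tau> i b \<noteq> \<tau> j b"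
proof -
  have d: "w \<in> whites G" "b \<in> blacks G" "i \<in> C" "j \<in> C" "i \<noteq> j" "par C \<tau> w b = C - {i, j}"
     "\<forall>c\<in>C. (w, c) \<notin> R \<and> (b, c) \<notin> R" "dipole D G (\<tau> i b) (\<tau> i w)" "dipole D G (\<tau> j b) (\<tau> j w)"
     "\<tau> i w \<noteq> \<tau> j w" "\<tau> i b \<noteq> \<tau> j b"
    using assms unfolding biflank_def by blast+
  then show "w \<in> whites G" "b \<in> blacks G" "i \<in> C" "j \<in> C" "i \<noteq> j" "dipole D G (\<tau> i b) (\<tau> i w)" "dipole D G (\<tau> j b) (\<tau> j w)"
     "\<tau> i w \<noteq> \<tau> j w" "\<tau> i b \<noteq> \<tau> j b" "c \<in> C \<Longrightarrow> (w, c) \<notin> R" "c \<in> C \<Longrightarrow> (b, c) \<notin> R" by blast+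
  have v: "w \<in> V" "b \<in> V" using d whites_blacks by auto
  show 1: "c \<in> C \<Longrightarrow> c \<noteq> i \<Longrightarrow> c \<noteq> j \<Longrightarrow> \<tau> c w = b" for c using d(6) by (auto simp: par_def)
  show "c \<in> C \<Longrightarrow> c \<noteq> i \<Longrightarrow> c \<noteq> j \<Longrightarrow> \<tau> c b = w" using 1 matchings_eqD(2)[OF matching _ v] by blast
  show 2: "\<tau> i w \<noteq> b" "\<tau> j w \<noteq> b" using d(3,4,6) by (auto simp: par_def)
  show "\<tau> i b \<noteq> w" "\<tau> j b \<noteq> w" using 2 matchings_eqD(2)[OF matching _ v] d by blast+
qed

lemma full_dipole:
  assumes n: "5 \<le> card V" and w: "w \<in> whites G" and f: "full C V \<tau> R w" and u: "udip C \<tau> R w b"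
  shows "dipole D G w b"
proof -
  obtain i j where ij: "i \<in> C" "j \<in> C" "i \<noteq> j" "par C \<tau> w b = C - {i, j}"
    using full_struct[OF marked con n f u] by metis
  have "par C \<tau> w b \<noteq> {}"
  proof
    assume "par C \<tau> w b = {}"
    then have "card (C - {i, j}) = 0" using ij(4) by simp
    then show False using card_C2[OF ij(1-3)] D by simp
  qed
  then have "b \<in> blacks G" using nbr_color(1)[OF _ w] by (auto simp: par_def)
  then show ?thesis using w ij card_C2 by (simp add: dipole_iff)
qed

text \<open>That the neighbours of \<open>w\<close> are full excludes, by
  \<open>link_ends_distinct\<close>, that both links lead to the same dipole, and turns the dipoles
  at their other ends into dipoles in the sense of \<open>dipole\<close>.\<close>

lemma biflankI:
  assumes n: "5 \<le> card V" and w: "w \<in> whites G" and f: "full C V \<tau> R w" and u: "udip C \<tau> R w b"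
    and f': "\<And>c. c \<in> C \<Longrightarrow> full C V \<tau> R (\<tau> c w)"
  shows "\<exists>i j. biflank i j w b \<and> (w, b, i) \<in> links C V \<tau> R \<and> (w, b, j) \<in> links C V \<tau> R"
proof -
  obtain i j where ij: "i \<in> C" "j \<in> C" "i \<noteq> j" "par C \<tau> w b = C - {i, j}" "unm C \<tau> R w b = C - {i, j}"
    "(w, b, i) \<in> links C V \<tau> R" "(w, b, j) \<in> links C V \<tau> R"
    using full_struct[OF marked con n f u] by metis
  have b: "b \<in> blacks G" using full_dipole[OF n w f u] by (simp add: dipole_def)
  have wV: "w \<in> V" "b \<in> V" using w b whites_blacks by auto
  have fb: "full C V \<tau> R b" by (rule full_partner[OF marked con n f u])
  have dp: "dipole D G (\<tau> x b) (\<tau> x w) \<and> full C V \<tau> R (\<tau> x b)" if x: "x \<in> C" "(w, b, x) \<in> links C V \<tau> R" for x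
  proof -
    have ux: "udip C \<tau> R (\<tau> x w) (\<tau> x b)" using x by (simp add: links_def)
    have v: "\<tau> x w \<in> V" "\<tau> x b \<in> V" "\<tau> x b \<in> whites G" using matchingsD(3)[OF matching x(1)] wV nbr_color(2)[OF x(1) b] by auto
    have "full C V \<tau> R (\<tau> x b)" by (rule full_partner[OF marked con n f'[OF x(1)] ux])
    moreover have "udip C \<tau> R (\<tau> x b) (\<tau> x w)" using udip_sym[OF marked v(1,2)] ux by simp
    ultimately show ?thesis using full_dipole[OF n v(3)] by blast
  qed
  have "\<tau> i w \<noteq> \<tau> j w" by (rule link_ends_distinct[OF marked con n ij(6,7,3) f'[OF ij(1)]])
  moreover have "\<tau> i b \<noteq> \<tau> j b"
    by (rule link_ends_distinct[OF marked con n links_sym(1)[OF marked ij(6)] links_sym(1)[OF marked ij(7)] ij(3)])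
      (use dp ij in blast)
  moreover have "(w, c) \<notin> R \<and> (b, c) \<notin> R" if c: "c \<in> C" for c
  proof (cases "c = i \<or> c = j")
    case True then show ?thesis using ij(6,7) by (auto simp: links_def)
  next
    case False
    then have "c \<in> unm C \<tau> R w b" using c ij(5) by simp
    then have "c \<in> unm C \<tau> R b w" "c \<in> unm C \<tau> R w b" using unm_sym[OF marked wV] by auto
    then show ?thesis by (simp add: unm_def)
  qed
  ultimately have "biflank i j w b" using ij w b dp by (simp add: biflank_def)
  then show ?thesis using ij by blast
qed

end

section \<open>Pre-chains and maximality\<close>

context rgraph begin

lemma prechainD:
  assumes "prechain D G p"
  shows "dipoles p \<noteq> []" "distinct (map fst (dipoles p))" "distinct (map snd (dipoles p))"
    "(w, b) \<in> set (dipoles p) \<Longrightarrow> dipole D G w b"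
    "Suc i < length (dipoles p) \<Longrightarrow> edges_between G (fst (dipoles p ! i)) (snd (dipoles p ! Suc i)) \<noteq> {}"
    "Suc i < length (dipoles p) \<Longrightarrow> edges_between G (fst (dipoles p ! Suc i)) (snd (dipoles p ! i)) \<noteq> {}"
    "{left_w p, left_b p, right_w p, right_b p} \<subseteq> edges G - internal_edges G p"
    "white_end G (left_w p) = fst (hd (dipoles p))" "black_end G (left_b p) = snd (hd (dipoles p))"
    "white_end G (right_w p) = fst (last (dipoles p))" "black_end G (right_b p) = snd (last (dipoles p))"
    "distinct [left_w p, left_b p, right_w p, right_b p]" "e0 \<notin> internal_edges G p"
  using assms rt unfolding prechain_def Let_def by blast+

text \<open>\<open>Lb\<close> and \<open>Rb\<close> are the black neighbours of the white vertex of
  the \<open>n\<close>-th dipole on its two sides, \<open>Lw\<close> and \<open>Rw\<close> the white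
  neighbours of the black one. At the ends of the pre-chain they are the far ends of the external
  edges, so that all positions can be treated alike.\<close>

definition Lb where "Lb p n = (if n = 0 then black_end G (left_w p) else snd (dipoles p ! (n - 1)))"
definition Lw where "Lw p n = (if n = 0 then white_end G (left_b p) else fst (dipoles p ! (n - 1)))"
definition Rb where "Rb p n = (if Suc n = length (dipoles p) then black_end G (right_w p) else snd (dipoles p ! Suc n))"
definition Rw where "Rw p n = (if Suc n = length (dipoles p) then white_end G (right_b p) else fst (dipoles p ! Suc n))"

abbreviation "dw p n \<equiv> fst (dipoles p ! n)"
abbreviation "db p n \<equiv> snd (dipoles p ! n)"

lemma pos:
  assumes p: "prechain D G p" and n: "n < length (dipoles p)"
  shows "dipole D G (dw p n) (db p n)" "dw p n \<in> whites G" "db p n \<in> blacks G"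
    "dw p n \<in> internal_verts p" "db p n \<in> internal_verts p" "card (par C \<tau> (dw p n) (db p n)) = D - 1"
proof -
  have i: "dipoles p ! n \<in> set (dipoles p)" using n by simp
  then show 1: "dipole D G (dw p n) (db p n)" using prechainD(4)[OF p] by (metis prod.collapse)
  then show "dw p n \<in> whites G" "db p n \<in> blacks G" by (auto simp: dipole_def)
  show "dw p n \<in> internal_verts p" "db p n \<in> internal_verts p" using i by (auto simp: internal_verts_def)
  show "card (par C \<tau> (dw p n) (db p n)) = D - 1" using 1 dipole_iff by blast
qed

lemma pos_inj:
  assumes p: "prechain D G p" and n: "n < length (dipoles p)" "k < length (dipoles p)"
  shows "dw p n = dw p k \<longleftrightarrow> n = k" "db p n = db p k \<longleftrightarrow> n = k"
  using nth_eq_iff_index_eq[OF prechainD(2)[OF p], of n k] nth_eq_iff_index_eq[OF prechainD(3)[OF p], of n k] n by auto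

lemma internal_vertsE:
  assumes "v \<in> internal_verts p"
  obtains n where "n < length (dipoles p)" "v = dw p n \<or> v = db p n"
  using assms unfolding internal_verts_def by (auto simp: in_set_conv_nth)

lemma internal_white:
  assumes p: "prechain D G p" and v: "v \<in> internal_verts p" "v \<in> whites G"
  obtains n where "n < length (dipoles p)" "v = dw p n"
  using internal_vertsE[OF v(1)] pos(3)[OF p] whites_blacks(3)[OF v(2)] by metis

lemma internal_black:
  assumes p: "prechain D G p" and v: "v \<in> internal_verts p" "v \<in> blacks G"
  obtains n where "n < length (dipoles p)" "v = db p n"
  using internal_vertsE[OF v(1)] pos(2)[OF p] whites_blacks(3) v(2) by metis

lemma external_other_end:
  assumes p: "prechain D G p"
  shows "black_end G (left_w p) \<notin> internal_verts p" "white_end G (left_b p) \<notin> internal_verts p"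
    "black_end G (right_w p) \<notin> internal_verts p" "white_end G (right_b p) \<notin> internal_verts p"
proof -
  have i: "fst (hd (dipoles p)) \<in> internal_verts p" "snd (hd (dipoles p)) \<in> internal_verts p"
    "fst (last (dipoles p)) \<in> internal_verts p" "snd (last (dipoles p)) \<in> internal_verts p"
    using prechainD(1)[OF p] by (auto simp: internal_verts_def)
  show "black_end G (left_w p) \<notin> internal_verts p" "white_end G (left_b p) \<notin> internal_verts p"
    "black_end G (right_w p) \<notin> internal_verts p" "white_end G (right_b p) \<notin> internal_verts p"
    using prechainD(7-11)[OF p] i unfolding internal_edges_def by auto
qed

lemma neighbours:
  assumes p: "proper_prechain D G p" and n: "n < length (dipoles p)"
  shows "\<exists>x\<in>C. \<tau> x (dw p n) = Lb p n" "\<exists>x\<in>C. \<tau> x (dw p n) = Rb p n"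
    "\<exists>x\<in>C. \<tau> x (db p n) = Lw p n" "\<exists>x\<in>C. \<tau> x (db p n) = Rw p n"
    "Lb p n \<noteq> Rb p n" "Lw p n \<noteq> Rw p n" "Lb p n \<noteq> db p n" "Rb p n \<noteq> db p n" "Lw p n \<noteq> dw p n" "Rw p n \<noteq> dw p n"
proof -
  have pc: "prechain D G p" and l2: "2 \<le> length (dipoles p)" using p by (auto simp: proper_prechain_def)
  have ne: "dipoles p \<noteq> []" using l2 by auto
  have edge: "\<exists>x\<in>C. \<tau> x (white_end G e) = black_end G e" "\<exists>x\<in>C. \<tau> x (black_end G e) = white_end G e"
    if "e \<in> edges G" for e
    using nbr_ends[OF cg that] colored_graphD(6)[OF cg that] by auto
  have between: "\<exists>x\<in>C. \<tau> x w = b" "\<exists>x\<in>C. \<tau> x b = w" if ebn: "edges_between G w b \<noteq> {}" for w b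
  proof -
    obtain e where "e \<in> edges G" "white_end G e = w" "black_end G e = b" using ebn by (auto simp: edges_between_def)
    then show "\<exists>x\<in>C. \<tau> x w = b" "\<exists>x\<in>C. \<tau> x b = w" using edge by blast+
  qed
  have E: "left_w p \<in> edges G" "left_b p \<in> edges G" "right_w p \<in> edges G" "right_b p \<in> edges G"
    using prechainD(7)[OF pc] by auto
  note ends = prechainD(8-11)[OF pc, unfolded hd_conv_nth[OF ne] last_conv_nth[OF ne]]
  show "\<exists>x\<in>C. \<tau> x (dw p n) = Lb p n"
  proof (cases n)
    case 0 then show ?thesis using edge(1)[OF E(1)] ends by (simp add: Lb_def)
  next
    case (Suc k) then show ?thesis using between(1)[OF prechainD(6)[OF pc, of k]] n by (simp add: Lb_def)
  qed
  show "\<exists>x\<in>C. \<tau> x (db p n) = Lw p n"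
  proof (cases n)
    case 0 then show ?thesis using edge(2)[OF E(2)] ends by (simp add: Lw_def)
  next
    case (Suc k) then show ?thesis using between(2)[OF prechainD(5)[OF pc, of k]] n by (simp add: Lw_def)
  qed
  show "\<exists>x\<in>C. \<tau> x (dw p n) = Rb p n"
  proof (cases "Suc n = length (dipoles p)")
    case True
    then have "n = length (dipoles p) - 1" by simp
    then show ?thesis using True edge(1)[OF E(3)] ends by (simp add: Rb_def)
  next
    case False then show ?thesis using between(1)[OF prechainD(5)[OF pc, of n]] n by (simp add: Rb_def)
  qed
  show "\<exists>x\<in>C. \<tau> x (db p n) = Rw p n"
  proof (cases "Suc n = length (dipoles p)")
    case True
    then have "n = length (dipoles p) - 1" by simp
    then show ?thesis using True edge(2)[OF E(4)] ends by (simp add: Rw_def)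
  next
    case False then show ?thesis using between(2)[OF prechainD(6)[OF pc, of n]] n by (simp add: Rw_def)
  qed
  note oe = external_other_end[OF pc]
  have iv: "dw p k \<in> internal_verts p" "db p k \<in> internal_verts p" if "k < length (dipoles p)" for k
    using pos[OF pc that] by auto
  have Lne: "Lb p n \<noteq> db p n" "Lw p n \<noteq> dw p n"
    using oe iv[OF n] pos_inj[OF pc, of "n - 1" n] n by (auto simp: Lb_def Lw_def)
  have Rne: "Rb p n \<noteq> db p n" "Rw p n \<noteq> dw p n"
    using oe iv[OF n] pos_inj[OF pc, of "Suc n" n] n by (auto simp: Rb_def Rw_def)
  show "Lb p n \<noteq> db p n" "Rb p n \<noteq> db p n" "Lw p n \<noteq> dw p n" "Rw p n \<noteq> dw p n" using Lne Rne by auto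
  consider "n = 0" "Suc n < length (dipoles p)" | "n > 0" "Suc n = length (dipoles p)" | "n > 0" "Suc n < length (dipoles p)"
    using n l2 by linarith
  then have "Lb p n \<noteq> Rb p n \<and> Lw p n \<noteq> Rw p n"
  proof cases
    case 1 then show ?thesis using oe iv[of "Suc n"] by (auto simp: Lb_def Rb_def Lw_def Rw_def)
  next
    case 2
    then have "n - 1 < length (dipoles p)" by simp
    from iv[OF this] 2 show ?thesis using oe by (auto simp: Lb_def Rb_def Lw_def Rw_def)
  next
    case 3 then show ?thesis using pos_inj[OF pc, of "n - 1" "Suc n"] n by (auto simp: Lb_def Rb_def Lw_def Rw_def)
  qed
  then show "Lb p n \<noteq> Rb p n" "Lw p n \<noteq> Rw p n" by auto
qed

lemma par_two:
  assumes c: "card (par C \<tau> v u) = D - 1" and xy: "x \<in> C" "y \<in> C" "\<tau> x v \<noteq> \<tau> y v" "\<tau> x v \<noteq> u" "\<tau> y v \<noteq> u"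
  shows "par C \<tau> v u = C - {x, y}" "card (par C \<tau> v z) = D - 1 \<Longrightarrow> z = u"
proof -
  have ne: "x \<noteq> y" using xy by auto
  show 1: "par C \<tau> v u = C - {x, y}"
    by (rule card_subset_eq) (use xy c card_C2[OF xy(1,2) ne] in \<open>auto simp: par_def\<close>)
  assume z: "card (par C \<tau> v z) = D - 1"
  show "z = u"
  proof (rule ccontr)
    assume "z \<noteq> u"
    then have "par C \<tau> v z \<inter> par C \<tau> v u = {}" by (auto simp: par_def)
    then have s: "par C \<tau> v z \<subseteq> {x, y}" using 1 by (auto simp: par_def)
    have "\<not> (x \<in> par C \<tau> v z \<and> y \<in> par C \<tau> v z)" using xy(3) by (auto simp: par_def)
    then have "par C \<tau> v z \<subseteq> {x} \<or> par C \<tau> v z \<subseteq> {y}" using s by auto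
    then have "card (par C \<tau> v z) \<le> 1" by (metis card_mono finite.emptyI finite_insert card.empty card_insert_if empty_iff One_nat_def)
    then show False using z D by simp
  qed
qed

lemma par_sym: "w \<in> V \<Longrightarrow> b \<in> V \<Longrightarrow> par C \<tau> w b = par C \<tau> b w"
  using matchings_eqD(2)[OF matching, of _ w b] by (auto simp: par_def)

lemma posw:
  assumes p: "proper_prechain D G p" and n: "n < length (dipoles p)"
  obtains x y where "x \<in> C" "y \<in> C" "\<tau> x (dw p n) = Lb p n" "\<tau> y (dw p n) = Rb p n"
    "par C \<tau> (dw p n) (db p n) = C - {x, y}"
proof -
  have pc: "prechain D G p" using p by (simp add: proper_prechain_def)
  note nb = neighbours[OF p n]
  obtain x y where xy: "x \<in> C" "\<tau> x (dw p n) = Lb p n" "y \<in> C" "\<tau> y (dw p n) = Rb p n" using nb(1,2) by blast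
  have "par C \<tau> (dw p n) (db p n) = C - {x, y}"
    by (rule par_two(1)) (use xy nb pos[OF pc n] whites_blacks in auto)
  then show thesis using that xy by blast
qed

lemma posb:
  assumes p: "proper_prechain D G p" and n: "n < length (dipoles p)"
  obtains x y where "x \<in> C" "y \<in> C" "\<tau> x (db p n) = Lw p n" "\<tau> y (db p n) = Rw p n"
    "par C \<tau> (dw p n) (db p n) = C - {x, y}"
proof -
  have pc: "prechain D G p" using p by (simp add: proper_prechain_def)
  note nb = neighbours[OF p n] and ps = pos[OF pc n]
  have v: "dw p n \<in> V" "db p n \<in> V" using ps whites_blacks by auto
  obtain x y where xy: "x \<in> C" "\<tau> x (db p n) = Lw p n" "y \<in> C" "\<tau> y (db p n) = Rw p n" using nb(3,4) by blast
  have c: "card (par C \<tau> (db p n) (dw p n)) = D - 1" using ps(6) par_sym[OF v] by simp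
  have "par C \<tau> (db p n) (dw p n) = C - {x, y}"
    by (rule par_two(1)[OF c xy(1,3)]) (use xy nb(6,9,10) in simp_all)
  then show thesis using that[OF xy(1,3,2,4)] par_sym[OF v] by simp
qed

lemma uniq_w:
  assumes p: "proper_prechain D G p" and n: "n < length (dipoles p)" and d: "dipole D G (dw p n) b"
  shows "b = db p n"
proof -
  have pc: "prechain D G p" using p by (simp add: proper_prechain_def)
  note nb = neighbours[OF p n]
  obtain x y where xy: "x \<in> C" "\<tau> x (dw p n) = Lb p n" "y \<in> C" "\<tau> y (dw p n) = Rb p n" using nb(1,2) by blast
  show ?thesis by (rule par_two(2)[of "dw p n" "db p n" x y])
    (use xy nb pos[OF pc n] whites_blacks d dipole_iff in auto)
qed

lemma uniq_b:
  assumes p: "proper_prechain D G p" and n: "n < length (dipoles p)" and d: "dipole D G w (db p n)"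
  shows "w = dw p n"
proof -
  have pc: "prechain D G p" using p by (simp add: proper_prechain_def)
  note nb = neighbours[OF p n] and ps = pos[OF pc n]
  have v: "dw p n \<in> V" "db p n \<in> V" "w \<in> V" using ps d whites_blacks by (auto simp: dipole_def)
  obtain x y where xy: "x \<in> C" "\<tau> x (db p n) = Lw p n" "y \<in> C" "\<tau> y (db p n) = Rw p n" using nb(3,4) by blast
  have c: "card (par C \<tau> (db p n) (dw p n)) = D - 1" using ps(6) par_sym[OF v(1,2)] by simp
  have "card (par C \<tau> (db p n) w) = D - 1" using d dipole_iff par_sym[OF v(3,2)] by simp
  then show ?thesis by (rule par_two(2)[OF c xy(1,3), rotated 3]) (use xy nb(6,9,10) in simp_all)
qed

text \<open>So proper pre-chains overlap only in whole dipoles, even for \<open>D = 3\<close>, where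
  in general a vertex can lie in two dipoles.\<close>

lemma dipole_in:
  assumes p: "proper_prechain D G p" and d: "dipole D G w b" and v: "w \<in> internal_verts p \<or> b \<in> internal_verts p"
  shows "(w, b) \<in> set (dipoles p)"
proof -
  have pc: "prechain D G p" using p by (simp add: proper_prechain_def)
  have wb: "w \<in> whites G" "b \<in> blacks G" using d by (auto simp: dipole_def)
  obtain n where n: "n < length (dipoles p)" "w = dw p n" "b = db p n"
  proof (cases "w \<in> internal_verts p")
    case True
    then obtain n where "n < length (dipoles p)" "w = dw p n" using internal_white[OF pc _ wb(1)] by metis
    then show thesis using uniq_w[OF p] d that by blast
  next
    case False
    then have "b \<in> internal_verts p" using v by simp
    then obtain n where "n < length (dipoles p)" "b = db p n" using internal_black[OF pc _ wb(2)] by metis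
    then show thesis using uniq_b[OF p] d that by blast
  qed
  then have "(w, b) = dipoles p ! n" by simp
  then show ?thesis using n(1) by simp
qed

definition chL where "chL p n \<longleftrightarrow> (\<exists>x\<in>C. \<tau> x (dw p n) = Lb p n \<and> \<tau> x (db p n) = Lw p n)"
definition chR where "chR p n \<longleftrightarrow> (\<exists>x\<in>C. \<tau> x (dw p n) = Rb p n \<and> \<tau> x (db p n) = Rw p n)"

text \<open>The same two colors leave a dipole at both of its vertices. So if the left edges agree
  in color, the right ones do, and conversely. Together with \<open>chR_chL_Suc\<close> this carries
  \<open>is_chain\<close>, which looks only at the left end, along the whole pre-chain.\<close>

lemma chL_chR:
  assumes p: "proper_prechain D G p" and n: "n < length (dipoles p)"
  shows "chL p n \<longleftrightarrow> chR p n"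
proof -
  have pc: "prechain D G p" using p by (simp add: proper_prechain_def)
  note nb = neighbours[OF p n] and ps = pos[OF pc n]
  obtain x y where xy: "x \<in> C" "y \<in> C" "\<tau> x (dw p n) = Lb p n" "\<tau> y (dw p n) = Rb p n"
    "par C \<tau> (dw p n) (db p n) = C - {x, y}" using posw[OF p n] by metis
  obtain x' y' where xy': "x' \<in> C" "y' \<in> C" "\<tau> x' (db p n) = Lw p n" "\<tau> y' (db p n) = Rw p n"
    "par C \<tau> (dw p n) (db p n) = C - {x', y'}" using posb[OF p n] by metis
  have v: "dw p n \<in> V" "db p n \<in> V" using ps whites_blacks by auto
  have eq: "{x, y} = {x', y'}" using xy(1,2,5) xy'(1,2,5) by blast
  have w: "c = x \<or> c = y" if "c \<in> C" "\<tau> c (dw p n) \<noteq> db p n" for c using that xy(5) by (auto simp: par_def)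
  have b: "c = x' \<or> c = y'" if "c \<in> C" "\<tau> c (db p n) \<noteq> dw p n" for c
    using that xy'(5) par_sym[OF v] by (auto simp: par_def)
  have "x \<noteq> y" using xy(3,4) nb(5) by metis
  moreover have "x' \<noteq> y'" using xy'(3,4) nb(6) by metis
  ultimately have ne: "x \<noteq> y" "x' \<noteq> y'" by blast+
  have "chL p n \<longleftrightarrow> x = x'"
  proof
    assume "chL p n"
    then obtain c where c: "c \<in> C" "\<tau> c (dw p n) = Lb p n" "\<tau> c (db p n) = Lw p n" by (auto simp: chL_def)
    have "c = x" using w[OF c(1)] c(2) xy(4) nb(5,7) by metis
    moreover have "c = x'" using b[OF c(1)] c(3) xy'(4) nb(6,9) by metis
    ultimately show "x = x'" by simp
  qed (use xy xy' in \<open>auto simp: chL_def\<close>)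
  moreover have "chR p n \<longleftrightarrow> y = y'"
  proof
    assume "chR p n"
    then obtain c where c: "c \<in> C" "\<tau> c (dw p n) = Rb p n" "\<tau> c (db p n) = Rw p n" by (auto simp: chR_def)
    have "c = y" using w[OF c(1)] c(2) xy(3) nb(5,8) by metis
    moreover have "c = y'" using b[OF c(1)] c(3) xy'(3) nb(6,10) by metis
    ultimately show "y = y'" by simp
  qed (use xy xy' in \<open>auto simp: chR_def\<close>)
  moreover have "x = x' \<longleftrightarrow> y = y'" using eq ne by (auto simp: doubleton_eq_iff)
  ultimately show ?thesis by simp
qed

lemma chR_chL_Suc:
  assumes p: "proper_prechain D G p" and n: "Suc n < length (dipoles p)"
  shows "chR p n \<longleftrightarrow> chL p (Suc n)"
proof -
  have pc: "prechain D G p" using p by (simp add: proper_prechain_def)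
  have n': "n < length (dipoles p)" using n by simp
  have v: "dw p n \<in> V" "db p n \<in> V" "dw p (Suc n) \<in> V" "db p (Suc n) \<in> V"
    using pos[OF pc n] pos[OF pc n'] whites_blacks by auto
  have "(\<tau> c (dw p n) = db p (Suc n) \<and> \<tau> c (db p n) = dw p (Suc n)) \<longleftrightarrow>
      (\<tau> c (dw p (Suc n)) = db p n \<and> \<tau> c (db p (Suc n)) = dw p n)" if "c \<in> C" for c
    using matchings_eqD(2)[OF matching that v(1,4)] matchings_eqD(2)[OF matching that v(2,3)] by blast
  then show ?thesis using n by (auto simp: chR_def chL_def Rb_def Rw_def Lb_def Lw_def)
qed

lemma chL_0:
  assumes p: "proper_prechain D G p"
  shows "chL p 0 \<longleftrightarrow> is_chain G p"
proof -
  have pc: "prechain D G p" and l: "0 < length (dipoles p)" and ne: "dipoles p \<noteq> []"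
    using p by (auto simp: proper_prechain_def)
  note nb = neighbours[OF p l] and ps = pos[OF pc l] and hd = hd_conv_nth[OF ne]
  have E: "left_w p \<in> edges G" "left_b p \<in> edges G" using prechainD(7)[OF pc] by auto
  let ?a = "color G (left_w p)" and ?b = "color G (left_b p)"
  have a: "?a \<in> C" "\<tau> ?a (dw p 0) = Lb p 0" using nbr_ends(1)[OF cg E(1)] colored_graphD(6)[OF cg E(1)] prechainD(8)[OF pc] hd
    by (auto simp: Lb_def)
  have b: "?b \<in> C" "\<tau> ?b (db p 0) = Lw p 0" using nbr_ends(2)[OF cg E(2)] colored_graphD(6)[OF cg E(2)] prechainD(9)[OF pc] hd
    by (auto simp: Lw_def)
  show ?thesis
  proof
    assume "chL p 0"
    then obtain c where c: "c \<in> C" "\<tau> c (dw p 0) = Lb p 0" "\<tau> c (db p 0) = Lw p 0" by (auto simp: chL_def)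
    obtain x y where xy: "x \<in> C" "y \<in> C" "\<tau> x (dw p 0) = Lb p 0" "\<tau> y (dw p 0) = Rb p 0"
      "par C \<tau> (dw p 0) (db p 0) = C - {x, y}" using posw[OF p l] by metis
    obtain x' y' where xy': "x' \<in> C" "y' \<in> C" "\<tau> x' (db p 0) = Lw p 0" "\<tau> y' (db p 0) = Rw p 0"
      "par C \<tau> (dw p 0) (db p 0) = C - {x', y'}" using posb[OF p l] by metis
    have v: "dw p 0 \<in> V" "db p 0 \<in> V" using ps whites_blacks by auto
    have w: "d = x" if "d \<in> C" "\<tau> d (dw p 0) = Lb p 0" for d
    proof -
      have "d \<notin> par C \<tau> (dw p 0) (db p 0)" using that nb(7) by (auto simp: par_def)
      then have "d = x \<or> d = y" using that(1) xy(5) by auto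
      then show ?thesis using that(2) xy(4) nb(5) by metis
    qed
    have b': "d = x'" if "d \<in> C" "\<tau> d (db p 0) = Lw p 0" for d
    proof -
      have "d \<notin> par C \<tau> (dw p 0) (db p 0)" using that nb(9) par_sym[OF v] by (auto simp: par_def)
      then have "d = x' \<or> d = y'" using that(1) xy'(5) by auto
      then show ?thesis using that(2) xy'(4) nb(6) by metis
    qed
    have "?a = c" "?b = c" using w[OF a] w[OF c(1,2)] b'[OF b] b'[OF c(1,3)] by auto
    then show "is_chain G p" by (simp add: is_chain_def)
  qed (use a b in \<open>auto simp: is_chain_def chL_def\<close>)
qed

lemma ch_all:
  assumes p: "proper_prechain D G p" and n: "n < length (dipoles p)"
  shows "chL p n \<longleftrightarrow> is_chain G p" "chR p n \<longleftrightarrow> is_chain G p"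
proof -
  show 1: "chL p n \<longleftrightarrow> is_chain G p"
    using n
  proof (induction n)
    case 0 then show ?case using chL_0[OF p] by simp
  next
    case (Suc n)
    then show ?case using chR_chL_Suc[OF p Suc.prems] chL_chR[OF p, of n] by simp
  qed
  then show "chR p n \<longleftrightarrow> is_chain G p" using chL_chR[OF p n] by simp
qed

lemma internal_unmarked:
  assumes p: "prechain D G p" and v: "v \<in> internal_verts p" "v \<in> V" and c: "c \<in> C" and t: "\<tau> c v \<in> internal_verts p"
  shows "(v, c) \<notin> R"
proof
  assume "(v, c) \<in> R"
  then have "ed G c v = e0" using R_iff v(2) c by simp
  have e: "ed G c v \<in> edges G" using ed(1)[OF cg v(2)] c by simp
  have "white_end G (ed G c v) = v \<or> black_end G (ed G c v) = v" using ed(3)[OF cg v(2), of c] c by simp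
  then have "white_end G (ed G c v) \<in> internal_verts p \<and> black_end G (ed G c v) \<in> internal_verts p"
    using v(1) t by (auto simp: nbr_def split: if_splits)
  then show False using prechainD(13)[OF p] e \<open>ed G c v = e0\<close> by (simp add: internal_edges_def)
qed

section \<open>Inner dipoles and the extension of pre-chains\<close>

lemma interior_biflank:
  assumes p: "proper_prechain D G p" and ch: "is_chain G p" and n: "0 < n" "Suc n < length (dipoles p)"
  shows "\<exists>i j. biflank i j (dw p n) (db p n) \<and>
    \<tau> i (dw p n) = db p (n - 1) \<and> \<tau> i (db p n) = dw p (n - 1) \<and>
    \<tau> j (dw p n) = db p (Suc n) \<and> \<tau> j (db p n) = dw p (Suc n)"
proof -
  have pc: "prechain D G p" using p by (simp add: proper_prechain_def)
  have n': "n < length (dipoles p)" "n - 1 < length (dipoles p)" using n by auto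
  note nb = neighbours[OF p n'(1)] and ps = pos[OF pc n'(1)] and psl = pos[OF pc n'(2)] and psr = pos[OF pc n(2)]
  have L: "Lb p n = db p (n - 1)" "Lw p n = dw p (n - 1)" "Rb p n = db p (Suc n)" "Rw p n = dw p (Suc n)"
    using n by (auto simp: Lb_def Lw_def Rb_def Rw_def)
  obtain i where i: "i \<in> C" "\<tau> i (dw p n) = Lb p n" "\<tau> i (db p n) = Lw p n"
    using ch_all(1)[OF p n'(1)] ch by (auto simp: chL_def)
  obtain j where j: "j \<in> C" "\<tau> j (dw p n) = Rb p n" "\<tau> j (db p n) = Rw p n"
    using ch_all(2)[OF p n'(1)] ch by (auto simp: chR_def)
  have v: "dw p n \<in> V" "db p n \<in> V" using ps whites_blacks by auto
  have par: "par C \<tau> (dw p n) (db p n) = C - {i, j}"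
    by (rule par_two(1)) (use i j nb ps v in auto)
  have "\<tau> c (dw p n) \<in> internal_verts p \<and> \<tau> c (db p n) \<in> internal_verts p" if c: "c \<in> C" for c
  proof (cases "c = i \<or> c = j")
    case True then show ?thesis using i j L psl psr by auto
  next
    case False
    then have "c \<in> par C \<tau> (dw p n) (db p n)" using par c by simp
    then have "\<tau> c (dw p n) = db p n" "\<tau> c (db p n) = dw p n" using par_sym[OF v] by (auto simp: par_def)
    then show ?thesis using ps by simp
  qed
  then have nm: "\<forall>c\<in>C. (dw p n, c) \<notin> R \<and> (db p n, c) \<notin> R"
    using internal_unmarked[OF pc] ps v by blast
  have t: "\<tau> i (dw p n) \<noteq> \<tau> j (dw p n)" "\<tau> i (db p n) \<noteq> \<tau> j (db p n)" using i j nb(5,6) by simp_all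
  then have ij: "i \<noteq> j" by blast
  have d: "dipole D G (\<tau> i (db p n)) (\<tau> i (dw p n))" "dipole D G (\<tau> j (db p n)) (\<tau> j (dw p n))"
    using i j L psl(1) psr(1) by simp_all
  have "biflank i j (dw p n) (db p n)"
    unfolding biflank_def using i(1) j(1) ps(2,3) ij par nm t d by blast
  then show ?thesis using i j L by auto
qed

text \<open>The conditions on the other neighbour and on the left edges keep the four external edges
  of the longer pre-chain external and distinct. The root edge does not become internal because
  \<open>biflank\<close> excludes marks at \<open>wa\<close> and \<open>ba\<close>.\<close>

lemma extend_right:
  assumes q: "proper_prechain D G q" and f: "biflank i j wa ba"
    and e: "last (dipoles q) = (\<tau> i ba, \<tau> i wa)"
    and out: "wa \<notin> internal_verts q" "ba \<notin> internal_verts q" "\<tau> j wa \<notin> internal_verts q" "\<tau> j ba \<notin> internal_verts q"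
    and lft: "black_end G (left_w q) \<noteq> ba" "white_end G (left_b q) \<noteq> wa"
  shows "\<exists>q'. proper_prechain D G q' \<and> set (dipoles q') = insert (wa, ba) (set (dipoles q))"
proof -
  have pc: "prechain D G q" and l2: "2 \<le> length (dipoles q)" using q by (auto simp: proper_prechain_def)
  note F = biflankD[OF f]
  have jD: "j \<le> D" "i \<le> D" using F(3,4) by auto
  have fV: "wa \<in> V" "ba \<in> V" using F whites_blacks by auto
  define q' where "q' = \<lparr>dipoles = dipoles q @ [(wa, ba)], left_w = left_w q, left_b = left_b q,
    right_w = ed G j wa, right_b = ed G j ba\<rparr>"
  let ?ds = "dipoles q"
  have s: "dipoles q' = ?ds @ [(wa, ba)]" "left_w q' = left_w q" "left_b q' = left_b q"
    "right_w q' = ed G j wa" "right_b q' = ed G j ba" by (auto simp: q'_def)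
  have iv: "internal_verts q' = insert wa (insert ba (internal_verts q))" by (auto simp: internal_verts_def s)
  have ne: "?ds \<noteq> []" using l2 by auto
  note nw = white_edge[OF _ F(1)] and nb = black_edge[OF _ F(2)]
  have dist: "distinct (map fst (dipoles q'))" "distinct (map snd (dipoles q'))"
    using prechainD(2,3)[OF pc] out by (auto simp: s internal_verts_def)
  have dip: "dipole D G w b" if "(w, b) \<in> set (dipoles q')" for w b
    using that prechainD(4)[OF pc] biflank_dipole[OF f] by (auto simp: s)
  have adj: "edges_between G (fst (dipoles q' ! k)) (snd (dipoles q' ! Suc k)) \<noteq> {} \<and>
      edges_between G (fst (dipoles q' ! Suc k)) (snd (dipoles q' ! k)) \<noteq> {}" if k: "Suc k < length (dipoles q')" for k
  proof (cases "Suc k < length ?ds")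
    case True
    then show ?thesis using prechainD(5,6)[OF pc True] by (simp add: s nth_append)
  next
    case False
    then have kl: "Suc k = length ?ds" using k by (simp add: s)
    then have "k = length ?ds - 1" by simp
    then have "dipoles q' ! k = last ?ds" using ne by (simp add: s nth_append last_conv_nth)
    moreover have "dipoles q' ! Suc k = (wa, ba)" using kl by (simp add: s nth_append)
    moreover have "ed G i ba \<in> edges_between G (\<tau> i ba) ba" "ed G i wa \<in> edges_between G wa (\<tau> i wa)"
      using nw[OF jD(2)] nb[OF jD(2)] by (auto simp: edges_between_def)
    ultimately show ?thesis using e by auto
  qed
  have ie: "internal_edges G q' \<subseteq> internal_edges G q \<union> {x \<in> edges G. white_end G x = wa \<or> black_end G x = ba}"
  proof
    fix x assume x: "x \<in> internal_edges G q'"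
    then have xe: "x \<in> edges G" "white_end G x \<in> internal_verts q'" "black_end G x \<in> internal_verts q'"
      by (auto simp: internal_edges_def)
    have "white_end G x \<noteq> ba" "black_end G x \<noteq> wa"
      using colored_graphD(4,5)[OF cg xe(1)] F(1,2) whites_blacks(3) by auto
    then show "x \<in> internal_edges G q \<union> {x \<in> edges G. white_end G x = wa \<or> black_end G x = ba}"
      using xe iv by (auto simp: internal_edges_def)
  qed
  have e0n: "white_end G e0 \<noteq> wa" "black_end G e0 \<noteq> ba"
    using F(12,13)[of "color G e0"] colored_graphD(6)[OF cg e0] by (auto simp: R_def)
  have root: "root G \<notin> Some ` internal_edges G q'" using ie prechainD(13)[OF pc] e0n rt by auto
  have "hd ?ds \<noteq> last ?ds"
  proof -
    have "0 < length ?ds" "length ?ds - 1 < length ?ds" "0 \<noteq> length ?ds - 1" using l2 by auto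
    then have "?ds ! 0 \<noteq> ?ds ! (length ?ds - 1)" using pos_inj(1)[OF pc, of 0 "length ?ds - 1"] by metis
    then show ?thesis using ne by (simp add: hd_conv_nth last_conv_nth)
  qed
  have lE: "left_w q \<in> edges G" "left_b q \<in> edges G" using prechainD(7)[OF pc] by auto
  have lwh: "white_end G (left_w q) \<in> internal_verts q" "black_end G (left_b q) \<in> internal_verts q"
    using prechainD(8,9)[OF pc] ne by (auto simp: internal_verts_def)
  have "black_end G (left_w q) \<noteq> wa" "white_end G (left_b q) \<noteq> ba"
    using colored_graphD(4,5)[OF cg] lE F(1,2) whites_blacks(3) by metis+
  then have l1: "left_w q \<notin> internal_edges G q'" "left_b q \<notin> internal_edges G q'"
    using external_other_end(1,2)[OF pc] lft by (auto simp: internal_edges_def iv)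
  have "\<tau> j wa \<noteq> wa" "\<tau> j ba \<noteq> ba" using matchingsD(4)[OF matching F(4)] fV by auto
  then have r1: "ed G j wa \<notin> internal_edges G q'" "ed G j ba \<notin> internal_edges G q'"
    using nw(1)[OF jD(1)] nb(1)[OF jD(1)] out F(9,11) by (auto simp: internal_edges_def iv)
  have d4: "distinct [left_w q, left_b q, ed G j wa, ed G j ba]"
  proof -
    have "left_w q \<noteq> left_b q" using prechainD(12)[OF pc] by simp
    moreover have "left_w q \<noteq> ed G j wa" "left_b q \<noteq> ed G j ba" "left_w q \<noteq> ed G j ba" "left_b q \<noteq> ed G j wa"
      using lwh out nw[OF jD(1)] nb[OF jD(1)] lft by auto
    moreover have "ed G j wa \<noteq> ed G j ba" using nw(1)[OF jD(1)] nb(2)[OF jD(1)] F(9) by auto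
    ultimately show ?thesis by simp
  qed
  have "prechain D G q'"
    unfolding prechain_def Let_def
  proof (intro conjI)
    show "\<forall>(w, b)\<in>set (dipoles q'). dipole D G w b" using dip by blast
    show "\<forall>i. Suc i < length (dipoles q') \<longrightarrow> edges_between G (fst (dipoles q' ! i)) (snd (dipoles q' ! Suc i)) \<noteq> {} \<and>
         edges_between G (fst (dipoles q' ! Suc i)) (snd (dipoles q' ! i)) \<noteq> {}" using adj by blast
    show "{left_w q', left_b q', right_w q', right_b q'} \<subseteq> edges G - internal_edges G q'"
      using l1 r1 lE nw(3)[OF jD(1)] nb(3)[OF jD(1)] by (simp add: s)
    show "white_end G (left_w q') = fst (hd (dipoles q'))" "black_end G (left_b q') = snd (hd (dipoles q'))"
      using prechainD(8,9)[OF pc] ne by (simp_all add: s)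
    show "white_end G (right_w q') = fst (last (dipoles q'))" "black_end G (right_b q') = snd (last (dipoles q'))"
      using nw(2)[OF jD(1)] nb(2)[OF jD(1)] by (simp_all add: s)
    show "distinct [left_w q', left_b q', right_w q', right_b q']" using d4 by (simp add: s)
  qed (use dist root in \<open>simp_all add: s\<close>)
  then have "proper_prechain D G q'" using l2 by (simp add: proper_prechain_def s)
  then show ?thesis using s(1) by auto
qed

text \<open>
  The dipole could be appended to \<open>q\<close>, unless its other neighbour lies in \<open>q\<close> as well. But then the
  dipole closes \<open>q\<close> up to the whole graph, and there is no place left for the root.
\<close>

lemma no_dipole_beside_last:
  assumes q: "maximal_proper_prechain D G q" and f: "biflank i j wa ba" and nin: "(wa, ba) \<notin> set (dipoles q)"
    and e: "last (dipoles q) = (\<tau> i ba, \<tau> i wa)"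
  shows False
proof -
  have pq: "proper_prechain D G q" using q by (simp add: maximal_proper_prechain_def)
  then have pc: "prechain D G q" and l2: "2 \<le> length (dipoles q)" by (auto simp: proper_prechain_def)
  have ne: "dipoles q \<noteq> []" using l2 by auto
  let ?n = "length (dipoles q) - 1"
  have nl: "?n < length (dipoles q)" "0 < length (dipoles q)" "?n \<noteq> 0" using l2 by auto
  note F = biflankD[OF f]
  have fV: "wa \<in> V" "ba \<in> V" using F whites_blacks by auto
  have out: "wa \<notin> internal_verts q" "ba \<notin> internal_verts q"
    using dipole_in[OF pq biflank_dipole[OF f]] nin by auto
  have ends: "dw q ?n = \<tau> i ba" "db q ?n = \<tau> i wa" using e ne by (auto simp: last_conv_nth)
  have hd0: "hd (dipoles q) = dipoles q ! 0" "last (dipoles q) = dipoles q ! ?n" using ne by (auto simp: hd_conv_nth last_conv_nth)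
  have hl: "dw q 0 \<noteq> \<tau> i ba" "db q 0 \<noteq> \<tau> i wa" using pos_inj[OF pc nl(2,1)] ends nl(3) by auto
  have lE: "left_w q \<in> edges G" "left_b q \<in> edges G" using prechainD(7)[OF pc] by auto
  have lends: "white_end G (left_w q) = dw q 0" "black_end G (left_b q) = db q 0"
    "white_end G (right_w q) = dw q ?n" "black_end G (right_b q) = db q ?n"
    using prechainD(8-11)[OF pc] hd0 by auto
  have p0: "dw q 0 \<in> internal_verts q" "db q 0 \<in> internal_verts q" using pos[OF pc nl(2)] by auto
  have inv: "\<tau> c (\<tau> c x) = x" if "c \<in> C" "x \<in> V" for c x using matchingsD(5)[OF matching that] .
  have gdef: "(\<tau> j ba, \<tau> j wa) \<notin> set (dipoles q)"
  proof
    assume g: "(\<tau> j ba, \<tau> j wa) \<in> set (dipoles q)"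
    have gi: "\<tau> j ba \<in> internal_verts q" "\<tau> j wa \<in> internal_verts q"
      using g by (force simp: internal_verts_def)+
    have ei: "\<tau> i ba \<in> internal_verts q" "\<tau> i wa \<in> internal_verts q"
      using pos(4,5)[OF pc nl(1)] ends by auto
    have wh: "\<tau> i ba \<in> whites G" "\<tau> j ba \<in> whites G" "\<tau> i wa \<in> blacks G" "\<tau> j wa \<in> blacks G"
      using F(14,15) by (auto simp: dipole_def)
    have W: "ed G c (\<tau> c ba) = left_w q \<or> ed G c (\<tau> c ba) = right_w q" "white_end G (ed G c (\<tau> c ba)) = \<tau> c ba"
      "black_end G (ed G c (\<tau> c ba)) = ba"
      if c: "c = i \<or> c = j" for c
    proof -
      have cC: "c \<in> C" "c \<le> D" and w: "\<tau> c ba \<in> whites G" "\<tau> c ba \<in> internal_verts q" using c F(3,4) wh gi ei by auto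
      show en: "white_end G (ed G c (\<tau> c ba)) = \<tau> c ba" "black_end G (ed G c (\<tau> c ba)) = ba"
        using nbr_white(1,2)[OF cg w(1) cC(2)] inv[OF cC(1) fV(2)] by auto
      have "ed G c (\<tau> c ba) \<in> edges G" using ed(1)[OF cg whites_blacks(1)[OF w(1)] cC(2)] .
      moreover have "ed G c (\<tau> c ba) \<notin> internal_edges G q" using en out by (simp add: internal_edges_def)
      ultimately show "ed G c (\<tau> c ba) = left_w q \<or> ed G c (\<tau> c ba) = right_w q"
        using external_w[OF cg pc, of "ed G c (\<tau> c ba)"] en w D by simp
    qed
    have B: "ed G c (\<tau> c wa) = left_b q \<or> ed G c (\<tau> c wa) = right_b q" "black_end G (ed G c (\<tau> c wa)) = \<tau> c wa"
      "white_end G (ed G c (\<tau> c wa)) = wa"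
      if c: "c = i \<or> c = j" for c
    proof -
      have cC: "c \<in> C" "c \<le> D" and w: "\<tau> c wa \<in> blacks G" "\<tau> c wa \<in> internal_verts q" using c F(3,4) wh gi ei by auto
      show en: "black_end G (ed G c (\<tau> c wa)) = \<tau> c wa" "white_end G (ed G c (\<tau> c wa)) = wa"
        using nbr_black(1,2)[OF cg w(1) cC(2)] inv[OF cC(1) fV(1)] by auto
      have "ed G c (\<tau> c wa) \<in> edges G" using ed(1)[OF cg whites_blacks(2)[OF w(1)] cC(2)] .
      moreover have "ed G c (\<tau> c wa) \<notin> internal_edges G q" using en out by (simp add: internal_edges_def)
      ultimately show "ed G c (\<tau> c wa) = left_b q \<or> ed G c (\<tau> c wa) = right_b q"
        using external_b[OF cg pc, of "ed G c (\<tau> c wa)"] en w D by simp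
    qed
    \<comment> \<open>The neighbour over \<open>i\<close> is the last dipole and not the first, so
      its edges to \<open>wa\<close> and \<open>ba\<close> are the right external ones. The
      neighbour over \<open>j\<close> is a different dipole, so its edges are the left ones.\<close>
    have rw: "black_end G (right_w q) = ba" "white_end G (right_b q) = wa"
      using W[of i] B[of i] lends hl by metis+
    have lw: "black_end G (left_w q) = ba" "white_end G (left_b q) = wa"
      using W[of j] B[of j] lends ends F(16,17) by metis+
    let ?S = "insert wa (insert ba (internal_verts q))"
    have clS: "\<tau> c x \<in> ?S" if x: "x \<in> ?S" "x \<in> V" and c: "c \<in> C" for x c
    proof (cases "x \<in> internal_verts q")
      case True
      have cD: "c \<le> D" using c by simp
      let ?e = "ed G c x"
      have eE: "?e \<in> edges G" using ed(1)[OF cg x(2) cD] .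
      show ?thesis
      proof (cases "x \<in> whites G")
        case w: True
        note en = nbr_white(1,2)[OF cg w cD]
        show ?thesis
        proof (cases "?e \<in> internal_edges G q")
          case True then show ?thesis using en by (auto simp: internal_edges_def)
        next
          case False
          then have "?e = left_w q \<or> ?e = right_w q" using external_w[OF cg pc _ eE _ False] en True D by simp
          then show ?thesis using en lw rw by auto
        qed
      next
        case False
        then have bx: "x \<in> blacks G" using x(2) by (simp add: verts_def)
        note en = nbr_black(1,2)[OF cg bx cD]
        show ?thesis
        proof (cases "?e \<in> internal_edges G q")
          case True then show ?thesis using en by (auto simp: internal_edges_def)
        next
          case False
          then have "?e = left_b q \<or> ?e = right_b q" using external_b[OF cg pc _ eE _ False] en True D by simp
          then show ?thesis using en lw rw by auto
        qed
      qed
    next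
      case False
      then have "x = wa \<or> x = ba" using x by auto
      then show ?thesis using F(6,7)[OF c] gi ei by (cases "c = i"; cases "c = j") auto
    qed
    have "cl C \<tau> wa \<subseteq> ?S \<inter> V"
      by (rule cl_least) (use clS matchingsD(3)[OF matching] fV in auto)
    then have VS: "V \<subseteq> ?S" using con fV by (auto simp: conn_def)
    have e0V: "white_end G e0 \<in> V" "black_end G e0 \<in> V"
      using colored_graphD(4,5)[OF cg e0] by (auto simp: verts_def)
    have "white_end G e0 \<noteq> wa" "black_end G e0 \<noteq> ba"
      using F(12,13)[of "color G e0"] colored_graphD(6)[OF cg e0] by (auto simp: R_def)
    moreover have "white_end G e0 \<noteq> ba" "black_end G e0 \<noteq> wa"
      using colored_graphD(4,5)[OF cg e0] F(1,2) whites_blacks(3) by auto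
    ultimately have "e0 \<in> internal_edges G q" using VS e0V e0 by (auto simp: internal_edges_def)
    then show False using prechainD(13)[OF pc] by simp
  qed
  have gout: "\<tau> j ba \<notin> internal_verts q" "\<tau> j wa \<notin> internal_verts q"
    using dipole_in[OF pq F(15)] gdef by auto
  \<comment> \<open>Such an edge would join \<open>ba\<close> to the first dipole of
    \<open>q\<close>. But color \<open>i\<close> leads from \<open>ba\<close> to the last dipole,
    color \<open>j\<close> out of \<open>q\<close>, and every other color to
    \<open>wa\<close>.\<close>
  have "black_end G (left_w q) \<noteq> ba"
  proof
    assume b: "black_end G (left_w q) = ba"
    let ?c = "color G (left_w q)"
    have c: "?c \<in> C" "\<tau> ?c ba = dw q 0" using nbr_ends(2)[OF cg lE(1)] colored_graphD(6)[OF cg lE(1)] b lends by auto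
    then show False using F(7)[OF c(1)] hl gout out p0 by (cases "?c = i"; cases "?c = j") auto
  qed
  moreover have "white_end G (left_b q) \<noteq> wa"
  proof
    assume b: "white_end G (left_b q) = wa"
    let ?c = "color G (left_b q)"
    have c: "?c \<in> C" "\<tau> ?c wa = db q 0" using nbr_ends(1)[OF cg lE(2)] colored_graphD(6)[OF cg lE(2)] b lends by auto
    then show False using F(6)[OF c(1)] hl gout out p0 by (cases "?c = i"; cases "?c = j") auto
  qed
  ultimately obtain q' where q': "proper_prechain D G q'" "set (dipoles q') = insert (wa, ba) (set (dipoles q))"
    using extend_right[OF pq f e out gout(2,1)] by blast
  have "set (dipoles q) \<subset> set (dipoles q')" using q'(2) nin by auto
  then show False using q q'(1) by (auto simp: maximal_proper_prechain_def)
qed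

lemma maximal_rev: "maximal_proper_prechain D G q \<Longrightarrow> maximal_proper_prechain D G (rev_pc q)"
  by (auto simp: maximal_proper_prechain_def proper_prechain_def prechain_rev)

text \<open>The edges from the dipole into \<open>q\<close> are external edges of \<open>q\<close>,
  so they meet its first or its last dipole. Reversing \<open>q\<close> reduces the first case to
  \<open>no_dipole_beside_last\<close>.\<close>

lemma no_dipole_beside:
  assumes q: "maximal_proper_prechain D G q" and f: "biflank i j wa ba" and nin: "(wa, ba) \<notin> set (dipoles q)"
    and e: "(\<tau> x ba, \<tau> x wa) \<in> set (dipoles q)" "x \<in> {i, j}"
  shows False
proof -
  obtain y where fx: "biflank x y wa ba"
  proof (cases "x = i")
    case False
    then have "x = j" using e(2) by simp
    then show thesis using that[of i] biflank_sym[OF f] by simp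
  qed (use f that in blast)
  have pq: "proper_prechain D G q" using q by (simp add: maximal_proper_prechain_def)
  then have pc: "prechain D G q" and ne: "dipoles q \<noteq> []" by (auto simp: proper_prechain_def prechain_def Let_def)
  note F = biflankD[OF fx]
  have fV: "ba \<in> V" using F whites_blacks by auto
  have out: "ba \<notin> internal_verts q" using dipole_in[OF pq biflank_dipole[OF f]] nin by auto
  have xD: "x \<le> D" using F(3) by simp
  have w: "\<tau> x ba \<in> whites G" "\<tau> x ba \<in> internal_verts q" using F(14) e by (force simp: dipole_def internal_verts_def)+
  have en: "white_end G (ed G x (\<tau> x ba)) = \<tau> x ba" "black_end G (ed G x (\<tau> x ba)) = ba"
    using nbr_white(1,2)[OF cg w(1) xD] matchingsD(5)[OF matching F(3) fV] by auto
  have "ed G x (\<tau> x ba) \<notin> internal_edges G q" using en out by (simp add: internal_edges_def)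
  moreover have "ed G x (\<tau> x ba) \<in> edges G" using ed(1)[OF cg whites_blacks(1)[OF w(1)] xD] .
  ultimately have "ed G x (\<tau> x ba) = left_w q \<or> ed G x (\<tau> x ba) = right_w q"
    using external_w[OF cg pc, of "ed G x (\<tau> x ba)"] en w D by simp
  then have "\<tau> x ba = fst (hd (dipoles q)) \<or> \<tau> x ba = fst (last (dipoles q))"
    using en prechainD(8,10)[OF pc] by metis
  moreover
  have inj: "inj_on fst (set (dipoles q))" using prechainD(2)[OF pc] by (simp add: distinct_map)
  have key: "d = (\<tau> x ba, \<tau> x wa)" if "d \<in> set (dipoles q)" "fst d = \<tau> x ba" for d
    using inj_onD[OF inj _ that(1) e(1)] that(2) by simp
  ultimately have "(\<tau> x ba, \<tau> x wa) = hd (dipoles q) \<or> (\<tau> x ba, \<tau> x wa) = last (dipoles q)"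
    using key[OF hd_in_set[OF ne]] key[OF last_in_set[OF ne]] by metis
  then show False
  proof
    assume "(\<tau> x ba, \<tau> x wa) = last (dipoles q)"
    then show False using no_dipole_beside_last[OF q fx nin] by simp
  next
    assume "(\<tau> x ba, \<tau> x wa) = hd (dipoles q)"
    then show False using no_dipole_beside_last[OF maximal_rev[OF q] fx] nin ne by (simp add: last_rev)
  qed
qed

lemma maximal_exists:
  assumes p: "proper_prechain D G p"
  shows "\<exists>q. maximal_proper_prechain D G q \<and> set (dipoles p) \<subseteq> set (dipoles q)"
proof -
  let ?Q = "{q. proper_prechain D G q \<and> set (dipoles p) \<subseteq> set (dipoles q)}"
  have bound: "card (set (dipoles q)) \<le> card (V \<times> V) \<and> finite (set (dipoles q))" if "q \<in> ?Q" for q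
  proof -
    have "dipole D G w b" if "(w, b) \<in> set (dipoles q)" for w b
      using \<open>q \<in> ?Q\<close> that prechainD(4)[of q] by (auto simp: proper_prechain_def)
    then have "set (dipoles q) \<subseteq> V \<times> V" using whites_blacks by (auto simp: dipole_def)
    moreover have "finite (V \<times> V)" using colored_graphD(1)[OF cg] by simp
    ultimately show ?thesis using card_mono by blast
  qed
  have "p \<in> ?Q" using p by simp
  then obtain q where q: "q \<in> ?Q" "\<forall>r. r \<in> ?Q \<longrightarrow> card (set (dipoles r)) \<le> card (set (dipoles q))"
    using ex_has_greatest_nat[of "\<lambda>q. q \<in> ?Q" p "\<lambda>q. card (set (dipoles q))" "Suc (card (V \<times> V))"]
      bound le_imp_less_Suc by blast
  have "maximal_proper_prechain D G q"
    unfolding maximal_proper_prechain_def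
  proof (intro conjI notI)
    assume "\<exists>r. proper_prechain D G r \<and> set (dipoles q) \<subset> set (dipoles r)"
    then obtain r where r: "proper_prechain D G r" "set (dipoles q) \<subset> set (dipoles r)" by blast
    then have "r \<in> ?Q" using q(1) by auto
    moreover have "card (set (dipoles q)) < card (set (dipoles r))" using r(2) by (intro psubset_card_mono) auto
    ultimately show False using q(2) by (meson not_le)
  qed (use q in auto)
  then show ?thesis using q(1) by auto
qed

lemma prechain_udip:
  assumes p: "prechain D G p" and n: "n < length (dipoles p)" shows "udip C \<tau> R (dw p n) (db p n)"
proof (rule dipole_udip[OF pos(1)[OF p n]])
  have "edges_between G (dw p n) (db p n) \<subseteq> internal_edges G p"
    using pos(4,5)[OF p n] by (auto simp: edges_between_def internal_edges_def)
  then show "root G \<notin> Some ` edges_between G (dw p n) (db p n)" using prechainD(13)[OF p] rt by auto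
qed

lemma two_dipole_prechain:
  assumes f: "biflank i j w b" and g: "biflank i k (\<tau> i b) (\<tau> i w)"
  shows "\<exists>p. proper_prechain D G p \<and> set (dipoles p) = {(w, b), (\<tau> i b, \<tau> i w)}"
proof -
  let ?w = "\<tau> i b" and ?b = "\<tau> i w"
  note F = biflankD[OF f] and H = biflankD[OF g]
  have le: "i \<le> D" "j \<le> D" "k \<le> D" using F(3,4) H(4) by auto
  have v: "w \<in> V" "b \<in> V" "?w \<in> V" "?b \<in> V" using F(1,2) H(1,2) whites_blacks by auto
  have inv: "\<tau> i ?w = b" "\<tau> i ?b = w" using matchingsD(5)[OF matching F(3)] v by auto
  have neq: "w \<noteq> ?w" "b \<noteq> ?b" using F(8,10) by auto
  note nw = white_edge and nb = black_edge
  define p where "p = \<lparr>dipoles = [(w, b), (?w, ?b)], left_w = ed G j w, left_b = ed G j b,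
    right_w = ed G k ?w, right_b = ed G k ?b\<rparr>"
  have s: "dipoles p = [(w, b), (?w, ?b)]" "left_w p = ed G j w" "left_b p = ed G j b"
    "right_w p = ed G k ?w" "right_b p = ed G k ?b" by (auto simp: p_def)
  have iv: "internal_verts p = {w, b, ?w, ?b}" by (auto simp: internal_verts_def s)
  have o: "\<tau> j w \<notin> {b, ?b}" "\<tau> j b \<notin> {w, ?w}" "\<tau> k ?w \<notin> {b, ?b}" "\<tau> k ?b \<notin> {w, ?w}"
    using F(9,11,16,17) H(9,11,16,17) inv by auto
  have bw: "x \<notin> blacks G" if "x \<in> {w, ?w}" for x using that F(1) H(1) whites_blacks(3) by auto
  have col: "\<tau> j w \<in> blacks G" "\<tau> j b \<in> whites G" "\<tau> k ?w \<in> blacks G" "\<tau> k ?b \<in> whites G"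
    using nbr_color F(1,2,4) H(1,2,4) by auto
  have out: "\<tau> j w \<notin> internal_verts p" "\<tau> j b \<notin> internal_verts p" "\<tau> k ?w \<notin> internal_verts p" "\<tau> k ?b \<notin> internal_verts p"
  proof -
    have bb: "x \<notin> whites G" if "x \<in> {b, ?b}" for x using that F(2) H(2) whites_blacks(3) by auto
    show "\<tau> j w \<notin> internal_verts p" using o(1) col(1) bw unfolding iv by blast
    show "\<tau> j b \<notin> internal_verts p" using o(2) col(2) bb unfolding iv by blast
    show "\<tau> k ?w \<notin> internal_verts p" using o(3) col(3) bw unfolding iv by blast
    show "\<tau> k ?b \<notin> internal_verts p" using o(4) col(4) bb unfolding iv by blast
  qed
  have "e0 \<notin> internal_edges G p"
  proof
    assume "e0 \<in> internal_edges G p"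
    then have "white_end G e0 \<in> {w, b, ?w, ?b}" by (simp add: internal_edges_def iv)
    then have "white_end G e0 \<in> {w, ?w}" using colored_graphD(4)[OF cg e0] F(2) H(2) whites_blacks(3) by auto
    then show False using F(12)[of "color G e0"] H(12)[of "color G e0"] colored_graphD(6)[OF cg e0]
      by (auto simp: R_def)
  qed
  then have root: "root G \<notin> Some ` internal_edges G p" using rt by auto
  have "edges_between G w ?b \<noteq> {}" "edges_between G ?w b \<noteq> {}"
    using nw[OF le(1) F(1)] nb[OF le(1) F(2)] by (auto simp: edges_between_def)
  then have adj: "\<forall>i. Suc i < length (dipoles p) \<longrightarrow> edges_between G (fst (dipoles p ! i)) (snd (dipoles p ! Suc i)) \<noteq> {} \<and>
         edges_between G (fst (dipoles p ! Suc i)) (snd (dipoles p ! i)) \<noteq> {}"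
    by (auto simp: s less_Suc_eq)
  have "prechain D G p"
    unfolding prechain_def Let_def
  proof (intro conjI)
    show "\<forall>(w, b)\<in>set (dipoles p). dipole D G w b" using biflank_dipole[OF f] biflank_dipole[OF g] by (auto simp: s)
    show "{left_w p, left_b p, right_w p, right_b p} \<subseteq> edges G - internal_edges G p"
      using out nw[OF le(2) F(1)] nb[OF le(2) F(2)] nw[OF le(3) H(1)] nb[OF le(3) H(2)]
      by (auto simp: s internal_edges_def)
    have "ed G j w \<noteq> ed G j b" "ed G k ?w \<noteq> ed G k ?b"
      using nw(1)[OF le(2) F(1)] nb(2)[OF le(2) F(2)] nw(1)[OF le(3) H(1)] nb(2)[OF le(3) H(2)] F(9) H(9) by auto
    moreover have "ed G j w \<noteq> ed G k ?w" "ed G j b \<noteq> ed G k ?b"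
      using nw(2)[OF le(2) F(1)] nw(2)[OF le(3) H(1)] nb(2)[OF le(2) F(2)] nb(2)[OF le(3) H(2)] neq by auto
    moreover have "ed G j w \<noteq> ed G k ?b" "ed G j b \<noteq> ed G k ?w"
      using nw(1)[OF le(2) F(1)] nb(2)[OF le(3) H(2)] nb(1)[OF le(2) F(2)] nw(2)[OF le(3) H(1)] o by auto
    ultimately show "distinct [left_w p, left_b p, right_w p, right_b p]" by (simp add: s)
  qed (use adj root neq nw[OF le(2) F(1)] nb[OF le(2) F(2)] nw[OF le(3) H(1)] nb[OF le(3) H(2)] in \<open>simp_all add: s\<close>)
  then have "proper_prechain D G p" by (simp add: proper_prechain_def s)
  then show ?thesis using s(1) by auto
qed

lemma biflank_pos:
  assumes p: "proper_prechain D G p" and n: "k < length (dipoles p)" and f: "biflank i j (dw p k) (db p k)"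
    and ch: "is_chain G p"
  shows "0 < k \<Longrightarrow> \<exists>x\<in>{i, j}. (\<tau> x (db p k), \<tau> x (dw p k)) = dipoles p ! (k - 1)"
    "Suc k < length (dipoles p) \<Longrightarrow> \<exists>x\<in>{i, j}. (\<tau> x (db p k), \<tau> x (dw p k)) = dipoles p ! Suc k"
proof -
  note nb = neighbours[OF p n] and F = biflankD[OF f]
  { assume k: "0 < k"
    obtain x where x: "x \<in> C" "\<tau> x (dw p k) = Lb p k" "\<tau> x (db p k) = Lw p k"
      using ch_all(1)[OF p n] ch by (auto simp: chL_def)
    then have "x \<in> {i, j}" using F(6)[OF x(1)] nb(7) by auto
    then show "\<exists>x\<in>{i, j}. (\<tau> x (db p k), \<tau> x (dw p k)) = dipoles p ! (k - 1)"
      using x k by (intro bexI[of _ x]) (auto simp: Lb_def Lw_def) }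
  { assume k: "Suc k < length (dipoles p)"
    obtain x where x: "x \<in> C" "\<tau> x (dw p k) = Rb p k" "\<tau> x (db p k) = Rw p k"
      using ch_all(2)[OF p n] ch by (auto simp: chR_def)
    then have "x \<in> {i, j}" using F(6)[OF x(1)] nb(8) by auto
    then show "\<exists>x\<in>{i, j}. (\<tau> x (db p k), \<tau> x (dw p k)) = dipoles p ! Suc k"
      using x k by (intro bexI[of _ x]) (auto simp: Rb_def Rw_def) }
qed

lemma first_change:
  fixes k n :: nat
  assumes "k < n" "\<not> Q k" "Q n" obtains l where "k \<le> l" "l < n" "\<not> Q l" "Q (Suc l)"
  using assms
proof (induction n arbitrary: thesis)
  case (Suc n)
  show ?case
  proof (cases "Q n")
    case True
    then have "k < n" using Suc.prems by (cases "k = n") auto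
    then show ?thesis using Suc.IH[OF _ _ Suc.prems(3) True] Suc.prems(1) by (metis less_Suc_eq)
  next
    case False
    then show ?thesis using Suc.prems by (metis less_Suc_eq_le lessI)
  qed
qed simp

lemma last_change:
  fixes k n :: nat
  assumes "n < k" "\<not> Q k" "Q n" obtains l where "n \<le> l" "l < k" "\<not> Q (Suc l)" "Q l"
  using first_change[of n k "\<lambda>x. \<not> Q x"] assms by metis

text \<open>Between the positions \<open>k\<close> and \<open>n\<close> of \<open>p\<close> there is
  a step that enters \<open>q\<close>. The dipole before it is either the given one at
  \<open>k\<close> or an inner dipole of \<open>p\<close>, hence it lies between two dipoles, and
  \<open>no_dipole_beside\<close> forbids it next to \<open>q\<close>.\<close>

lemma chain_not_left:
  assumes p: "proper_prechain D G p" and ch: "is_chain G p" and q: "maximal_proper_prechain D G q"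
    and k: "k < length (dipoles p)" "biflank i j (dw p k) (db p k)" "dipoles p ! k \<notin> set (dipoles q)"
    and n: "n < length (dipoles p)" "dipoles p ! n \<in> set (dipoles q)"
  shows False
proof -
  let ?Q = "\<lambda>x. dipoles p ! x \<in> set (dipoles q)"
  have bi: "\<exists>i j. biflank i j (dw p l) (db p l)" if "l = k \<or> 0 < l \<and> Suc l < length (dipoles p)" for l
    using that interior_biflank[OF p ch] k(2) by blast
  have nin: "(dw p l, db p l) \<notin> set (dipoles q)" if "\<not> ?Q l" for l using that by simp
  have "n \<noteq> k" using k(3) n(2) by auto
  then consider "k < n" | "n < k" by linarith
  then show False
  proof cases
    case 1
    obtain l where l: "k \<le> l" "l < n" "\<not> ?Q l" "?Q (Suc l)" using first_change[OF 1, of ?Q] k(3) n(2) by metis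
    have ll: "l < length (dipoles p)" "Suc l < length (dipoles p)" using l n by auto
    have "l = k \<or> 0 < l \<and> Suc l < length (dipoles p)" using l ll by auto
    then obtain i' j' where f: "biflank i' j' (dw p l) (db p l)" using bi by blast
    obtain x where x: "x \<in> {i', j'}" "(\<tau> x (db p l), \<tau> x (dw p l)) = dipoles p ! Suc l"
      using biflank_pos(2)[OF p ll(1) f ch ll(2)] by blast
    show False using no_dipole_beside[OF q f nin[OF l(3)] _ x(1)] x(2) l(4) by simp
  next
    case 2
    obtain l where l: "n \<le> l" "l < k" "\<not> ?Q (Suc l)" "?Q l" using last_change[OF 2, of ?Q] k(3) n(2) by metis
    have ll: "Suc l < length (dipoles p)" using l k by auto
    have "Suc l = k \<or> 0 < Suc l \<and> Suc (Suc l) < length (dipoles p)" using l k by auto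
    then obtain i' j' where f: "biflank i' j' (dw p (Suc l)) (db p (Suc l))" using bi by blast
    obtain x where x: "x \<in> {i', j'}" "(\<tau> x (db p (Suc l)), \<tau> x (dw p (Suc l))) = dipoles p ! l"
      using biflank_pos(1)[OF p ll f ch] by auto
    show False using no_dipole_beside[OF q f nin[OF l(3)] _ x(1)] x(2) l(4) by simp
  qed
qed

section \<open>Replaced chains and non-full vertices\<close>

abbreviation "nonfull \<equiv> {x \<in> V. \<not> full C V \<tau> R x}"

lemma partner_nbrs_full:
  assumes n: "5 \<le> card V" and w: "w \<in> V" and fw: "full C V \<tau> R w" and u: "udip C \<tau> R w b"
    and fb: "\<And>c. c \<in> C \<Longrightarrow> full C V \<tau> R (\<tau> c b)" and c: "c \<in> C"
  shows "full C V \<tau> R (\<tau> c w)"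
proof -
  have b: "b \<in> V" using udip_mem(1)[OF marked w u] .
  obtain i j where s: "i \<in> C" "j \<in> C" "unm C \<tau> R w b = C - {i, j}" "(w, b, i) \<in> links C V \<tau> R" "(w, b, j) \<in> links C V \<tau> R"
    by (rule full_struct[OF marked con n fw u])
  show ?thesis
  proof (cases "c = i \<or> c = j")
    case True
    then have "udip C \<tau> R (\<tau> c w) (\<tau> c b)" using s by (auto simp: links_def)
    then have "udip C \<tau> R (\<tau> c b) (\<tau> c w)"
      using udip_sym[OF marked matchingsD(3)[OF matching c w] matchingsD(3)[OF matching c b]] by simp
    then show ?thesis using full_partner[OF marked con n fb[OF c]] by blast
  next
    case False
    then have "c \<in> unm C \<tau> R w b" using s(3) c by simp
    then have "\<tau> c w = b" by (simp add: unm_def)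
    then show ?thesis using full_partner[OF marked con n fw u] by simp
  qed
qed

text \<open>The dipole of \<open>w\<close> and one linked to it form a proper pre-chain. It extends
  to a maximal one, \<open>p\<close>, which is a chain. As chains may overlap, \<open>p\<close>
  itself need not be among those chosen, but some chosen \<open>q\<close> meets it, and by
  \<open>chain_not_left\<close> this \<open>q\<close> contains the dipole of
  \<open>w\<close>.\<close>

lemma white_in_chain:
  assumes n: "5 \<le> card V" and P: "replaced_chains D G P" and w: "w \<in> whites G" and fw: "full C V \<tau> R w"
    and u: "udip C \<tau> R w b" and f': "\<And>c. c \<in> C \<Longrightarrow> full C V \<tau> R (\<tau> c w)"
    and f'': "\<And>i c. (w, b, i) \<in> links C V \<tau> R \<Longrightarrow> c \<in> C \<Longrightarrow> full C V \<tau> R (\<tau> c (\<tau> i b))"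
  shows "\<exists>q\<in>P. (w, b) \<in> set (dipoles q)"
proof (rule ccontr)
  assume no: "\<not> ?thesis"
  obtain i j where f: "biflank i j w b" and l: "(w, b, i) \<in> links C V \<tau> R" "(w, b, j) \<in> links C V \<tau> R"
    using biflankI[OF n w fw u f'] by blast
  note F = biflankD[OF f]
  have V: "w \<in> V" "b \<in> V" using F(1,2) whites_blacks by auto
  have part: "full C V \<tau> R (\<tau> x b)" "udip C \<tau> R (\<tau> x b) (\<tau> x w)" "udip C \<tau> R (\<tau> x w) (\<tau> x b)"
    if x: "x \<in> C" "(w, b, x) \<in> links C V \<tau> R" for x
  proof -
    have v: "\<tau> x w \<in> V" "\<tau> x b \<in> V" using matchingsD(3)[OF matching x(1)] V by auto
    show u': "udip C \<tau> R (\<tau> x w) (\<tau> x b)" using x by (simp add: links_def)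
    then show "udip C \<tau> R (\<tau> x b) (\<tau> x w)" using udip_sym[OF marked v] by simp
    show "full C V \<tau> R (\<tau> x b)" by (rule full_partner[OF marked con n f'[OF x(1)] u'])
  qed
  let ?w = "\<tau> i b" and ?b = "\<tau> i w"
  have iv: "\<tau> i ?w = b" "\<tau> i ?b = w" using matchingsD(5)[OF matching F(3)] V by auto
  have wW: "?w \<in> whites G" using F(14) by (auto simp: dipole_def)
  obtain i' k' where g0: "biflank i' k' ?w ?b"
    using biflankI[OF n wW part(1)[OF F(3) l(1)] part(2)[OF F(3) l(1)] f''[OF l(1)]] by blast
  have "i = i' \<or> i = k'" using biflankD(6)[OF g0 F(3)] iv F(8) by auto
  then obtain k where g: "biflank i k ?w ?b" using g0 biflank_sym by blast
  obtain p0 where p0: "proper_prechain D G p0" "set (dipoles p0) = {(w, b), (?w, ?b)}"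
    using two_dipole_prechain[OF f g] by blast
  obtain p where p: "maximal_proper_prechain D G p" "set (dipoles p0) \<subseteq> set (dipoles p)"
    using maximal_exists[OF p0(1)] by blast
  have pp: "proper_prechain D G p" using p(1) by (simp add: maximal_proper_prechain_def)
  then have pc: "prechain D G p" and l2: "2 \<le> length (dipoles p)" by (auto simp: proper_prechain_def)
  have "(w, b) \<in> set (dipoles p)" using p0 p by auto
  then obtain k where k: "k < length (dipoles p)" "dipoles p ! k = (w, b)" by (auto simp: in_set_conv_nth)
  note nb = neighbours[OF pp k(1)]
  \<comment> \<open>The neighbour of \<open>w\<close> over \<open>x\<close> is full and so has only
    one dipole. Hence the next dipole of \<open>p\<close> is the linked one, and both edges to it
    have the color \<open>x\<close>.\<close>
  have next_dipole: "\<tau> x b = dw p r" if x: "x \<in> C" "\<tau> x w = db p r" "\<tau> x w \<noteq> b" and r: "r < length (dipoles p)" for x r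
  proof -
    have "x = i \<or> x = j" using F(6)[OF x(1)] x(3) by auto
    then have lx: "(w, b, x) \<in> links C V \<tau> R" using l by auto
    have pr: "dw p r \<in> V" "db p r \<in> V" using pos[OF pc r] whites_blacks by auto
    have "udip C \<tau> R (db p r) (dw p r)" using prechain_udip[OF pc r] udip_sym[OF marked pr] by simp
    then show ?thesis using full_unique[OF marked con n f'[OF x(1)] part(3)[OF x(1) lx]] x(2) by simp
  qed
  have ch: "is_chain G p"
  proof (cases "Suc k < length (dipoles p)")
    case True
    obtain x where x: "x \<in> C" "\<tau> x w = Rb p k" using nb(2) k by auto
    have "\<tau> x b = Rw p k" using next_dipole[of x "Suc k"] x nb(8) True k by (simp add: Rb_def Rw_def)
    then have "chR p k" using x k by (auto simp: chR_def)
    then show ?thesis using ch_all(2)[OF pp k(1)] by simp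
  next
    case False
    then have k0: "0 < k" using l2 k by linarith
    obtain x where x: "x \<in> C" "\<tau> x w = Lb p k" using nb(1) k by auto
    have "\<tau> x b = Lw p k" using next_dipole[of x "k - 1"] x nb(7) k0 k by (simp add: Lb_def Lw_def)
    then have "chL p k" using x k by (auto simp: chL_def)
    then show ?thesis using ch_all(1)[OF pp k(1)] by simp
  qed
  obtain q where q: "q \<in> P" "internal_verts p \<inter> internal_verts q \<noteq> {}"
    using P p(1) ch unfolding replaced_chains_def by blast
  have mq: "maximal_proper_prechain D G q" using P q(1) by (simp add: replaced_chains_def)
  then have qc: "prechain D G q" by (simp add: maximal_proper_prechain_def proper_prechain_def)
  obtain v where v: "v \<in> internal_verts p" "v \<in> internal_verts q" using q(2) by auto
  obtain r where r: "r < length (dipoles q)" "v = dw q r \<or> v = db q r" using internal_vertsE[OF v(2)] by metis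
  have "(dw q r, db q r) \<in> set (dipoles p)" using dipole_in[OF pp pos(1)[OF qc r(1)]] v(1) r(2) by auto
  then obtain s where s: "s < length (dipoles p)" "dipoles p ! s = dipoles q ! r" by (auto simp: in_set_conv_nth)
  have s': "dipoles p ! s \<in> set (dipoles q)" using s r by simp
  have kq: "dipoles p ! k \<notin> set (dipoles q)" using no q(1) k by auto
  have fk: "biflank i j (dw p k) (db p k)" using f k by simp
  show False by (rule chain_not_left[OF pp ch mq k(1) fk kq s(1) s'])
qed

text \<open>Two neighbourhood steps suffice, whether \<open>v\<close> is white or black, because
  \<open>partner_nbrs_full\<close> carries fullness of all neighbours from one vertex of a dipole to
  the other.\<close>

lemma full_vertex_in_chain:
  assumes n: "5 \<le> card V" and P: "replaced_chains D G P" and v: "v \<in> V" "v \<notin> nbh C \<tau> (nbh C \<tau> nonfull)"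
  shows "\<exists>q\<in>P. v \<in> internal_verts q"
proof -
  have S: "nonfull \<subseteq> nbh C \<tau> nonfull" "nbh C \<tau> nonfull \<subseteq> nbh C \<tau> (nbh C \<tau> nonfull)" by (auto simp: nbh_def)
  have fl: "full C V \<tau> R x" if "x \<in> V" "x \<notin> nonfull" for x using that by simp
  have fv: "full C V \<tau> R v" using v S by blast
  have tV: "\<tau> c x \<in> V" if "c \<in> C" "x \<in> V" for c x using matchingsD(3)[OF matching that] .
  have f1: "full C V \<tau> R (\<tau> c v)" if "c \<in> C" for c
    using nbh_step[OF matching that v] S(1) fl[OF tV[OF that v(1)]] by blast
  have f2: "full C V \<tau> R (\<tau> d (\<tau> c v))" if "c \<in> C" "d \<in> C" for c d
    using nbh_step[OF matching that(2) tV[OF that(1) v(1)] nbh_step[OF matching that(1) v]] fl[OF tV[OF that(2) tV[OF that(1) v(1)]]] by blast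
  obtain u where u: "udip C \<tau> R v u" using fv by (auto simp: full_def links_def)
  have uV: "u \<in> V" by (rule udip_mem(1)[OF marked v(1) u])
  have u': "udip C \<tau> R u v" using udip_sym[OF marked v(1) uV] u by simp
  have fu: "full C V \<tau> R u" by (rule full_partner[OF marked con n fv u])
  show ?thesis
  proof (cases "v \<in> whites G")
    case True
    have "\<exists>q\<in>P. (v, u) \<in> set (dipoles q)"
    proof (rule white_in_chain[OF n P True fv u f1])
      fix i c assume l: "(v, u, i) \<in> links C V \<tau> R" and c: "c \<in> C"
      have i: "i \<in> C" "udip C \<tau> R (\<tau> i v) (\<tau> i u)" using l by (auto simp: links_def)
      have "udip C \<tau> R (\<tau> i u) (\<tau> i v)" using i(2) udip_sym[OF marked tV[OF i(1) v(1)] tV[OF i(1) uV]] by simp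
      then show "full C V \<tau> R (\<tau> c (\<tau> i u))"
        using partner_nbrs_full[OF n tV[OF i(1) uV] full_partner[OF marked con n f1[OF i(1)] i(2)] _ f2[OF i(1)] c] by blast
    qed
    then show ?thesis by (force simp: internal_verts_def)
  next
    case False
    obtain c where "c \<in> C" "\<tau> c v = u" 
    proof -
      have "unm C \<tau> R v u \<noteq> {}" using u D by (auto simp: udip_def)
      then show thesis using that by (auto simp: unm_def)
    qed
    moreover have "v \<in> blacks G" using False v(1) by (simp add: verts_def)
    ultimately have uW: "u \<in> whites G" using nbr_color(2) by blast
    have "\<exists>q\<in>P. (u, v) \<in> set (dipoles q)"
    proof (rule white_in_chain[OF n P uW fu u'])
      show "full C V \<tau> R (\<tau> c u)" if "c \<in> C" for c by (rule partner_nbrs_full[OF n uV fu u' f1 that])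
      show "full C V \<tau> R (\<tau> c (\<tau> i v))" if "(u, v, i) \<in> links C V \<tau> R" "c \<in> C" for i c
        using f2[of i c] that by (auto simp: links_def)
    qed
    then show ?thesis by (force simp: internal_verts_def)
  qed
qed

text \<open>Otherwise all vertices near the last dipole of \<open>q\<close> are full. Then this
  dipole is linked beyond the right end to a dipole that lies between two others and outside
  \<open>q\<close>, against \<open>no_dipole_beside\<close>. Since the chosen chains are disjoint,
  this bounds their number.\<close>

lemma chain_has_nonfull:
  assumes n: "5 \<le> card V" and P: "replaced_chains D G P" and q: "q \<in> P"
  shows "\<exists>v\<in>internal_verts q. v \<in> nbh C \<tau> (nbh C \<tau> nonfull)"
proof (rule ccontr)
  assume no: "\<not> ?thesis"
  have mq: "maximal_proper_prechain D G q" and ch: "is_chain G q" using P q by (auto simp: replaced_chains_def)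
  then have pq: "proper_prechain D G q" and qc: "prechain D G q" and l2: "2 \<le> length (dipoles q)"
    by (auto simp: maximal_proper_prechain_def proper_prechain_def)
  let ?n = "length (dipoles q) - 1"
  have nl: "?n < length (dipoles q)" "Suc ?n = length (dipoles q)" using l2 by auto
  note ps = pos[OF qc nl(1)] and nb = neighbours[OF pq nl(1)]
  let ?w = "dw q ?n" and ?b = "db q ?n"
  have V: "?w \<in> V" "?b \<in> V" using ps whites_blacks by auto
  have tV: "\<tau> c x \<in> V" if "c \<in> C" "x \<in> V" for c x using matchingsD(3)[OF matching that] .
  have S: "nonfull \<subseteq> nbh C \<tau> nonfull" "nbh C \<tau> nonfull \<subseteq> nbh C \<tau> (nbh C \<tau> nonfull)" by (auto simp: nbh_def)
  have nw: "?w \<notin> nbh C \<tau> (nbh C \<tau> nonfull)" "?b \<notin> nbh C \<tau> (nbh C \<tau> nonfull)" using no ps by auto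
  have fl: "full C V \<tau> R x" if "x \<in> V" "x \<notin> nonfull" for x using that by simp
  have fw: "full C V \<tau> R ?w" using fl[OF V(1)] nw(1) S by blast
  have f1: "full C V \<tau> R (\<tau> c ?w)" if "c \<in> C" for c
    using nbh_step[OF matching that V(1) nw(1)] S(1) fl[OF tV[OF that V(1)]] by blast
  have f2: "full C V \<tau> R (\<tau> c ?b)" if "c \<in> C" for c
    using nbh_step[OF matching that V(2) nw(2)] S(1) fl[OF tV[OF that V(2)]] by blast
  have f3: "full C V \<tau> R (\<tau> d (\<tau> c ?b))" if "c \<in> C" "d \<in> C" for c d
    using nbh_step[OF matching that(2) tV[OF that(1) V(2)] nbh_step[OF matching that(1) V(2) nw(2)]] fl[OF tV[OF that(2) tV[OF that(1) V(2)]]] by blast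
  have u: "udip C \<tau> R ?w ?b" by (rule prechain_udip[OF qc nl(1)])
  obtain i j where f: "biflank i j ?w ?b" and l: "(?w, ?b, i) \<in> links C V \<tau> R" "(?w, ?b, j) \<in> links C V \<tau> R"
    using biflankI[OF n ps(2) fw u f1] by blast
  obtain x where x: "x \<in> C" "\<tau> x ?w = Rb q ?n" "\<tau> x ?b = Rw q ?n"
    using ch_all(2)[OF pq nl(1)] ch by (auto simp: chR_def)
  have "x = i \<or> x = j" using biflankD(6)[OF f x(1)] x(2) nb(8) by auto
  then have lx: "(?w, ?b, x) \<in> links C V \<tau> R" using l by auto
  have ux: "udip C \<tau> R (\<tau> x ?b) (\<tau> x ?w)"
    using lx udip_sym[OF marked tV[OF x(1) V(1)] tV[OF x(1) V(2)]] by (simp add: links_def)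
  have xw: "\<tau> x ?b \<in> whites G" using nbr_color(2)[OF x(1) ps(3)] .
  obtain i' j' where g: "biflank i' j' (\<tau> x ?b) (\<tau> x ?w)"
    using biflankI[OF n xw f2[OF x(1)] ux f3[OF x(1)]] by blast
  have iv: "\<tau> x (\<tau> x ?w) = ?w" "\<tau> x (\<tau> x ?b) = ?b" using matchingsD(5)[OF matching x(1)] V by auto
  have "?b \<noteq> \<tau> x ?w" using lx by (auto simp: links_def)
  then have x': "x \<in> {i', j'}" using biflankD(6)[OF g x(1)] iv by auto
  have "\<tau> x ?w \<notin> internal_verts q" using external_other_end(3)[OF qc] x(2) nl by (simp add: Rb_def)
  then have nin: "(\<tau> x ?b, \<tau> x ?w) \<notin> set (dipoles q)" by (force simp: internal_verts_def)
  have "(\<tau> x (\<tau> x ?w), \<tau> x (\<tau> x ?b)) \<in> set (dipoles q)" using iv nl(1) by simp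
  then show False using no_dipole_beside[OF mq g nin _ x'] by blast
qed

text \<open>The second neighbourhood of the non-full vertices contains all vertices outside the
  chosen chains and a vertex of each of these disjoint chains. Each neighbourhood step multiplies
  the size by at most \<open>1 + card C = D + 2\<close>.\<close>

theorem scheme_size:
  assumes n: "5 \<le> card V" and P: "replaced_chains D G P"
  shows "card (V - \<Union>(internal_verts ` P)) \<le> (D + 2)\<^sup>2 * card nonfull" "card P \<le> (D + 2)\<^sup>2 * card nonfull"
    "finite P"
proof -
  let ?S = "nbh C \<tau> (nbh C \<tau> nonfull)"
  have fV: "finite V" using colored_graphD(1)[OF cg] .
  have f1: "finite nonfull" using fV by simp
  have c1: "card (nbh C \<tau> nonfull) \<le> (D + 2) * card nonfull" "finite (nbh C \<tau> nonfull)"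
    using card_nbh[OF f1, of C \<tau>] by auto
  have c2: "card ?S \<le> (D + 2) * card (nbh C \<tau> nonfull)" "finite ?S"
    using card_nbh[OF c1(2), of C \<tau>] by auto
  have cS: "card ?S \<le> (D + 2)\<^sup>2 * card nonfull"
  proof -
    have "card ?S \<le> (D + 2) * ((D + 2) * card nonfull)"
      using c2(1) mult_le_mono2[OF c1(1), of "D + 2"] by (rule le_trans)
    then show ?thesis by (simp only: power2_eq_square mult.assoc)
  qed
  have "V - \<Union>(internal_verts ` P) \<subseteq> ?S" using full_vertex_in_chain[OF n P] by blast
  then show "card (V - \<Union>(internal_verts ` P)) \<le> (D + 2)\<^sup>2 * card nonfull"
    using card_mono[OF c2(2)] cS le_trans by blast
  define h :: "('v, 'e) prechain \<Rightarrow> 'v" where "h = (\<lambda>q. SOME v. v \<in> internal_verts q \<and> v \<in> ?S)"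
  have h: "h q \<in> internal_verts q \<and> h q \<in> ?S" if "q \<in> P" for q
    unfolding h_def by (rule someI_ex) (use chain_has_nonfull[OF n P that] in blast)
  have inj: "inj_on h P"
  proof (rule inj_onI)
    fix p q assume pq: "p \<in> P" "q \<in> P" "h p = h q"
    show "p = q"
    proof (rule ccontr)
      assume "p \<noteq> q"
      then have "internal_verts p \<inter> internal_verts q = {}" using P pq unfolding replaced_chains_def by blast
      then show False using h[OF pq(1)] h[OF pq(2)] pq(3) by auto
    qed
  qed
  have hS: "h ` P \<subseteq> ?S" using h by blast
  then show "card P \<le> (D + 2)\<^sup>2 * card nonfull"
    using card_inj_on_le[OF inj hS c2(2)] cS by simp
  show "finite P" using inj_on_finite[OF inj hS c2(2)] .
qed

end

section \<open>Counting schemes\<close>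

definition regulars :: "('v, 'e, 'c) scheme \<Rightarrow> 'v set" where
  "regulars S = reg_whites S \<union> reg_blacks S"

text \<open>
  An edge of a scheme is determined by its white end and its color, so an isomorphism class is
  determined by the renamed ends and colors of the edges.
\<close>

definition edge_code :: "('v \<Rightarrow> nat) \<Rightarrow> ('c \<Rightarrow> nat) \<Rightarrow> ('v, 'e, 'c) scheme \<Rightarrow> 'e \<Rightarrow>
    (nat, nat) attachment \<times> nat \<times> (nat, nat) attachment" where
  "edge_code f h S e = (carry_attachment f h (\<lambda>_. False) (swhite_end S e), scolor S e,
     carry_attachment f h (\<lambda>_. False) (sblack_end S e))"

definition code :: "('v \<Rightarrow> nat) \<Rightarrow> ('c \<Rightarrow> nat) \<Rightarrow> ('v, 'e, 'c) scheme \<Rightarrow> nat set \<times> nat set \<times> (nat \<times> chain_type) set \<times>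
    ((nat, nat) attachment \<times> nat \<times> (nat, nat) attachment) set \<times> ((nat, nat) attachment \<times> nat \<times> (nat, nat) attachment) option" where
  "code f h S = (f ` reg_whites S, f ` reg_blacks S, (\<lambda>c. (h c, chain_type S c)) ` chain_verts S,
     edge_code f h S ` sedges S, map_option (edge_code f h S) (sroot S))"

lemma is_schemeD:
  assumes "is_scheme D S"
  shows "finite (regulars S)" "finite (chain_verts S)" "c \<in> chain_verts S \<Longrightarrow> valid_type D (chain_type S c)"
    "e \<in> sedges S \<Longrightarrow> scolor S e \<le> D"
    "e \<in> sedges S \<Longrightarrow> swhite_end S e \<in> Regular ` reg_whites S \<union> (\<Union>c\<in>chain_verts S. range (Port c))"
    "e \<in> sedges S \<Longrightarrow> sblack_end S e \<in> Regular ` reg_blacks S \<union> (\<Union>c\<in>chain_verts S. range (Port c))"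
    "w \<in> reg_whites S \<Longrightarrow> c' \<le> D \<Longrightarrow> \<exists>!e. e \<in> sedges S \<and> swhite_end S e = Regular w \<and> scolor S e = c'"
    "c \<in> chain_verts S \<Longrightarrow> \<exists>e\<in>sedges S. {e' \<in> sedges S. swhite_end S e' = Port c s} = {e}"
    "sroot S = Some e \<Longrightarrow> e \<in> sedges S"
proof -
  have 1: "finite (reg_whites S)" using assms unfolding is_scheme_def by (elim conjE)
  have 2: "finite (reg_blacks S)" using assms unfolding is_scheme_def by (elim conjE)
  have 3: "finite (chain_verts S)" using assms unfolding is_scheme_def by (elim conjE)
  have 4: "\<forall>c\<in>chain_verts S. valid_type D (chain_type S c)" using assms unfolding is_scheme_def by (elim conjE)
  have 5: "\<forall>e\<in>sedges S. scolor S e \<le> D \<and>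
        swhite_end S e \<in> Regular ` reg_whites S \<union> (\<Union>c\<in>chain_verts S. range (Port c)) \<and>
        sblack_end S e \<in> Regular ` reg_blacks S \<union> (\<Union>c\<in>chain_verts S. range (Port c))"
    using assms unfolding is_scheme_def by (elim conjE)
  have 6: "\<forall>w\<in>reg_whites S. \<forall>c\<le>D. \<exists>!e. e \<in> sedges S \<and> swhite_end S e = Regular w \<and> scolor S e = c"
    using assms unfolding is_scheme_def by (elim conjE)
  have 7: "\<forall>c\<in>chain_verts S. \<forall>s.
        (\<exists>e\<in>sedges S. {e' \<in> sedges S. swhite_end S e' = Port c s} = {e} \<and>
           scolor S e = external_color (chain_type S c) s) \<and>
        (\<exists>e\<in>sedges S. {e' \<in> sedges S. sblack_end S e' = Port c s} = {e} \<and>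
           scolor S e = external_color (chain_type S c) s)"
    using assms unfolding is_scheme_def by (elim conjE)
  have 8: "case sroot S of Some e \<Rightarrow> e \<in> sedges S
      | None \<Rightarrow> reg_whites S = {} \<and> reg_blacks S = {} \<and> chain_verts S = {} \<and> sedges S = {}"
    using assms unfolding is_scheme_def by (elim conjE)
  show "finite (regulars S)" "finite (chain_verts S)" using 1 2 3 by (simp_all add: regulars_def)
  show "c \<in> chain_verts S \<Longrightarrow> valid_type D (chain_type S c)" using 4 by blast
  show "e \<in> sedges S \<Longrightarrow> scolor S e \<le> D"
    "e \<in> sedges S \<Longrightarrow> swhite_end S e \<in> Regular ` reg_whites S \<union> (\<Union>c\<in>chain_verts S. range (Port c))"
    "e \<in> sedges S \<Longrightarrow> sblack_end S e \<in> Regular ` reg_blacks S \<union> (\<Union>c\<in>chain_verts S. range (Port c))"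
    using bspec[OF 5] by blast+
  show "w \<in> reg_whites S \<Longrightarrow> c' \<le> D \<Longrightarrow> \<exists>!e. e \<in> sedges S \<and> swhite_end S e = Regular w \<and> scolor S e = c'"
    using 6 by blast
  show "c \<in> chain_verts S \<Longrightarrow> \<exists>e\<in>sedges S. {e' \<in> sedges S. swhite_end S e' = Port c s} = {e}"
    using 7 by blast
  show "sroot S = Some e \<Longrightarrow> e \<in> sedges S" using 8 by simp
qed

lemma attachment_valid:
  assumes "is_scheme D S" "e \<in> sedges S"
  shows "swhite_end S e \<in> Regular ` regulars S \<union> (\<Union>c\<in>chain_verts S. range (Port c))"
    "sblack_end S e \<in> Regular ` regulars S \<union> (\<Union>c\<in>chain_verts S. range (Port c))"
  using is_schemeD(5,6)[OF assms] unfolding regulars_def by blast+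

lemma carry_inverse:
  assumes "inj_on f A" "inj_on h B" "a \<in> Regular ` A \<union> (\<Union>c\<in>B. range (Port c))"
  shows "carry_attachment (inv_into A f) (inv_into B h) (\<lambda>_. False) (carry_attachment f h (\<lambda>_. False) a) = a"
  using assms by auto

lemma edge_code_inj:
  assumes S: "is_scheme D S" and f: "inj_on f (regulars S)" and h: "inj_on h (chain_verts S)"
  shows "inj_on (edge_code f h S) (sedges S)"
proof (rule inj_onI)
  fix e e' assume e: "e \<in> sedges S" and e': "e' \<in> sedges S" and eq: "edge_code f h S e = edge_code f h S e'"
  have c: "carry_attachment f h (\<lambda>_. False) (swhite_end S e) = carry_attachment f h (\<lambda>_. False) (swhite_end S e')"
    "scolor S e = scolor S e'" using eq unfolding edge_code_def by (blast dest: Pair_inject)+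
  then have w: "swhite_end S e = swhite_end S e'"
    using carry_inverse[OF f h attachment_valid(1)[OF S e]] carry_inverse[OF f h attachment_valid(1)[OF S e']] by metis
  consider w0 where "w0 \<in> reg_whites S" "swhite_end S e = Regular w0"
    | p s where "p \<in> chain_verts S" "swhite_end S e = Port p s" using is_schemeD(5)[OF S e] by auto
  then show "e = e'"
  proof cases
    case 1
    then show ?thesis using is_schemeD(7)[OF S 1(1) is_schemeD(4)[OF S e]] e e' w c(2) by metis
  next
    case 2
    obtain x where "{e' \<in> sedges S. swhite_end S e' = Port p s} = {x}" using is_schemeD(8)[OF S 2(1)] by blast
    then show ?thesis using e e' w 2(2) by (metis (mono_tags, lifting) mem_Collect_eq singletonD)
  qed
qed

lemma bij_of_images:
  assumes "inj_on f A" "inj_on f' A'" "f ` A = f' ` A'"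
  shows "bij_betw (inv_into A' f' \<circ> f) A A'"
proof -
  have "bij_betw f A (f' ` A')" using assms by (simp add: bij_betw_def)
  moreover have "bij_betw (inv_into A' f') (f' ` A') A'" using assms(2) by (simp add: bij_betw_inv_into inj_on_imp_bij_betw)
  ultimately show ?thesis by (rule bij_betw_trans)
qed

text \<open>Renaming along \<open>f\<close> and back along \<open>f'\<close> gives the isomorphism,
  without reversing any chain. Schemes that differ only in the direction of chains may have
  different codes, but this does no harm to finiteness.\<close>

lemma code_iso:
  assumes S: "is_scheme D S" and T: "is_scheme D T"
    and f: "inj_on f (regulars S)" "inj_on h (chain_verts S)" and f': "inj_on f' (regulars T)" "inj_on h' (chain_verts T)"
    and eq: "code f h S = code f' h' T"
  shows "\<exists>F H \<phi> g. scheme_isomorphism F H \<phi> g S T"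
proof -
  let ?F = "inv_into (regulars T) f' \<circ> f" and ?H = "inv_into (chain_verts T) h' \<circ> h"
  let ?g = "inv_into (sedges T) (edge_code f' h' T) \<circ> edge_code f h S"
  have e: "f ` reg_whites S = f' ` reg_whites T" "f ` reg_blacks S = f' ` reg_blacks T"
    "(\<lambda>c. (h c, chain_type S c)) ` chain_verts S = (\<lambda>c. (h' c, chain_type T c)) ` chain_verts T"
    "edge_code f h S ` sedges S = edge_code f' h' T ` sedges T"
    "map_option (edge_code f h S) (sroot S) = map_option (edge_code f' h' T) (sroot T)"
    using eq by (auto simp: code_def)
  have iS: "inj_on (edge_code f h S) (sedges S)" by (rule edge_code_inj[OF S f])
  have iT: "inj_on (edge_code f' h' T) (sedges T)" by (rule edge_code_inj[OF T f'])
  have "f ` regulars S = f' ` regulars T" using e(1,2) by (simp add: regulars_def image_Un)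
  then have F: "bij_betw ?F (regulars S) (regulars T)" using bij_of_images[OF f(1) f'(1)] by blast
  have "h ` chain_verts S = fst ` ((\<lambda>c. (h c, chain_type S c)) ` chain_verts S)" by force
  also have "\<dots> = h' ` chain_verts T" unfolding e(3) by force
  finally have H: "bij_betw ?H (chain_verts S) (chain_verts T)" using bij_of_images[OF f(2) f'(2)] by blast
  have g: "bij_betw ?g (sedges S) (sedges T)" by (rule bij_of_images[OF iS iT e(4)])
  have Fw: "?F ` reg_whites S = reg_whites T" "?F ` reg_blacks S = reg_blacks T"
    unfolding image_comp[symmetric] e(1,2)
    by (rule inv_into_image_cancel[OF f'(1)], simp add: regulars_def)+
  have ty: "chain_type T (?H c) = chain_type S c" if c: "c \<in> chain_verts S" for c
  proof -
    have "(h c, chain_type S c) \<in> (\<lambda>c. (h' c, chain_type T c)) ` chain_verts T" using c e(3) by blast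
    then obtain c' where c': "c' \<in> chain_verts T" "h c = h' c'" "chain_type S c = chain_type T c'" by auto
    then show ?thesis using f'(2) by simp
  qed
  have cc: "carry_attachment ?F ?H (\<lambda>_. False) a = carry_attachment (inv_into (regulars T) f') (inv_into (chain_verts T) h')
      (\<lambda>_. False) (carry_attachment f h (\<lambda>_. False) a)" for a by (cases a) auto
  have ge: "edge_code f' h' T (?g e) = edge_code f h S e" "?g e \<in> sedges T" if "e \<in> sedges S" for e
  proof -
    have "edge_code f h S e \<in> edge_code f' h' T ` sedges T" using that e(4) by blast
    then show "edge_code f' h' T (?g e) = edge_code f h S e" "?g e \<in> sedges T"
      by (simp_all add: f_inv_into_f inv_into_into)
  qed
  have edge: "scolor T (?g e) = scolor S e \<and> swhite_end T (?g e) = carry_attachment ?F ?H (\<lambda>_. False) (swhite_end S e) \<and>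
      sblack_end T (?g e) = carry_attachment ?F ?H (\<lambda>_. False) (sblack_end S e)" if eS: "e \<in> sedges S" for e
  proof -
    have "scolor T (?g e) = scolor S e"
      "carry_attachment f' h' (\<lambda>_. False) (swhite_end T (?g e)) = carry_attachment f h (\<lambda>_. False) (swhite_end S e)"
      "carry_attachment f' h' (\<lambda>_. False) (sblack_end T (?g e)) = carry_attachment f h (\<lambda>_. False) (sblack_end S e)"
      using ge(1)[OF eS] unfolding edge_code_def by (blast dest: Pair_inject)+
    then show ?thesis
      unfolding cc using carry_inverse[OF f' attachment_valid(1)[OF T ge(2)[OF eS]]]
        carry_inverse[OF f' attachment_valid(2)[OF T ge(2)[OF eS]]] by metis
  qed
  have root: "sroot T = map_option ?g (sroot S)"
  proof (cases "sroot S")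
    case None then show ?thesis using e(5) by simp
  next
    case (Some x)
    then obtain y where y: "sroot T = Some y" "edge_code f h S x = edge_code f' h' T y" using e(5) by (cases "sroot T") auto
    then have "?g x = y" using iT is_schemeD(9)[OF T] by simp
    then show ?thesis using Some y by simp
  qed
  have "scheme_isomorphism ?F ?H (\<lambda>_. False) ?g S T"
    unfolding scheme_isomorphism_def using F H g Fw ty edge root unfolding regulars_def by simp
  then show ?thesis by blast
qed

section \<open>Finitely many classes of schemes of bounded size\<close>

definition bounded_schemes :: "nat \<Rightarrow> nat \<Rightarrow> ('v, 'e, 'c) scheme set" where
  "bounded_schemes D N = {S. is_scheme D S \<and> card (regulars S) \<le> N \<and> card (chain_verts S) \<le> N}"

text \<open>Number the regular vertices and the chain-vertices by numbers below \<open>N\<close>.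
  The codes then lie in a finite set, and by \<open>code_iso\<close> the isomorphism class of a
  scheme is a function of its code.\<close>

lemma finite_bounded_schemes:
  "finite ((bounded_schemes D N :: ('v, 'e, 'c) scheme set) // scheme_iso D)"
proof -
  let ?A = "bounded_schemes D N :: ('v, 'e, 'c) scheme set"
  define nf where "nf = (\<lambda>S :: ('v, 'e, 'c) scheme. SOME f. bij_betw f (regulars S) {0..<card (regulars S)})"
  define nh where "nh = (\<lambda>S :: ('v, 'e, 'c) scheme. SOME h. bij_betw h (chain_verts S) {0..<card (chain_verts S)})"
  have nf: "bij_betw (nf S) (regulars S) {0..<card (regulars S)}" if "S \<in> ?A" for S
    unfolding nf_def by (rule someI_ex[OF ex_bij_betw_finite_nat]) (use that is_schemeD(1) in \<open>auto simp: bounded_schemes_def\<close>)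
  have nh: "bij_betw (nh S) (chain_verts S) {0..<card (chain_verts S)}" if "S \<in> ?A" for S
    unfolding nh_def by (rule someI_ex[OF ex_bij_betw_finite_nat]) (use that is_schemeD(2) in \<open>auto simp: bounded_schemes_def\<close>)
  let ?enc = "\<lambda>S. code (nf S) (nh S) S"
  let ?Att = "Regular ` {..<N} \<union> (\<Union>c<N. range (Port c)) :: (nat, nat) attachment set"
  let ?E = "?Att \<times> {..D} \<times> ?Att"
  let ?Ty = "{t. valid_type D t}"
  have "UNIV = {Left, Right}" using side.exhaust by auto
  then have "finite (UNIV :: side set)" by (metis finite.emptyI finite_insert)
  then have fAtt: "finite ?Att" by simp
  have "?Ty \<subseteq> case_prod Broken ` ({..D} \<times> {..D}) \<union> case_prod UnbrokenDiff ` ({..D} \<times> {..D}) \<union>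
      case_prod UnbrokenSame ` ({..D} \<times> {..D})"
  proof
    fix t assume "t \<in> ?Ty"
    then show "t \<in> case_prod Broken ` ({..D} \<times> {..D}) \<union> case_prod UnbrokenDiff ` ({..D} \<times> {..D}) \<union>
      case_prod UnbrokenSame ` ({..D} \<times> {..D})" by (cases t) force+
  qed
  then have fTy: "finite ?Ty" by (rule finite_subset) auto
  have "?enc ` ?A \<subseteq> Pow {..<N} \<times> Pow {..<N} \<times> Pow ({..<N} \<times> ?Ty) \<times> Pow ?E \<times> insert None (Some ` ?E)"
  proof
    fix z assume "z \<in> ?enc ` ?A"
    then obtain S where S: "S \<in> ?A" "z = ?enc S" by blast
    have sc: "is_scheme D S" "card (regulars S) \<le> N" "card (chain_verts S) \<le> N" using S by (auto simp: bounded_schemes_def)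
    have f: "nf S v < N" if "v \<in> regulars S" for v using bij_betwE[OF nf[OF S(1)]] that sc(2) by fastforce
    have h: "nh S c < N" if "c \<in> chain_verts S" for c using bij_betwE[OF nh[OF S(1)]] that sc(3) by fastforce
    have at: "carry_attachment (nf S) (nh S) (\<lambda>_. False) a \<in> ?Att"
      if "a \<in> Regular ` regulars S \<union> (\<Union>c\<in>chain_verts S. range (Port c))" for a
    proof (cases a)
      case (Port c s)
      then have "nh S c < N" using that h by auto
      then show ?thesis using Port by (auto intro!: UN_I[of "nh S c"])
    qed (use that f in auto)
    have ed: "edge_code (nf S) (nh S) S e \<in> ?E" if "e \<in> sedges S" for e
      using at[OF attachment_valid(1)[OF sc(1) that]] at[OF attachment_valid(2)[OF sc(1) that]] is_schemeD(4)[OF sc(1) that]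
      unfolding edge_code_def by blast
    have r: "map_option (edge_code (nf S) (nh S) S) (sroot S) \<in> insert None (Some ` ?E)"
      using ed is_schemeD(9)[OF sc(1)] by (cases "sroot S") auto
    have "nf S ` reg_whites S \<subseteq> {..<N}" "nf S ` reg_blacks S \<subseteq> {..<N}" using f by (auto simp: regulars_def)
    moreover have "(\<lambda>c. (nh S c, chain_type S c)) ` chain_verts S \<subseteq> {..<N} \<times> ?Ty"
      using h is_schemeD(3)[OF sc(1)] by auto
    moreover have "edge_code (nf S) (nh S) S ` sedges S \<subseteq> ?E" using ed by blast
    ultimately show "z \<in> Pow {..<N} \<times> Pow {..<N} \<times> Pow ({..<N} \<times> ?Ty) \<times> Pow ?E \<times> insert None (Some ` ?E)"
      unfolding S(2) code_def using r by blast
  qed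
  moreover have "finite (Pow {..<N} \<times> Pow {..<N} \<times> Pow ({..<N} \<times> ?Ty) \<times> Pow ?E \<times> insert None (Some ` ?E))"
    using fAtt fTy by (intro finite_cartesian_product) auto
  ultimately have fin: "finite (?enc ` ?A)" by (rule finite_subset)
  define g where "g = (\<lambda>y. scheme_iso D `` {SOME S. S \<in> ?A \<and> ?enc S = y})"
  have "scheme_iso D `` {S} = g (?enc S)" if S: "S \<in> ?A" for S
  proof -
    let ?T = "SOME T. T \<in> ?A \<and> ?enc T = ?enc S"
    have T: "?T \<in> ?A \<and> ?enc ?T = ?enc S" by (rule someI) (use S in simp)
    have "\<exists>F H \<phi> g. scheme_isomorphism F H \<phi> g S ?T"
      by (rule code_iso[of D]) (use S T nf[OF S] nh[OF S] nf[of ?T] nh[of ?T] in \<open>auto simp: bounded_schemes_def bij_betw_def\<close>)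
    then have "(S, ?T) \<in> scheme_iso D" using S T by (auto simp: scheme_iso_def bounded_schemes_def)
    then show ?thesis unfolding g_def using equiv_class_eq[OF equiv_scheme_iso] by blast
  qed
  then have "?A // scheme_iso D \<subseteq> g ` (?enc ` ?A)" unfolding quotient_def by blast
  then show ?thesis using fin finite_subset by blast
qed

lemma schemes_bounded:
  assumes "3 \<le> D"
  shows "\<exists>N. schemes_of_degree D \<delta> \<subseteq> bounded_schemes D N"
proof -
  obtain N0 :: nat where N0: "\<forall>(G :: (nat, nat) graph) e0. rgraph D G e0 \<longrightarrow> degree D G = int \<delta> \<longrightarrow>
     2 * card (verts G) \<le> N0 + card (links {..D} (verts G) (nbr G) (rgraph.R G e0))"
    by (rule exE[OF defect_degree[OF assms, of \<delta>]])
  \<comment> \<open>The summand 4 covers the graphs with at most four vertices, the empty one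
    included, to which \<open>scheme_size\<close> does not apply. There the disjoint chains are
    bounded by the number of vertices, by choosing a vertex in each.\<close>
  let ?N = "(D + 2)\<^sup>2 * N0 + 4"
  have "S \<in> bounded_schemes D ?N" if "S \<in> schemes_of_degree D \<delta>" for S
  proof -
    obtain G where G: "rooted_colored_graph D G" "melon_free D G" "degree D G = int \<delta>" "is_scheme_of D G S"
      using \<open>S \<in> _\<close> by (auto simp: schemes_of_degree_def)
    obtain P where P: "replaced_chains D G P" "S = replace D G P" using G(4) by (auto simp: is_scheme_of_def)
    have sc: "is_scheme D S" using schemes_of_degree_subset[of D \<delta>] assms that by auto
    have reg: "regulars S = verts G - \<Union>(internal_verts ` P)" "chain_verts S = P"
      by (auto simp: P(2) replace_def regulars_def verts_def)
    have ne: "\<exists>v. v \<in> internal_verts p \<and> v \<in> verts G" if "p \<in> P" for p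
    proof -
      have "prechain D G p" using P(1) that by (auto simp: replaced_chains_def maximal_proper_prechain_def proper_prechain_def)
      then have "dipoles p \<noteq> []" "\<forall>(w, b)\<in>set (dipoles p). dipole D G w b" by (simp_all add: prechain_def Let_def)
      moreover obtain w b where wb: "hd (dipoles p) = (w, b)" by fastforce
      ultimately have "(w, b) \<in> set (dipoles p)" "w \<in> whites G" using hd_in_set[of "dipoles p"] by (auto simp: dipole_def)
      then show ?thesis by (force simp: verts_def internal_verts_def)
    qed
    define h :: "(nat, nat) prechain \<Rightarrow> nat" where "h = (\<lambda>p. SOME v. v \<in> internal_verts p \<and> v \<in> verts G)"
    have h: "h p \<in> internal_verts p" "h p \<in> verts G" if "p \<in> P" for p
      using someI_ex[OF ne[OF that]] by (auto simp: h_def)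
    have inj: "inj_on h P"
    proof (rule inj_onI)
      fix p q assume pq: "p \<in> P" "q \<in> P" "h p = h q"
      show "p = q"
      proof (rule ccontr)
        assume "p \<noteq> q"
        then have "internal_verts p \<inter> internal_verts q = {}" using P(1) pq unfolding replaced_chains_def by blast
        then show False using h(1)[OF pq(1)] h(1)[OF pq(2)] pq(3) by auto
      qed
    qed
    have hV: "h ` P \<subseteq> verts G" using h(2) by blast
    have small: "card (regulars S) \<le> card (verts G)" "card P \<le> card (verts G)" if "finite (verts G)"
      using that card_inj_on_le[OF inj hV that] reg(1) by (auto intro: card_mono)
    have "card (regulars S) \<le> ?N \<and> card P \<le> ?N"
    proof (cases "empty_graph G")
      case True
      then show ?thesis using small by (simp add: empty_graph_def)
    next
      case False
      then obtain e0 where e0: "colored_graph D G" "e0 \<in> edges G" "root G = Some e0"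
        using G(1) by (auto simp: rooted_colored_graph_def)
      interpret rgraph D G e0 by unfold_locales (use assms e0 G in auto)
      show ?thesis
      proof (cases "5 \<le> card V")
        case True
        have "2 * card V \<le> N0 + card (links C V \<tau> R)" using N0 rgraph_axioms G(3) by blast
        then have "card nonfull \<le> N0" using nonfull_count[OF marked con True] by linarith
        then have "(D + 2)\<^sup>2 * card nonfull \<le> (D + 2)\<^sup>2 * N0" by (rule mult_le_mono2)
        then show ?thesis using scheme_size(1,2)[OF True P(1)] unfolding reg(1) by (intro conjI; linarith)
      next
        case False
        then show ?thesis using small[OF colored_graphD(1)[OF cg]] by (intro conjI; linarith)
      qed
    qed
    then show ?thesis using sc reg(2) by (simp add: bounded_schemes_def)
  qed
  then show ?thesis by blast
qed

theorem theorem5: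
  fixes D \<delta> :: nat
  assumes "D \<ge> 3"
  shows "finite (schemes_of_degree D \<delta> // scheme_iso D)"
proof -
  obtain N where "schemes_of_degree D \<delta> \<subseteq> bounded_schemes D N" using schemes_bounded[OF assms] by blast
  then have "schemes_of_degree D \<delta> // scheme_iso D \<subseteq> bounded_schemes D N // scheme_iso D"
    unfolding quotient_def by blast
  then show ?thesis using finite_bounded_schemes finite_subset by blast
qed

end
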